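(* Let $d\ge1$, $r,s>0$, and $\theta_i:=\sqrt{\lambda_i}$, $i=1,\dots,d$. Let $h\in\mathcal{C}^2(\mathbb{R}^d)$ be a superharmonic function and let $$f(\theta)=\sum_{a\in\{1,-1\}^d}h(a_1\theta_1,a_2\theta_2,\dots,a_d\theta_d),\qquad \theta\in[0,\infty)^d,$$ be nonnegative and not identically zero. Suppose that for every $z\in\mathbb{N}^d$, $t>0$ and $i\in\{1,\dots,d\}$, $$\int f(\theta)\prod_{j=1}^d\theta_j^{2z_j}e^{-t\theta_j^2}\,\mathrm{d}\theta<\infty,\quad \int\Bigl|\frac{\partial f}{\partial\theta_i}(\theta)\Bigr|\prod_{j=1}^d\theta_j^{2z_j}e^{-t\theta_j^2}\,\mathrm{d}\theta<\infty,\quad \int\Bigl|\frac{\partial^2 f}{\partial\theta_i^2}(\theta)\Bigr|\prod_{j=1}^d\theta_j^{2z_j}e^{-t\theta_j^2}\,\mathrm{d}\theta<\infty$$ (integrals over $[0,\infty)^d$). Then the Bayesian predictive distribution $p_{f,\mathrm J}(y\mid x)$ weakly dominates the Bayesian predictive distribution $p_{\mathrm J}(y\mid x)$ based on the Jeffreys prior. Furthermore, if $F(z,r)$ is not a constant function of $z$ on $\mathbb{N}^d$, then $p_{f,\mathrm J}(y\mid x)$ dominates $p_{\mathrm J}(y\mid x)$.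
   Context: $\mathbb{N}=\{0,1,2,\dots\}$. A function $h\in\mathcal C^2(\mathbb{R}^d)$ is superharmonic if $\sum_i\partial^2h/\partial\theta_i^2\le0$ everywhere. Model: for unknown $\lambda\in(0,\infty)^d$ and known $r,s>0$, $x$ and $y$ are independent with $p(x\mid\lambda)=\prod_{i=1}^d (r\lambda_i)^{x_i}e^{-r\lambda_i}/x_i!$ and $p(y\mid\lambda)=\prod_{i=1}^d (s\lambda_i)^{y_i}e^{-s\lambda_i}/y_i!$, $x,y\in\mathbb{N}^d$. For a (possibly improper) prior density $\pi(\lambda)$, the Bayesian predictive distribution is $p_\pi(y\mid x)=\int p(x\mid\lambda)p(y\mid\lambda)\pi(\lambda)\,\mathrm{d}\lambda\big/\int p(x\mid\lambda)\pi(\lambda)\,\mathrm{d}\lambda$. The Jeffreys prior is $\pi_{\mathrm J}(\lambda)\propto\prod_{i=1}^d\lambda_i^{-1/2}$, with predictive distribution $p_{\mathrm J}$. For nonnegative $f$ on $[0,\infty)^d$, $\pi_{f,\mathrm J}(\lambda)\propto f(\sqrt{\lambda_1},\dots,\sqrt{\lambda_d})\prod_{i=1}^d\lambda_i^{-1/2}$, with predictive distribution $p_{f,\mathrm J}$. The Kullback–Leibler (K-L) risk of a predictive distribution $q(y\mid x)$ at $\lambda$ is $\sum_x p(x\mid\lambda)\sum_y p(y\mid\lambda)\log\frac{p(y\mid\lambda)}{q(y\mid x)}$. $q_1$ weakly dominates $q_2$ if the K-L risk of $q_1$ is at most that of $q_2$ at every $\lambda$; $q_1$ dominates $q_2$ if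 moreover the inequality is strict for some $\lambda$. $$F(z,r)=\int_{(0,\infty)^d} f(\sqrt{\lambda_1},\dots,\sqrt{\lambda_d})\prod_{i=1}^d\frac{r^{z_i+1/2}\lambda_i^{z_i-1/2}e^{-r\lambda_i}}{\Gamma(z_i+1/2)}\,\mathrm{d}\lambda,\quad z\in\mathbb{N}^d.$$ *)

theory Defs
  imports "HOL-Probability.Probability"
begin

definition partial :: "'n \<Rightarrow> (real^'n \<Rightarrow> real) \<Rightarrow> real^'n \<Rightarrow> real" where
  "partial i h \<theta> = deriv (\<lambda>t. h (\<theta> + t *\<^sub>R axis i 1)) 0"

definition has_partials :: "(real^'n \<Rightarrow> real) \<Rightarrow> bool" where
  "has_partials h \<longleftrightarrow> (\<forall>i \<theta>. (\<lambda>t. h (\<theta> + t *\<^sub>R axis i 1)) differentiable (at 0))"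

definition C2 :: "(real^'n \<Rightarrow> real) \<Rightarrow> bool" where
  "C2 h \<longleftrightarrow> continuous_on UNIV h
     \<and> has_partials h \<and> (\<forall>i. continuous_on UNIV (partial i h))
     \<and> (\<forall>i. has_partials (partial i h)) \<and> (\<forall>i j. continuous_on UNIV (partial j (partial i h)))"

text \<open>Only meaningful together with \<open>C2\<close>, since \<open>deriv\<close> is total.\<close>

definition superharmonic :: "(real^'n \<Rightarrow> real) \<Rightarrow> bool" where
  "superharmonic h \<longleftrightarrow> (\<forall>\<theta>. (\<Sum>i\<in>UNIV. partial i (partial i h) \<theta>) \<le> 0)"

definition nonneg_orthant :: "(real^'n) set" where
  "nonneg_orthant = {\<theta>. \<forall>i. 0 \<le> \<theta> $ i}"

definition pos_orthant :: "(real^'n) set" where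
  "pos_orthant = {l. \<forall>i. 0 < l $ i}"

definition sqrt_vec :: "real^'n \<Rightarrow> real^'n" where
  "sqrt_vec l = (\<chi> i. sqrt (l $ i))"

definition poisson_lik :: "real \<Rightarrow> ('n \<Rightarrow> nat) \<Rightarrow> real^'n \<Rightarrow> real" where
  "poisson_lik c x l = (\<Prod>i\<in>UNIV. (c * l $ i) ^ x i * exp (- (c * l $ i)) / fact (x i))"

text \<open>The predictive distribution does not change when the prior is multiplied by a positive
  constant, so the normalisation of the two (possibly improper) priors is fixed arbitrarily.\<close>

definition jeffreys_prior :: "real^'n \<Rightarrow> real" where
  "jeffreys_prior l = (\<Prod>i\<in>UNIV. (l $ i) powr (- (1 / 2)))"

definition weighted_jeffreys_prior :: "(real^'n \<Rightarrow> real) \<Rightarrow> real^'n \<Rightarrow> real" where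
  "weighted_jeffreys_prior f l = f (sqrt_vec l) * jeffreys_prior l"

text \<open>In \<open>predictive r s \<pi> x y\<close>, the observation \<open>x\<close> comes first: it is \<open>p\<^sub>\<pi>(y | x)\<close>.\<close>

definition predictive ::
    "real \<Rightarrow> real \<Rightarrow> (real^'n \<Rightarrow> real) \<Rightarrow> ('n \<Rightarrow> nat) \<Rightarrow> ('n \<Rightarrow> nat) \<Rightarrow> real" where
  "predictive r s \<pi> x y =
     (LINT l:pos_orthant|lborel. poisson_lik r x l * poisson_lik s y l * \<pi> l)
     / (LINT l:pos_orthant|lborel. poisson_lik r x l * \<pi> l)"

text \<open>The sum of a family of extended reals of either sign, as the sum of the positive parts
  minus the sum of the negative parts, so that a divergent risk is \<open>\<infinity>\<close>. For a probability mass
  function \<open>q\<close>, the negative parts in a Kullback--Leibler divergence have a finite sum.\<close>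

definition ext_sum :: "('a \<Rightarrow> ereal) \<Rightarrow> ereal" where
  "ext_sum g =
     enn2ereal (\<integral>\<^sup>+ x. e2ennreal (g x) \<partial>count_space UNIV)
     - enn2ereal (\<integral>\<^sup>+ x. e2ennreal (- g x) \<partial>count_space UNIV)"

text \<open>\<open>log (p / q)\<close> for \<open>p > 0\<close> and \<open>q \<ge> 0\<close>.\<close>

definition log_ratio :: "real \<Rightarrow> real \<Rightarrow> ereal" where
  "log_ratio p q = (if q = 0 then \<infinity> else ereal (ln (p / q)))"

definition KL_risk ::
    "real \<Rightarrow> real \<Rightarrow> (('n::finite \<Rightarrow> nat) \<Rightarrow> ('n \<Rightarrow> nat) \<Rightarrow> real) \<Rightarrow> real^'n \<Rightarrow> ereal" where
  "KL_risk r s q l =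
     ext_sum (\<lambda>x. ereal (poisson_lik r x l)
       * ext_sum (\<lambda>y. ereal (poisson_lik s y l) * log_ratio (poisson_lik s y l) (q x y)))"

definition weakly_dominates ::
    "real \<Rightarrow> real \<Rightarrow> (('n::finite \<Rightarrow> nat) \<Rightarrow> ('n \<Rightarrow> nat) \<Rightarrow> real)
      \<Rightarrow> (('n::finite \<Rightarrow> nat) \<Rightarrow> ('n \<Rightarrow> nat) \<Rightarrow> real) \<Rightarrow> bool" where
  "weakly_dominates r s q1 q2 \<longleftrightarrow> (\<forall>l\<in>pos_orthant. KL_risk r s q1 l \<le> KL_risk r s q2 l)"

definition dominates ::
    "real \<Rightarrow> real \<Rightarrow> (('n::finite \<Rightarrow> nat) \<Rightarrow> ('n \<Rightarrow> nat) \<Rightarrow> real)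
      \<Rightarrow> (('n::finite \<Rightarrow> nat) \<Rightarrow> ('n \<Rightarrow> nat) \<Rightarrow> real) \<Rightarrow> bool" where
  "dominates r s q1 q2 \<longleftrightarrow>
     weakly_dominates r s q1 q2 \<and> (\<exists>l\<in>pos_orthant. KL_risk r s q1 l < KL_risk r s q2 l)"

text \<open>The symmetrisation is defined on all of \<open>\<real>\<^sup>d\<close>; restricted to the nonnegative orthant it is the
  weight \<open>f\<close>, and it provides the partial derivatives of \<open>f\<close> there, boundary points included.\<close>

definition sign_symmetrize :: "(real^'n \<Rightarrow> real) \<Rightarrow> real^'n \<Rightarrow> real" where
  "sign_symmetrize h \<theta> = (\<Sum>a\<in>PiE UNIV (\<lambda>_. {1, -1}). h (\<chi> i. a i * \<theta> $ i))"

definition gauss_moment :: "('n \<Rightarrow> nat) \<Rightarrow> real \<Rightarrow> real^'n \<Rightarrow> real" where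
  "gauss_moment z t \<theta> = (\<Prod>j\<in>UNIV. (\<theta> $ j) ^ (2 * z j) * exp (- (t * (\<theta> $ j)\<^sup>2)))"

definition gamma_average :: "(real^'n \<Rightarrow> real) \<Rightarrow> ('n \<Rightarrow> nat) \<Rightarrow> real \<Rightarrow> real" where
  "gamma_average f z r =
     (LINT l:pos_orthant|lborel. f (sqrt_vec l) *
        (\<Prod>i\<in>UNIV. r powr (real (z i) + 1 / 2) * (l $ i) powr (real (z i) - 1 / 2)
            * exp (- (r * l $ i)) / Gamma (real (z i) + 1 / 2)))"

end

theory Submission imports Defs begin

text \<open>With \<open>\<lambda>\<^sub>i = \<theta>\<^sub>i\<^sup>2\<close> the Jeffreys prior becomes Lebesgue measure, and both predictive distributions
  are ratios of Gaussian moments of the even function \<open>f\<close>. Writing \<open>F(z, t)\<close> for the gamma average, the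
  difference of the two risks is \<open>E ln F(x + y, r + s) - E ln F(x, r)\<close>. Given \<open>x + y = n\<close>, the observation
  \<open>x\<close> is binomial with parameter \<open>r / (r + s)\<close>, whatever \<open>\<lambda>\<close> is, so by Jensen's inequality it suffices
  that the binomial average of \<open>F(x, t)\<close> with parameter \<open>t / T\<close> and \<open>T = r + s\<close> is at most its value
  \<open>F(n, T)\<close> at \<open>t = T\<close>. It is increasing in \<open>t\<close>: the averaged kernel solves the backward heat equation
  \<open>\<partial>\<^sub>t H = - \<Delta> H / (4 t\<^sup>2)\<close>, and \<open>\<integral> f \<Delta> H = \<integral> (\<Delta> f) H \<le> 0\<close>. The boundary terms of this integration by
  parts vanish because the even extension of \<open>f\<close> lives on the whole space, where the integral of a
  directional derivative is zero by translation invariance. If \<open>F(\<cdot>, r)\<close> is not constant, Jensen's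
  inequality is strict for some \<open>n\<close>.\<close>

subsection \<open>Square substitution\<close>

text \<open>Why a heat equation appears: in one coordinate the normalised kernel
  \<open>kern 0 t\<close> is the Gaussian heat kernel at time tau = 1 / (4 t). Since d tau / dt = -
  1 / (4 t^2), the stated equation is the ordinary heat equation in tau. Lowering t from r + s to r
  spreads the kernel of F(n, r + s) by heat flow, and the binomial average with parameter t / T is
  what expresses the spread kernel again through kernels with integer index. The average of a
  superharmonic weight can only decrease under this flow.

  The other obstacle is analytic. The risks are sums of extended reals of either sign, so
  subtracting them and regrouping by the total x + y requires absolute summability. It comes from a
  crude bound |ln moment| \<le> C 4^(z_1 + ... + z_d), which Poisson weights absorb. The integral
  over t is handled by Fubini with an explicit polynomial-times-Gaussian envelope instead of
  differentiation under the integral sign.\<close>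

lemma Basis_vec_eq: "(Basis :: (real^'n) set) = range (\<lambda>i. axis i 1)"
  by (auto simp: Basis_vec_def)

lemma nn_integral_lborel_vec_prod:
  fixes g :: "'n::finite \<Rightarrow> real \<Rightarrow> ennreal"
  assumes [measurable]: "\<And>i. g i \<in> borel_measurable borel"
  shows "(\<integral>\<^sup>+\<theta>. (\<Prod>i\<in>UNIV. g i ((\<theta>::real^'n) $ i)) \<partial>lborel) = (\<Prod>i\<in>UNIV. \<integral>\<^sup>+x. g i x \<partial>lborel)"
proof -
  have inj: "inj (\<lambda>i::'n. axis i (1::real))"
    by (auto simp: inj_def axis_eq_axis)
  have "(\<integral>\<^sup>+\<theta>. (\<Prod>b\<in>Basis. g (axis_index b) ((\<theta>::real^'n) \<bullet> b)) \<partial>lborel)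
      = (\<Prod>b\<in>Basis. \<integral>\<^sup>+x. g (axis_index (b::real^'n)) x \<partial>lborel)"
    by (rule nn_integral_lborel_prod) auto
  then show ?thesis
    by (simp add: Basis_vec_eq prod.reindex[OF inj] o_def inner_axis)
qed

lemma vec_nth_borel_measurable [measurable]: "(\<lambda>x::real^'n. x $ i) \<in> borel_measurable borel"
  by (intro borel_measurable_continuous_onI continuous_intros)

lemma vec_lambda_borel_measurable [measurable]:
  fixes f :: "'n::finite \<Rightarrow> 'a \<Rightarrow> real"
  assumes "\<And>i. f i \<in> borel_measurable M"
  shows "(\<lambda>x. \<chi> i. f i x) \<in> borel_measurable M"
  unfolding borel_measurable_euclidean_space[where 'c = "real^'n"]
  using assms by (auto simp: Basis_vec_eq inner_axis)

lemma pos_orthant_borel [measurable]: "(pos_orthant :: (real^'n) set) \<in> sets borel"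
proof -
  have "(pos_orthant :: (real^'n) set) = {l\<in>space borel. \<forall>i\<in>UNIV. 0 < l $ i}"
    by (auto simp: pos_orthant_def)
  also have "\<dots> \<in> sets borel" by measurable
  finally show ?thesis .
qed

lemma nonneg_orthant_borel [measurable]: "(nonneg_orthant :: (real^'n) set) \<in> sets borel"
proof -
  have "(nonneg_orthant :: (real^'n) set) = {l\<in>space borel. \<forall>i\<in>UNIV. 0 \<le> l $ i}"
    by (auto simp: nonneg_orthant_def)
  also have "\<dots> \<in> sets borel" by measurable
  finally show ?thesis .
qed

lemma jeffreys_prior_borel [measurable]: "jeffreys_prior \<in> borel_measurable borel"
  unfolding jeffreys_prior_def[abs_def] by measurable

text \<open>Each l > 0 has two square roots, and either branch contributes the density 1 / (2 sqrt
  l). The two halves add up to l^(-1/2), so the Jeffreys weight appears without a constant.\<close>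

lemma square_pushforward_interval:
  fixes a b :: real
  shows "(\<integral>\<^sup>+x. indicator {a<..<b} (x\<^sup>2) \<partial>lborel)
       = (\<integral>\<^sup>+l. ennreal (indicator {0<..} l * l powr (- (1/2))) * indicator {a<..<b} l \<partial>lborel)"
proof (cases "b \<le> 0")
  case True
  have 1: "indicator {a<..<b} (x\<^sup>2) = (0::ennreal)" for x
    using True by (smt (verit) greaterThanLessThan_iff indicator_simps(2) zero_le_power2)
  have 2: "ennreal (indicator {0<..} l * l powr (- (1/2))) * indicator {a<..<b} l = 0" for l
    using True by (auto simp: indicator_def)
  show ?thesis by (simp add: 1 2)
next
  case False
  then have b: "b > 0" by simp
  define f where "f l = ennreal (indicator {0<..} l * l powr (- (1/2))) * indicator {a<..<b} l" for l
  have f[measurable]: "f \<in> borel_measurable borel" unfolding f_def by measurable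
  have reflect: "(\<integral>\<^sup>+x. indicator {a<..<b} (x\<^sup>2) * indicator {0<..} x \<partial>lborel)
      = (\<integral>\<^sup>+x. indicator {a<..<b} (x\<^sup>2) * indicator {..<0::real} x \<partial>lborel)"
    by (subst nn_integral_real_affine[where c="-1" and t=0]) (auto simp: indicator_def intro!: nn_integral_cong)
  \<comment> \<open>Cutting at b changes nothing, as \<open>f\<close> vanishes beyond b. It makes
    the domain the image of the compact interval from 0 to sqrt b, on which squaring is
    monotone.\<close>
  have "(\<integral>\<^sup>+l. f l \<partial>lborel) = (\<integral>\<^sup>+l. f l * indicator {0\<^sup>2..(sqrt b)\<^sup>2} l \<partial>lborel)"
    using b by (intro nn_integral_cong) (auto simp: f_def indicator_def)
  also have "\<dots> = (\<integral>\<^sup>+x. f (x\<^sup>2) * ennreal (2 * x) * indicator {0..sqrt b} x \<partial>lborel)"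
    using b by (intro nn_integral_substitution_aux[where g = "\<lambda>x. x\<^sup>2"])
      (auto intro!: derivative_eq_intros continuous_intros)
  also have "\<dots> = (\<integral>\<^sup>+x. 2 * (indicator {a<..<b} (x\<^sup>2) * indicator {0<..} x) \<partial>lborel)"
  proof (intro nn_integral_cong)
    fix x :: real
    show "f (x\<^sup>2) * ennreal (2 * x) * indicator {0..sqrt b} x = 2 * (indicator {a<..<b} (x\<^sup>2) * indicator {0<..} x)"
    proof (cases "0 < x \<and> a < x\<^sup>2 \<and> x\<^sup>2 < b")
      case True
      then have "x \<le> sqrt b" by (intro real_le_rsqrt) auto
      then have i: "indicator {0..sqrt b} x = (1::ennreal)" "indicator {a<..<b} (x\<^sup>2) = (1::ennreal)"
        "indicator {0<..} x = (1::ennreal)"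
        using True by auto
      have f: "f (x\<^sup>2) = ennreal (x\<^sup>2 powr (- (1/2)))"
      proof -
        have "indicator {0<..} (x\<^sup>2) = (1::real)" using True by (intro indicator_simps(1)) simp
        then show ?thesis unfolding f_def i by (simp only: mult_1 mult_1_right)
      qed
      have "x\<^sup>2 powr (- (1/2)) = 1 / x"
        using True by (subst powr_minus, subst powr_half_sqrt) (simp_all add: field_simps)
      then have v: "x\<^sup>2 powr (- (1/2)) * (2 * x) = 2"
        using True by simp
      have "f (x\<^sup>2) * ennreal (2 * x) = ennreal (x\<^sup>2 powr (- (1/2)) * (2 * x))"
        unfolding f using True by (intro ennreal_mult''[symmetric]) simp
      then show ?thesis unfolding v i by simp
    next
      case False
      then show ?thesis
        by (auto simp: f_def indicator_def)
    qed
  qed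
  also have "\<dots> = 2 * (\<integral>\<^sup>+x. indicator {a<..<b} (x\<^sup>2) * indicator {0<..} x \<partial>lborel)"
    by (intro nn_integral_cmult) measurable
  also have "\<dots> = (\<integral>\<^sup>+x. indicator {a<..<b} (x\<^sup>2) * indicator {0<..} x \<partial>lborel)
       + (\<integral>\<^sup>+x. indicator {a<..<b} (x\<^sup>2) * indicator {0<..} x \<partial>lborel)"
    by (simp add: mult_2)
  also have "\<dots> = (\<integral>\<^sup>+x. indicator {a<..<b} (x\<^sup>2) * indicator {0<..} x \<partial>lborel)
       + (\<integral>\<^sup>+x. indicator {a<..<b} (x\<^sup>2) * indicator {..<0} x \<partial>lborel)"
    by (simp only: reflect)
  also have "\<dots> = (\<integral>\<^sup>+x. indicator {a<..<b} (x\<^sup>2) * indicator {0<..} x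
        + indicator {a<..<b} (x\<^sup>2) * indicator {..<0} x \<partial>lborel)"
    by (intro nn_integral_add[symmetric]) measurable
  \<comment> \<open>The point 0 lies in neither half-line and is a null set.\<close>
  also have "\<dots> = (\<integral>\<^sup>+x. indicator {a<..<b} (x\<^sup>2) \<partial>lborel)"
    by (intro nn_integral_cong_AE AE_I[where N="{0}"]) (auto simp: indicator_def)
  finally show ?thesis by (simp add: f_def)
qed

text \<open>Boxes form an intersection-stable generator, and on a box both measures factor over the
  coordinates, which reduces the claim to \<open>square_pushforward_interval\<close>.\<close>

lemma distr_lborel_square:
  "distr lborel borel (\<lambda>\<theta>::real^'n. \<chi> i. (\<theta> $ i)\<^sup>2)
     = density lborel (\<lambda>l. ennreal (indicator pos_orthant l * jeffreys_prior l))"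
    (is "?L = ?R")
proof -
  let ?w = "\<lambda>l::real. ennreal (indicator {0<..} l * l powr (- (1/2)))"
  have w: "ennreal (indicator pos_orthant l * jeffreys_prior l) = (\<Prod>i\<in>UNIV. ?w (l $ i))" for l :: "real^'n"
  proof (cases "l \<in> pos_orthant")
    case True
    then show ?thesis
      by (subst prod_ennreal) (auto simp: jeffreys_prior_def pos_orthant_def)
  next
    case False
    then obtain i where "\<not> 0 < l $ i" by (auto simp: pos_orthant_def)
    then have "(\<Prod>i\<in>UNIV. ?w (l $ i)) = 0" by (intro prod_zero bexI[of _ i]) auto
    with False show ?thesis by simp
  qed
  have box: "indicator (box l u) x = (\<Prod>i\<in>UNIV. indicator {l $ i<..<u $ i} (x $ i) :: ennreal)" for l u x :: "real^'n"
    by (auto simp: mem_box_cart indicator_def prod_zero_iff)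
  have L: "emeasure ?L (box l u) = (\<Prod>i\<in>UNIV. \<integral>\<^sup>+x. indicator {l $ i<..<u $ i} (x\<^sup>2) \<partial>lborel)" for l u
  proof -
    have "emeasure ?L (box l u) = (\<integral>\<^sup>+x. indicator (box l u) x \<partial>?L)" by simp
    also have "\<dots> = (\<integral>\<^sup>+\<theta>. indicator (box l u) (\<chi> i. (\<theta> $ i)\<^sup>2) \<partial>lborel)"
      by (subst nn_integral_distr) auto
    also have "\<dots> = (\<Prod>i\<in>UNIV. \<integral>\<^sup>+x. indicator {l $ i<..<u $ i} (x\<^sup>2) \<partial>lborel)"
      unfolding box by (subst nn_integral_lborel_vec_prod[symmetric]) auto
    finally show ?thesis .
  qed
  have R: "emeasure ?R (box l u) = (\<Prod>i\<in>UNIV. \<integral>\<^sup>+x. ?w x * indicator {l $ i<..<u $ i} x \<partial>lborel)" for l u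
    unfolding w by (subst nn_integral_lborel_vec_prod[symmetric])
       (auto simp: emeasure_density box prod.distrib)
  show ?thesis
  proof (rule measure_eqI_generator_eq)
    let ?E = "range (\<lambda>(a, b). box a b :: (real^'n) set)"
    let ?A = "\<lambda>n::nat. box (- (real n *\<^sub>R One)) (real n *\<^sub>R One) :: (real^'n) set"
    show "Int_stable ?E"
      by (auto simp: Int_stable_def box_Int_box)
    show "?E \<subseteq> Pow UNIV" "sets ?L = sigma_sets UNIV ?E" "sets ?R = sigma_sets UNIV ?E"
      by (simp_all add: borel_eq_box)
    show "range ?A \<subseteq> ?E" "(\<Union>i. ?A i) = UNIV"
      unfolding UN_box_eq_UNIV by auto
    show "emeasure ?L X = emeasure ?R X" if "X \<in> ?E" for X
      using that by (auto simp: L R square_pushforward_interval)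
    \<comment> \<open>Uniqueness from a generator needs finite measure on an exhausting sequence;
      the preimage of a bounded interval under squaring is bounded.\<close>
    show "emeasure ?L (?A n) \<noteq> \<infinity>" for n
    proof -
      have "(\<integral>\<^sup>+x. indicator {a<..<b} (x\<^sup>2) \<partial>lborel) < \<infinity>" for a b :: real
      proof -
        have "(\<integral>\<^sup>+x. indicator {a<..<b} (x\<^sup>2) \<partial>lborel) \<le> (\<integral>\<^sup>+x. indicator {- sqrt (max b 0)..sqrt (max b 0)} x \<partial>lborel)"
          apply (intro nn_integral_mono)
          apply (auto simp: indicator_def)
           apply (smt (verit) real_le_rsqrt power2_minus)
          by (smt (verit) real_le_rsqrt)
        also have "\<dots> < \<infinity>" by (auto simp add: emeasure_lborel_Icc_eq)
        finally show ?thesis .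
      qed
      then show ?thesis unfolding L by (simp add: ennreal_prod_eq_top less_top)
    qed
  qed
qed

lemma integral_square:
  fixes g :: "real^'n \<Rightarrow> real"
  assumes [measurable]: "g \<in> borel_measurable borel"
  shows "(LINT l:pos_orthant|lborel. g l * jeffreys_prior l) = (LINT \<theta>|lborel. g (\<chi> i. (\<theta> $ i)\<^sup>2))"
proof -
  have nn: "0 \<le> indicator pos_orthant l * jeffreys_prior l" for l :: "real^'n"
    by (auto simp: jeffreys_prior_def intro!: prod_nonneg mult_nonneg_nonneg)
  have "(LINT \<theta>|lborel. g (\<chi> i. (\<theta> $ i)\<^sup>2)) = (LINT l|distr lborel borel (\<lambda>\<theta>::real^'n. \<chi> i. (\<theta> $ i)\<^sup>2). g l)"
    by (rule integral_distr[symmetric]) measurable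
  also have "\<dots> = (LINT l|lborel. (indicator pos_orthant l * jeffreys_prior l) *\<^sub>R g l)"
    unfolding distr_lborel_square using nn
    by (intro integral_density) (auto simp: )
  finally show ?thesis
    by (simp add: set_lebesgue_integral_def mult_ac)
qed

subsection \<open>Gaussian moments\<close>

text \<open>Over the whole space, not the orthant: for an even \<open>g\<close> this is exactly the
  integral against the Jeffreys prior, because the weight l^(-1/2) already counts both square roots
  in each coordinate.\<close>

definition moment :: "(real^'n \<Rightarrow> real) \<Rightarrow> ('n \<Rightarrow> nat) \<Rightarrow> real \<Rightarrow> real" where
  "moment g z t = (LINT \<theta>|lborel. g \<theta> * gauss_moment z t \<theta>)"

text \<open>For t > 0, the reciprocal of the integral of x^(2k) exp (- t x^2) over the real
  line.\<close>

definition gamma_const :: "nat \<Rightarrow> real \<Rightarrow> real" where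
  "gamma_const k t = t powr (real k + 1 / 2) / Gamma (real k + 1 / 2)"

lemma gamma_const_pos: "t > 0 \<Longrightarrow> gamma_const k t > 0"
  by (simp add: gamma_const_def)

lemma gauss_moment_borel [measurable]: "gauss_moment z t \<in> borel_measurable borel"
  unfolding gauss_moment_def[abs_def] by measurable

lemma sqrt_vec_borel [measurable]: "sqrt_vec \<in> borel_measurable borel"
  unfolding sqrt_vec_def[abs_def] by measurable

lemma gauss_moment_nonneg: "0 \<le> gauss_moment z t \<theta>"
  by (auto simp: gauss_moment_def intro!: prod_nonneg)

lemma powr_minus_half: "x > 0 \<Longrightarrow> x powr (real k - 1 / 2) = x ^ k * x powr (- (1 / 2))"
  by (metis powr_add powr_realpow uminus_add_conv_diff add.commute)

text \<open>The one change of variables behind the numerator and the denominator of a predictive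
  distribution and behind \<open>gamma_average\<close>. Evenness enters because
  \<open>sqrt_vec\<close> of the squared coordinates returns their absolute values.\<close>

lemma integral_jeffreys_eq_moment:
  fixes g :: "real^'n \<Rightarrow> real"
  assumes [measurable]: "g \<in> borel_measurable borel"
    and even: "\<And>\<theta>. g (\<chi> i. \<bar>\<theta> $ i\<bar>) = g \<theta>"
    and eq: "\<And>l. l \<in> pos_orthant \<Longrightarrow>
        q l = c * (g (sqrt_vec l) * (\<Prod>i\<in>UNIV. (l $ i) ^ z i * exp (- (t * l $ i)))) * jeffreys_prior l"
  shows "(LINT l:pos_orthant|lborel. q l) = c * moment g z t"
proof -
  have "(LINT l:pos_orthant|lborel. q l) = (LINT l:pos_orthant|lborel.
     c * (g (sqrt_vec l) * (\<Prod>i\<in>UNIV. (l $ i) ^ z i * exp (- (t * l $ i)))) * jeffreys_prior l)"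
    by (intro set_lebesgue_integral_cong) (auto simp: eq)
  also have "\<dots> = (LINT \<theta>|lborel. c * (g (sqrt_vec (\<chi> i. (\<theta> $ i)\<^sup>2))
      * (\<Prod>i\<in>UNIV. ((\<chi> i. (\<theta> $ i)\<^sup>2) $ i) ^ z i * exp (- (t * (\<chi> i. (\<theta> $ i)\<^sup>2) $ i)))))"
    by (rule integral_square) measurable
  also have "\<dots> = (LINT \<theta>|lborel. c * (g \<theta> * gauss_moment z t \<theta>))"
    by (simp add: sqrt_vec_def gauss_moment_def even power_mult)
  finally show ?thesis by (simp add: moment_def)
qed

text \<open>The factors r^x / x! occur in numerator and denominator and cancel. What remains outside
  the moments depends on s and y only, hence is the same for every weight \<open>g\<close>.\<close>

lemma predictive_eq_moment:
  fixes g :: "real^'n \<Rightarrow> real"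
  assumes [measurable]: "g \<in> borel_measurable borel"
    and even: "\<And>\<theta>. g (\<chi> i. \<bar>\<theta> $ i\<bar>) = g \<theta>" and r: "r > 0"
  shows "predictive r s (weighted_jeffreys_prior g) x y
    = (\<Prod>i\<in>UNIV. s ^ y i / fact (y i)) * moment g (\<lambda>i. x i + y i) (r + s) / moment g x r"
proof -
  have 1: "(LINT l:pos_orthant|lborel. poisson_lik r x l * weighted_jeffreys_prior g l)
      = (\<Prod>i\<in>UNIV. r ^ x i / fact (x i)) * moment g x r"
    by (rule integral_jeffreys_eq_moment)
      (auto simp: even poisson_lik_def weighted_jeffreys_prior_def prod.distrib[symmetric] power_mult_distrib
         intro!: prod.cong)
  have 2: "(LINT l:pos_orthant|lborel. poisson_lik r x l * poisson_lik s y l * weighted_jeffreys_prior g l)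
      = ((\<Prod>i\<in>UNIV. r ^ x i / fact (x i)) * (\<Prod>i\<in>UNIV. s ^ y i / fact (y i)))
        * moment g (\<lambda>i. x i + y i) (r + s)"
  proof (rule integral_jeffreys_eq_moment, goal_cases)
    case (3 l)
    have "poisson_lik r x l * poisson_lik s y l = ((\<Prod>i\<in>UNIV. r ^ x i / fact (x i)) * (\<Prod>i\<in>UNIV. s ^ y i / fact (y i)))
       * (\<Prod>i\<in>UNIV. (l $ i) ^ (x i + y i) * exp (- ((r + s) * l $ i)))"
      unfolding poisson_lik_def prod.distrib[symmetric]
      by (intro prod.cong refl) (simp add: power_mult_distrib power_add exp_add[symmetric] algebra_simps)
    then show ?case by (simp add: weighted_jeffreys_prior_def)
  qed (auto simp: even)
  have "(\<Prod>i\<in>UNIV. r ^ x i / fact (x i)) \<noteq> 0"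
    using r by (simp add: prod_zero_iff)
  then show ?thesis
    unfolding predictive_def 1 2 by (simp only: mult.assoc) (rule nonzero_mult_divide_mult_cancel_left)
qed

text \<open>Lets a single risk formula serve both predictive distributions.\<close>

lemma jeffreys_prior_eq_weighted: "jeffreys_prior = weighted_jeffreys_prior (\<lambda>_. 1)"
  by (auto simp: weighted_jeffreys_prior_def)

lemma gamma_average_eq_moment:
  fixes g :: "real^'n \<Rightarrow> real"
  assumes [measurable]: "g \<in> borel_measurable borel"
    and even: "\<And>\<theta>. g (\<chi> i. \<bar>\<theta> $ i\<bar>) = g \<theta>"
  shows "gamma_average g z r = (\<Prod>i\<in>UNIV. gamma_const (z i) r) * moment g z r"
  unfolding gamma_average_def
proof (rule integral_jeffreys_eq_moment, goal_cases)
  case (3 l)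
  then have "(\<Prod>i\<in>UNIV. r powr (real (z i) + 1 / 2) * (l $ i) powr (real (z i) - 1 / 2)
            * exp (- (r * l $ i)) / Gamma (real (z i) + 1 / 2))
      = (\<Prod>i\<in>UNIV. gamma_const (z i) r) * (\<Prod>i\<in>UNIV. (l $ i) ^ z i * exp (- (r * l $ i))) * jeffreys_prior l"
    unfolding jeffreys_prior_def prod.distrib[symmetric]
    by (intro prod.cong refl)
       (simp add: gamma_const_def pos_orthant_def powr_minus_half)
  then show ?case by (simp add: mult_ac)
qed (auto simp: even)

text \<open>Squaring turns each coordinate integral into a Gamma integral with its variable rescaled
  by t. Working with nonnegative extended integrals yields finiteness and the value
  together.\<close>

lemma nn_integral_gauss_moment:
  fixes z :: "'n::finite \<Rightarrow> nat"
  assumes t: "t > 0"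
  shows "(\<integral>\<^sup>+\<theta>. ennreal (gauss_moment z t \<theta>) \<partial>lborel) = ennreal (\<Prod>i\<in>UNIV. 1 / gamma_const (z i) t)"
proof -
  let ?h = "\<lambda>(l::real^'n). (\<Prod>i\<in>UNIV. ennreal ((l $ i) ^ z i * exp (- (t * l $ i))))"
  have 1: "ennreal (gauss_moment z t \<theta>) = ?h (\<chi> i. (\<theta> $ i)\<^sup>2)" for \<theta> :: "real^'n"
    by (subst prod_ennreal) (auto simp: gauss_moment_def power_mult)
  have "(\<integral>\<^sup>+\<theta>. ennreal (gauss_moment z t \<theta>) \<partial>lborel)
      = (\<integral>\<^sup>+l. ?h l \<partial>distr lborel borel (\<lambda>\<theta>::real^'n. \<chi> i. (\<theta> $ i)\<^sup>2))"
    unfolding 1 by (rule nn_integral_distr[symmetric]) measurable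
  also have "\<dots> = (\<integral>\<^sup>+l. ennreal (indicator pos_orthant l * jeffreys_prior l) * ?h l \<partial>lborel)"
    unfolding distr_lborel_square by (rule nn_integral_density) measurable
  also have "\<dots> = (\<integral>\<^sup>+l. (\<Prod>i\<in>UNIV. ennreal (indicator {0<..} (l $ i) * (l $ i) powr (- (1/2)) * (l $ i) ^ z i * exp (- (t * l $ i)))) \<partial>lborel)"
  proof (rule nn_integral_cong)
    fix l :: "real^'n"
    show "ennreal (indicator pos_orthant l * jeffreys_prior l) * ?h l
      = (\<Prod>i\<in>UNIV. ennreal (indicator {0<..} (l $ i) * (l $ i) powr (- (1/2)) * (l $ i) ^ z i * exp (- (t * l $ i))))"
    proof (cases "l \<in> pos_orthant")
      case True
      then show ?thesis
        by (subst (1 2) prod_ennreal)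
          (auto simp: pos_orthant_def less_imp_le jeffreys_prior_def ennreal_mult'[symmetric] prod_nonneg
             prod.distrib mult_ac intro!: arg_cong[where f=ennreal])
    next
      case False
      then obtain i where "\<not> 0 < l $ i" by (auto simp: pos_orthant_def)
      then have "(\<Prod>i\<in>UNIV. ennreal (indicator {0<..} (l $ i) * (l $ i) powr (- (1/2)) * (l $ i) ^ z i * exp (- (t * l $ i)))) = 0"
        by (intro prod_zero bexI[of _ i]) auto
      with False show ?thesis by (simp only:) simp
    qed
  qed
  also have "\<dots> = (\<Prod>i\<in>UNIV. \<integral>\<^sup>+x. ennreal (indicator {0<..} x * x powr (- (1/2)) * x ^ z i * exp (- (t * x))) \<partial>lborel)"
    by (rule nn_integral_lborel_vec_prod) measurable
  also have "\<dots> = (\<Prod>i\<in>UNIV. ennreal (1 / gamma_const (z i) t))"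
  proof (intro prod.cong refl)
    fix i
    let ?k = "z i" let ?a = "real ?k + 1/2"
    have "ennreal (Gamma ?a) = (\<integral>\<^sup>+x. ennreal (indicator {0..} x * x powr (?a - 1) / exp x) \<partial>lborel)"
      by (rule Gamma_conv_nn_integral_real) simp
    also have "\<dots> = ennreal t * (\<integral>\<^sup>+x. ennreal (indicator {0..} (0 + t * x) * (0 + t * x) powr (?a - 1) / exp (0 + t * x)) \<partial>lborel)"
      using t by (subst nn_integral_real_affine[where c=t and t=0]) auto
    also have "\<dots> = ennreal t * (\<integral>\<^sup>+x. ennreal (t powr (?a - 1)) * ennreal (indicator {0<..} x * x powr (- (1/2)) * x ^ ?k * exp (- (t * x))) \<partial>lborel)"
    proof (intro arg_cong2[where f="(*)"] refl nn_integral_cong_AE AE_I[where N="{0}"], safe)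
      fix x :: real
      assume H: "ennreal (indicator {0..} (0 + t * x) * (0 + t * x) powr (?a - 1) / exp (0 + t * x)) \<noteq> 
        ennreal (t powr (?a - 1)) * ennreal (indicator {0<..} x * x powr (- (1/2)) * x ^ ?k * exp (- (t * x)))" "x \<notin> {}"
      show "x = 0"
      proof (rule ccontr)
        assume "x \<noteq> 0"
        consider "x < 0" | "x > 0" using \<open>x \<noteq> 0\<close> by linarith
        then have "ennreal (indicator {0..} (0 + t * x) * (0 + t * x) powr (?a - 1) / exp (0 + t * x)) =
          ennreal (t powr (?a - 1)) * ennreal (indicator {0<..} x * x powr (- (1/2)) * x ^ ?k * exp (- (t * x)))"
        proof cases
          case 1
          then have "\<not> 0 \<le> t * x" using t by (simp add: zero_le_mult_iff)
          with 1 show ?thesis by (simp add: indicator_def)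
        next
          case 2
          have "x powr (?a - 1) = x powr (- (1/2)) * x ^ ?k"
            using powr_minus_half[OF 2, of ?k] by (simp add: mult.commute)
          with 2 t show ?thesis
            by (simp add: ennreal_mult'[symmetric] powr_mult exp_minus field_simps)
        qed
        with H(1) show False by simp
      qed
    qed auto
    also have "\<dots> = ennreal t * (ennreal (t powr (?a - 1)) * (\<integral>\<^sup>+x. ennreal (indicator {0<..} x * x powr (- (1/2)) * x ^ ?k * exp (- (t * x))) \<partial>lborel))" (is "_ = _ * (_ * ?I)")
      by (subst nn_integral_cmult) auto
    also have "\<dots> = ennreal (t * t powr (?a - 1)) * ?I"
      using t by (simp add: ennreal_mult' mult_ac)
    also have "t * t powr (?a - 1) = t powr ?a"
      using t by (subst powr_mult_base) (simp_all add: algebra_simps)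
    finally have "ennreal (1 / t powr ?a) * ennreal (Gamma ?a) = ennreal (1 / t powr ?a) * (ennreal (t powr ?a) * ?I)"
      by simp
    also have "\<dots> = ?I"
      using t by (subst mult.assoc[symmetric]) (simp add: ennreal_mult'[symmetric])
    finally show "?I = ennreal (1 / gamma_const (z i) t)"
      using t by (simp add: ennreal_mult'[symmetric] gamma_const_def)
  qed
  also have "\<dots> = ennreal (\<Prod>i\<in>UNIV. 1 / gamma_const (z i) t)"
    using t by (subst prod_ennreal) (auto simp: gamma_const_pos less_imp_le)
  finally show ?thesis .
qed

lemma
  fixes z :: "'n::finite \<Rightarrow> nat"
  assumes t: "t > 0"
  shows integrable_gauss_moment: "integrable lborel (gauss_moment z t)"
    and moment_one: "moment (\<lambda>_. 1) z t = (\<Prod>i\<in>UNIV. 1 / gamma_const (z i) t)"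
proof -
  have p: "(\<Prod>i\<in>UNIV. 1 / gamma_const (z i) t) \<ge> 0"
    using t by (intro prod_nonneg) (auto simp: gamma_const_pos less_imp_le)
  have "has_bochner_integral lborel (gauss_moment z t) (\<Prod>i\<in>UNIV. 1 / gamma_const (z i) t)"
    using nn_integral_gauss_moment[OF t, of z] gauss_moment_nonneg[of z t] p
    by (intro has_bochner_integral_nn_integral) auto
  then show "integrable lborel (gauss_moment z t)" "moment (\<lambda>_. 1) z t = (\<Prod>i\<in>UNIV. 1 / gamma_const (z i) t)"
    by (auto simp: has_bochner_integral_iff moment_def)
qed

subsection \<open>Integration by parts on the whole space\<close>

lemma prod_nonneg_UNIV: "(\<And>i. 0 \<le> f i) \<Longrightarrow> 0 \<le> (\<Prod>i\<in>UNIV. f i :: real)"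
  by (simp add: prod_nonneg)

text \<open>Integrate v(\<theta> + s e) over \<theta> and over s in [0, 1]. Doing s first gives
  u(\<theta> + e) - u(\<theta>), whose integral is 0 by translation invariance; doing \<theta> first
  gives the integral of v. Integrability of u and v takes the place of decay at infinity.\<close>

lemma integral_directional_derivative_eq_0:
  fixes u v :: "'a::euclidean_space \<Rightarrow> real"
  assumes v: "continuous_on UNIV v"
    and deriv: "\<And>\<theta>. ((\<lambda>t. u (\<theta> + t *\<^sub>R e)) has_real_derivative v \<theta>) (at 0)"
    and int: "integrable lborel u" "integrable lborel v"
  shows "(LINT \<theta>|lborel. v \<theta>) = 0"
proof -
  have [measurable]: "v \<in> borel_measurable borel" using v by (rule borel_measurable_continuous_onI)
  have shift: "(LINT \<theta>|lborel. w (\<theta> + c)) = (LINT \<theta>|lborel. w \<theta>)"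
    and shift_int: "integrable lborel (\<lambda>\<theta>. w (\<theta> + c))"
    if w: "integrable lborel w" for w :: "'a \<Rightarrow> real" and c
  proof -
    have m: "w \<in> borel_measurable borel" using w by auto
    have "(LINT \<theta>|lborel. w \<theta>) = (LINT \<theta>|distr lborel borel ((+) c). w \<theta>)"
      by (simp add: lborel_distr_plus)
    also have "\<dots> = (LINT \<theta>|lborel. w (c + \<theta>))"
      by (rule integral_distr) (use m in auto)
    finally show "(LINT \<theta>|lborel. w (\<theta> + c)) = (LINT \<theta>|lborel. w \<theta>)" by (simp add: add.commute)
    have "integrable (distr lborel borel ((+) c)) w" using w by (simp add: lborel_distr_plus)
    then show "integrable lborel (\<lambda>\<theta>. w (\<theta> + c))"
      by (subst (asm) integrable_distr_eq) (use m in \<open>auto simp: add.commute\<close>)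
  qed
  define W where "W s \<theta> = indicator {0..1} s *\<^sub>R v (\<theta> + s *\<^sub>R e)" for s :: real and \<theta>
  \<comment> \<open>The hypothesis speaks of parameter 0 only, so it is applied at the base point
    \<theta> + s e and shifted.\<close>
  have D: "((\<lambda>t. u (\<theta> + t *\<^sub>R e)) has_real_derivative v (\<theta> + s *\<^sub>R e)) (at s)" for \<theta> s
  proof -
    have "((\<lambda>t. u (\<theta> + (t + s) *\<^sub>R e)) has_real_derivative v (\<theta> + s *\<^sub>R e)) (at 0)"
      using deriv[of "\<theta> + s *\<^sub>R e"] by (simp add: algebra_simps)
    then show ?thesis using DERIV_shift[of "\<lambda>t. u (\<theta> + t *\<^sub>R e)" "v (\<theta> + s *\<^sub>R e)" 0 s] by simp
  qed
  have inner: "(LINT s|lborel. W s \<theta>) = u (\<theta> + e) - u \<theta>" for \<theta>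
  proof -
    have "(LINT s|lborel. W s \<theta>) = u (\<theta> + 1 *\<^sub>R e) - u (\<theta> + 0 *\<^sub>R e)"
      unfolding W_def
      by (rule integral_FTC_atLeastAtMost)
         (auto intro!: continuous_intros continuous_on_compose2[OF v] has_field_derivative_at_within D
            simp: has_real_derivative_iff_has_vector_derivative[symmetric])
    then show ?thesis by simp
  qed
  have "integrable (lborel \<Otimes>\<^sub>M lborel) (case_prod W)"
  proof (rule lborel_pair.Fubini_integrable)
    show "case_prod W \<in> borel_measurable (lborel \<Otimes>\<^sub>M lborel)"
      unfolding W_def by measurable
    have "(LINT y|lborel. norm (case_prod W (s, y))) = indicator {0..1} s *\<^sub>R (LINT y|lborel. \<bar>v y\<bar>)" for s
    proof -
      have "(LINT y|lborel. norm (case_prod W (s, y))) = (LINT y|lborel. indicator {0..1} s *\<^sub>R \<bar>v (y + s *\<^sub>R e)\<bar>)"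
        by (simp add: W_def abs_mult)
      also have "\<dots> = indicator {0..1} s *\<^sub>R (LINT y|lborel. \<bar>v (y + s *\<^sub>R e)\<bar>)"
        by (rule integral_scaleR_right)
      finally show ?thesis using shift[of "\<lambda>y. \<bar>v y\<bar>"] int by simp
    qed
    then show "integrable lborel (\<lambda>s. LINT y|lborel. norm (case_prod W (s, y)))"
      by simp
    show "AE s in lborel. integrable lborel (\<lambda>y. case_prod W (s, y))"
      using shift_int[OF int(2)] by (auto simp: W_def)
  qed
  then have "(LINT \<theta>|lborel. LINT s|lborel. W s \<theta>) = (LINT s|lborel. LINT \<theta>|lborel. W s \<theta>)"
    by (rule lborel_pair.Fubini_integral)
  moreover have "(LINT \<theta>|lborel. LINT s|lborel. W s \<theta>) = 0"
    unfolding inner using shift[OF int(1), of e] shift_int[OF int(1), of e] int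
    by (subst Bochner_Integration.integral_diff) auto
  moreover have "(LINT s|lborel. LINT \<theta>|lborel. W s \<theta>) = (LINT \<theta>|lborel. v \<theta>)"
  proof -
    have "(LINT \<theta>|lborel. W s \<theta>) = indicator {0..1} s *\<^sub>R (LINT \<theta>|lborel. v \<theta>)" for s
      unfolding W_def by (subst integral_scaleR_right) (simp add: shift[OF int(2)])
    then show ?thesis by simp
  qed
  ultimately show ?thesis by simp
qed

text \<open>The fundamental theorem in t followed by Fubini: the difference of the two integrals is
  the integral over t of the nonnegative numbers in the last hypothesis. The bound \<open>B\<close>,
  uniform in t, makes the derivative integrable on the strip over {a..b}.\<close>

lemma integral_mono_of_derivative_nonneg:
  fixes g g' :: "real \<Rightarrow> 'a::euclidean_space \<Rightarrow> real"
  assumes ab: "a \<le> b"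
    and deriv: "\<And>t \<theta>. t \<in> {a..b} \<Longrightarrow> ((\<lambda>t. g t \<theta>) has_real_derivative g' t \<theta>) (at t)"
    and cont: "\<And>\<theta>. continuous_on {a..b} (\<lambda>t. g' t \<theta>)"
    and meas: "(\<lambda>(t, \<theta>). indicator {a..b} t * g' t \<theta>) \<in> borel_measurable (borel \<Otimes>\<^sub>M borel)"
    and bound: "\<And>t \<theta>. t \<in> {a..b} \<Longrightarrow> \<bar>g' t \<theta>\<bar> \<le> B \<theta>" "integrable lborel B"
    and int: "integrable lborel (g a)" "integrable lborel (g b)"
    and nonneg: "\<And>t. t \<in> {a..b} \<Longrightarrow> 0 \<le> (LINT \<theta>|lborel. g' t \<theta>)"
  shows "(LINT \<theta>|lborel. g a \<theta>) \<le> (LINT \<theta>|lborel. g b \<theta>)"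
proof -
  define W where "W t \<theta> = indicator {a..b} t *\<^sub>R g' t \<theta>" for t \<theta>
  have m[measurable]: "case_prod W \<in> borel_measurable (borel \<Otimes>\<^sub>M borel)"
    using meas by (simp add: W_def[abs_def] case_prod_unfold)
  have inner: "(LINT s|lborel. W s \<theta>) = g b \<theta> - g a \<theta>" for \<theta>
    unfolding W_def
    by (rule integral_FTC_atLeastAtMost)
       (use ab cont in \<open>auto intro!: has_field_derivative_at_within deriv
            simp: has_real_derivative_iff_has_vector_derivative[symmetric]\<close>)
  have Wb: "\<bar>W t \<theta>\<bar> \<le> indicator {a..b} t * B \<theta>" for t \<theta>
    using bound(1)[of t \<theta>] by (auto simp: W_def indicator_def)
  have Bm: "B \<in> borel_measurable borel" using bound(2) by auto
  have "integrable (lborel \<Otimes>\<^sub>M lborel) (\<lambda>(t::real, \<theta>). indicator {a..b} t * B \<theta>)"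
  proof (rule lborel_pair.Fubini_integrable)
    show "(\<lambda>(t::real, \<theta>). indicator {a..b} t * B \<theta>) \<in> borel_measurable (lborel \<Otimes>\<^sub>M lborel)"
      using Bm by measurable
    have "(LINT y|lborel. norm (case (t, y) of (t, \<theta>) \<Rightarrow> indicator {a..b} t * B \<theta>))
        = indicator {a..b} t * (LINT y|lborel. \<bar>B y\<bar>)" for t
      by (simp add: abs_mult)
    moreover have "integrable lborel (indicator {a..b} :: real \<Rightarrow> real)"
      by (rule integrable_real_indicator) (auto simp: emeasure_lborel_Icc_eq)
    ultimately show "integrable lborel (\<lambda>t. LINT y|lborel. norm (case (t, y) of (t, \<theta>) \<Rightarrow> indicator {a..b} t * B \<theta>))"
      by simp
  qed (use bound(2) in auto)
  then have "integrable (lborel \<Otimes>\<^sub>M lborel) (case_prod W)"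
    by (rule Bochner_Integration.integrable_bound) (use Wb in \<open>auto intro!: AE_I2 order_trans[OF _ abs_ge_self]\<close>)
  then have eq: "(LINT \<theta>|lborel. LINT s|lborel. W s \<theta>) = (LINT s|lborel. LINT \<theta>|lborel. W s \<theta>)"
    by (rule lborel_pair.Fubini_integral)
  have "0 \<le> (LINT \<theta>|lborel. W s \<theta>)" for s
    using nonneg[of s] by (cases "s \<in> {a..b}") (simp_all add: W_def)
  then have "0 \<le> (LINT s|lborel. LINT \<theta>|lborel. W s \<theta>)"
    by (rule Bochner_Integration.integral_nonneg)
  also have "\<dots> = (LINT \<theta>|lborel. g b \<theta>) - (LINT \<theta>|lborel. g a \<theta>)"
    unfolding eq[symmetric] inner by (rule Bochner_Integration.integral_diff[OF int(2,1)])
  finally show ?thesis by simp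
qed

text \<open>One envelope for all kernels and their derivatives that occur: N caps the degree and r
  is the slowest decay. The form (1 + x^2)^N is chosen because it expands into even powers, hence
  into \<open>gauss_moment\<close> terms.\<close>

definition gauss_bound :: "nat \<Rightarrow> real \<Rightarrow> real^'n \<Rightarrow> real" where
  "gauss_bound N r \<theta> = (\<Prod>i\<in>UNIV. (1 + (\<theta> $ i)\<^sup>2) ^ N * exp (- (r * (\<theta> $ i)\<^sup>2)))"

lemma gauss_bound_nonneg: "0 \<le> gauss_bound N r \<theta>"
  unfolding gauss_bound_def by (intro prod_nonneg_UNIV mult_nonneg_nonneg zero_le_power) auto

text \<open>By the binomial theorem in each coordinate the envelope is a finite combination of
  Gaussian moments, so the moment hypotheses of the theorem reach it.\<close>

lemma integrable_gauss_boundI: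
  fixes g :: "real^'n \<Rightarrow> real"
  assumes "\<And>z. integrable lborel (\<lambda>\<theta>. g \<theta> * gauss_moment z r \<theta>)"
  shows "integrable lborel (\<lambda>\<theta>. g \<theta> * gauss_bound N r \<theta>)"
proof -
  let ?c = "\<lambda>z. (\<Prod>i\<in>UNIV. real (N choose z i))"
  have "gauss_bound N r \<theta> = (\<Sum>z\<in>PiE UNIV (\<lambda>_::'n. {..N}). ?c z * gauss_moment z r \<theta>)" for \<theta> :: "real^'n"
  proof -
    have "gauss_bound N r \<theta> = (\<Prod>i\<in>UNIV. \<Sum>k\<le>N. real (N choose k) * ((\<theta> $ i)^(2*k) * exp (- (r * (\<theta> $ i)\<^sup>2))))"
      unfolding gauss_bound_def
    proof (intro prod.cong refl)
      fix i
      have "(1 + (\<theta> $ i)\<^sup>2) ^ N = (\<Sum>k\<le>N. real (N choose k) * (\<theta> $ i)^(2*k))"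
        using binomial_ring[of "(\<theta> $ i)\<^sup>2" 1 N] by (simp add: add.commute power_mult)
      then show "(1 + (\<theta> $ i)\<^sup>2) ^ N * exp (- (r * (\<theta> $ i)\<^sup>2))
         = (\<Sum>k\<le>N. real (N choose k) * ((\<theta> $ i)^(2*k) * exp (- (r * (\<theta> $ i)\<^sup>2))))"
        by (simp add: sum_distrib_right mult.assoc)
    qed
    then show ?thesis
      by (simp add: prod_sum_PiE prod.distrib gauss_moment_def)
  qed
  then have "(\<lambda>\<theta>. g \<theta> * gauss_bound N r \<theta>)
     = (\<lambda>\<theta>. \<Sum>z\<in>PiE UNIV (\<lambda>_::'n. {..N}). ?c z * (g \<theta> * gauss_moment z r \<theta>))"
    by (simp add: sum_distrib_left mult_ac)
  then show ?thesis
    by (simp only:) (intro Bochner_Integration.integrable_sum integrable_mult_right assms)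
qed

lemma integrable_mult_gauss_dominated:
  fixes g K :: "real^'n \<Rightarrow> real"
  assumes "integrable lborel (\<lambda>\<theta>. g \<theta> * gauss_bound N r \<theta>)"
    and "g \<in> borel_measurable borel" "K \<in> borel_measurable borel"
    and K: "\<And>\<theta>. \<bar>K \<theta>\<bar> \<le> C * gauss_bound N r \<theta>"
  shows "integrable lborel (\<lambda>\<theta>. g \<theta> * K \<theta>)"
proof (rule Bochner_Integration.integrable_bound)
  show "integrable lborel (\<lambda>\<theta>. C * (g \<theta> * gauss_bound N r \<theta>))" using assms(1) by simp
  show "(\<lambda>\<theta>. g \<theta> * K \<theta>) \<in> borel_measurable lborel" using assms(2,3) by simp
  show "AE \<theta> in lborel. norm (g \<theta> * K \<theta>) \<le> norm (C * (g \<theta> * gauss_bound N r \<theta>))"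
  proof (rule AE_I2)
    fix \<theta>
    have "\<bar>K \<theta>\<bar> \<le> \<bar>C\<bar> * gauss_bound N r \<theta>"
      using K[of \<theta>] gauss_bound_nonneg[of N r \<theta>]
      by (smt (verit) mult_right_mono)
    then have "\<bar>g \<theta>\<bar> * \<bar>K \<theta>\<bar> \<le> \<bar>g \<theta>\<bar> * (\<bar>C\<bar> * gauss_bound N r \<theta>)"
      by (intro mult_left_mono) auto
    then show "norm (g \<theta> * K \<theta>) \<le> norm (C * (g \<theta> * gauss_bound N r \<theta>))"
      using gauss_bound_nonneg[of N r \<theta>] by (simp add: abs_mult mult_ac)
  qed
qed

lemma abs_prod_gauss_bound:
  fixes \<psi> :: "'n::finite \<Rightarrow> real \<Rightarrow> real"
  assumes "\<And>j x. \<bar>\<psi> j x\<bar> \<le> c j * ((1 + x\<^sup>2) ^ N * exp (- (r * x\<^sup>2)))"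
  shows "\<bar>\<Prod>j\<in>UNIV. \<psi> j ((\<theta>::real^'n) $ j)\<bar> \<le> (\<Prod>j\<in>UNIV. c j) * gauss_bound N r \<theta>"
proof -
  have "\<bar>\<Prod>j\<in>UNIV. \<psi> j (\<theta> $ j)\<bar> = (\<Prod>j\<in>UNIV. \<bar>\<psi> j (\<theta> $ j)\<bar>)"
    by (rule abs_prod)
  also have "\<dots> \<le> (\<Prod>j\<in>UNIV. c j * ((1 + (\<theta> $ j)\<^sup>2) ^ N * exp (- (r * (\<theta> $ j)\<^sup>2))))"
    by (intro prod_mono) (auto simp: assms)
  finally show ?thesis by (simp add: gauss_bound_def prod.distrib)
qed

lemma partial_has_derivative:
  assumes "has_partials f"
  shows "((\<lambda>t. f (\<theta> + t *\<^sub>R axis i 1)) has_real_derivative partial i f \<theta>) (at 0)"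
  using assms unfolding has_partials_def partial_def
  by (metis DERIV_deriv_iff_real_differentiable)

text \<open>Green's identity in one direction. With \<Phi> the product of the
  \<open>\<phi> j\<close>, the field u = f \<partial>\<Phi> - (\<partial>f) \<Phi> has derivative f
  \<partial>\<partial>\<Phi> - (\<partial>\<partial>f) \<Phi>, so both integrations by parts are
  done at once by \<open>integral_directional_derivative_eq_0\<close>.\<close>

lemma integral_second_partial_parts:
  fixes f :: "real^'n \<Rightarrow> real" and \<phi> \<phi>1 \<phi>2 :: "'n \<Rightarrow> real \<Rightarrow> real"
  assumes C2: "C2 f"
    and d1: "\<And>j x. (\<phi> j has_real_derivative \<phi>1 j x) (at x)"
    and d2: "\<And>j x. (\<phi>1 j has_real_derivative \<phi>2 j x) (at x)"
    and c2: "\<And>j. continuous_on UNIV (\<phi>2 j)"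
    and b0: "\<And>j x. \<bar>\<phi> j x\<bar> \<le> c j * ((1 + x\<^sup>2) ^ N * exp (- (r * x\<^sup>2)))"
    and b1: "\<And>j x. \<bar>\<phi>1 j x\<bar> \<le> c j * ((1 + x\<^sup>2) ^ N * exp (- (r * x\<^sup>2)))"
    and b2: "\<And>j x. \<bar>\<phi>2 j x\<bar> \<le> c j * ((1 + x\<^sup>2) ^ N * exp (- (r * x\<^sup>2)))"
    and i0: "integrable lborel (\<lambda>\<theta>. f \<theta> * gauss_bound N r \<theta>)"
    and i1: "integrable lborel (\<lambda>\<theta>. partial i f \<theta> * gauss_bound N r \<theta>)"
    and i2: "integrable lborel (\<lambda>\<theta>. partial i (partial i f) \<theta> * gauss_bound N r \<theta>)"
  shows "integrable lborel (\<lambda>\<theta>. f \<theta> * (\<phi>2 i (\<theta> $ i) * (\<Prod>j\<in>UNIV - {i}. \<phi> j (\<theta> $ j))))" (is ?A)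
    and "integrable lborel (\<lambda>\<theta>. partial i (partial i f) \<theta> * (\<Prod>j\<in>UNIV. \<phi> j (\<theta> $ j)))" (is ?B)
    and "(LINT \<theta>|lborel. f \<theta> * (\<phi>2 i (\<theta> $ i) * (\<Prod>j\<in>UNIV - {i}. \<phi> j (\<theta> $ j))))
      = (LINT \<theta>|lborel. partial i (partial i f) \<theta> * (\<Prod>j\<in>UNIV. \<phi> j (\<theta> $ j)))" (is ?C)
proof -
  \<comment> \<open>Only the factor in direction i is differentiated, so \<open>P\<close> with
    \<open>\<phi> i\<close>, \<open>\<phi>1 i\<close> or \<open>\<phi>2 i\<close> in that slot
    covers the test function and its two derivatives.\<close>
  define P where "P \<psi> \<theta> = \<psi> (\<theta> $ i) * (\<Prod>j\<in>UNIV - {i}. \<phi> j (\<theta> $ j))" for \<psi> and \<theta> :: "real^'n"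
  have c0: "continuous_on UNIV (\<phi> j)" and c1: "continuous_on UNIV (\<phi>1 j)" for j
    using d1 d2 by (auto intro!: DERIV_continuous_on)
  have Pc: "continuous_on UNIV (P \<psi>)" if "continuous_on UNIV \<psi>" for \<psi>
    unfolding P_def
    by (intro continuous_intros continuous_on_compose2[OF that] continuous_on_compose2[OF c0]) auto
  have Pb: "\<bar>P \<psi> \<theta>\<bar> \<le> (\<Prod>j\<in>UNIV. c j) * gauss_bound N r \<theta>"
    if "\<And>x. \<bar>\<psi> x\<bar> \<le> c i * ((1 + x\<^sup>2) ^ N * exp (- (r * x\<^sup>2)))" for \<psi> \<theta>
  proof -
    have "P \<psi> \<theta> = (\<Prod>j\<in>UNIV. (if j = i then \<psi> else \<phi> j) (\<theta> $ j))"
      unfolding P_def by (subst prod.remove[of UNIV i]) auto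
    also have "\<bar>\<dots>\<bar> \<le> (\<Prod>j\<in>UNIV. c j) * gauss_bound N r \<theta>"
      by (rule abs_prod_gauss_bound) (use that b0 in auto)
    finally show ?thesis .
  qed
  have Pd: "((\<lambda>t. P \<psi> (\<theta> + t *\<^sub>R axis i 1)) has_real_derivative P \<psi>' \<theta>) (at 0)"
    if "\<And>x. (\<psi> has_real_derivative \<psi>' x) (at x)" for \<psi> \<psi>' \<theta>
  proof -
    have "((\<lambda>t. \<psi> (\<theta> $ i + t)) has_real_derivative \<psi>' (\<theta> $ i)) (at 0)"
      using that[of "\<theta> $ i"] DERIV_shift[of \<psi> "\<psi>' (\<theta> $ i)" 0 "\<theta> $ i"] by (simp add: add.commute)
    then have "((\<lambda>t. \<psi> (\<theta> $ i + t) * (\<Prod>j\<in>UNIV - {i}. \<phi> j (\<theta> $ j))) has_real_derivative P \<psi>' \<theta>) (at 0)"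
      unfolding P_def by (rule DERIV_cmult_right)
    moreover have "P \<psi> (\<theta> + t *\<^sub>R axis i 1) = \<psi> (\<theta> $ i + t) * (\<Prod>j\<in>UNIV - {i}. \<phi> j (\<theta> $ j))" for t
      unfolding P_def by (intro arg_cong2[where f="(*)"] prod.cong refl) (auto simp: axis_def)
    ultimately show ?thesis by simp
  qed
  let ?f1 = "partial i f" and ?f2 = "partial i (partial i f)"
  have cf: "continuous_on UNIV f" "continuous_on UNIV ?f1" "continuous_on UNIV ?f2"
    and hp: "has_partials f" "has_partials ?f1"
    using C2 by (auto simp: C2_def)
  note mc = borel_measurable_continuous_onI
  have I0: "integrable lborel (\<lambda>\<theta>. f \<theta> * P (\<phi>1 i) \<theta>)"
    by (rule integrable_mult_gauss_dominated[OF i0 mc mc Pb]; intro cf Pc c1 b1)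
  have I1: "integrable lborel (\<lambda>\<theta>. f \<theta> * P (\<phi>2 i) \<theta>)"
    by (rule integrable_mult_gauss_dominated[OF i0 mc mc Pb]; intro cf Pc c2 b2)
  have I2: "integrable lborel (\<lambda>\<theta>. ?f1 \<theta> * P (\<phi> i) \<theta>)"
    by (rule integrable_mult_gauss_dominated[OF i1 mc mc Pb]; intro cf Pc c0 b0)
  have I3: "integrable lborel (\<lambda>\<theta>. ?f2 \<theta> * P (\<phi> i) \<theta>)"
    by (rule integrable_mult_gauss_dominated[OF i2 mc mc Pb]; intro cf Pc c0 b0)
  note I = I0 I1 I2 I3
  have "(LINT \<theta>|lborel. f \<theta> * P (\<phi>2 i) \<theta> - ?f2 \<theta> * P (\<phi> i) \<theta>) = 0"
  proof (rule integral_directional_derivative_eq_0[where u="\<lambda>\<theta>. f \<theta> * P (\<phi>1 i) \<theta> - ?f1 \<theta> * P (\<phi> i) \<theta>" and e="axis i 1"])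
    show "continuous_on UNIV (\<lambda>\<theta>. f \<theta> * P (\<phi>2 i) \<theta> - ?f2 \<theta> * P (\<phi> i) \<theta>)"
      by (intro continuous_intros cf Pc c0 c2)
    fix \<theta>
    show "((\<lambda>t. f (\<theta> + t *\<^sub>R axis i 1) * P (\<phi>1 i) (\<theta> + t *\<^sub>R axis i 1)
        - ?f1 (\<theta> + t *\<^sub>R axis i 1) * P (\<phi> i) (\<theta> + t *\<^sub>R axis i 1))
        has_real_derivative f \<theta> * P (\<phi>2 i) \<theta> - ?f2 \<theta> * P (\<phi> i) \<theta>) (at 0)"
    proof -
      \<comment> \<open>The product rule leaves the undifferentiated factors at this point. The two
        mixed terms, each a first partial of f times \<open>P (\<phi>1 i)\<close>, cancel.\<close>
      let ?\<theta> = "\<theta> + 0 *\<^sub>R axis i 1"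
      have "((\<lambda>t. f (\<theta> + t *\<^sub>R axis i 1) * P (\<phi>1 i) (\<theta> + t *\<^sub>R axis i 1)
          - ?f1 (\<theta> + t *\<^sub>R axis i 1) * P (\<phi> i) (\<theta> + t *\<^sub>R axis i 1))
          has_real_derivative (?f1 \<theta> * P (\<phi>1 i) ?\<theta> + P (\<phi>2 i) \<theta> * f ?\<theta>)
             - (?f2 \<theta> * P (\<phi> i) ?\<theta> + P (\<phi>1 i) \<theta> * ?f1 ?\<theta>)) (at 0)"
        by (intro DERIV_diff DERIV_mult partial_has_derivative hp Pd d1 d2)
      then show ?thesis by (simp add: mult_ac)
    qed
  qed (intro Bochner_Integration.integrable_diff I)+
  then have "(LINT \<theta>|lborel. f \<theta> * P (\<phi>2 i) \<theta>) = (LINT \<theta>|lborel. ?f2 \<theta> * P (\<phi> i) \<theta>)"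
    using I by simp
  moreover have "P (\<phi> i) \<theta> = (\<Prod>j\<in>UNIV. \<phi> j (\<theta> $ j))" for \<theta>
    unfolding P_def by (subst prod.remove[of UNIV i]) auto
  ultimately show ?A ?B ?C
    using I unfolding P_def by simp_all
qed

subsection \<open>One-dimensional kernels\<close>

lemma gamma_const_Suc: "t > 0 \<Longrightarrow> gamma_const (Suc k) t = gamma_const k t * t / (real k + 1 / 2)"
proof -
  assume t: "t > 0"
  have "real k + 1/2 \<notin> \<int>\<^sub>\<le>\<^sub>0"
    by (auto dest!: nonpos_Ints_nonpos)
  then have "Gamma (real (Suc k) + 1/2) = (real k + 1/2) * Gamma (real k + 1/2)"
    using Gamma_plus1[of "real k + 1/2"] by (simp add: add_ac)
  moreover have "t powr (real (Suc k) + 1/2) = t powr (real k + 1/2) * t"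
    using t powr_add[of t "real k + 1/2" 1] by (simp add: algebra_simps)
  ultimately show ?thesis by (simp add: gamma_const_def)
qed

text \<open>For t > 0 a probability density on the real line; \<open>kern 0 t\<close> is the heat
  kernel at time 1 / (4 t).\<close>

definition kern :: "nat \<Rightarrow> real \<Rightarrow> real \<Rightarrow> real" where
  "kern k t x = gamma_const k t * (x ^ (2 * k) * exp (- (t * x\<^sup>2)))"

definition kern1 :: "nat \<Rightarrow> real \<Rightarrow> real \<Rightarrow> real" where
  "kern1 k t x = gamma_const k t * ((2 * k * x ^ (2 * k - 1) - 2 * t * x ^ (2 * k + 1)) * exp (- (t * x\<^sup>2)))"

text \<open>At \<open>k = 0\<close> the exponent \<open>2 * k - 1\<close> in \<open>kern1\<close> and the index \<open>k - 1\<close> in \<open>kern2\<close> are truncated, but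
  their coefficients vanish.\<close>

definition kern2 :: "nat \<Rightarrow> real \<Rightarrow> real \<Rightarrow> real" where
  "kern2 k t x = 4 * t * (k * kern (k - 1) t x - (2 * k + 1 / 2) * kern k t x + (k + 1 / 2) * kern (Suc k) t x)"

text \<open>Trades multiplication by t x^2 for a shift of the index. Thus derivatives in t and
  second derivatives in x both become combinations of neighbouring kernels, and the heat equation
  becomes a linear identity between them.\<close>

lemma kern_Suc: "t > 0 \<Longrightarrow> (real k + 1 / 2) * kern (Suc k) t x = t * x\<^sup>2 * kern k t x"
  by (simp add: kern_def gamma_const_Suc power2_eq_square field_simps)

lemma kern_nonneg: "t > 0 \<Longrightarrow> 0 \<le> kern k t x"
  by (auto simp: kern_def gamma_const_pos less_imp_le intro!: mult_nonneg_nonneg)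

text \<open>The power of t contributes (k + 1/2) / t and the exponential contributes - x^2, which
  \<open>kern_Suc\<close> rewrites as a shift of the index.\<close>

lemma kern_deriv_time:
  assumes t: "t > 0"
  shows "((\<lambda>t. kern k t x) has_real_derivative (real k + 1 / 2) / t * (kern k t x - kern (Suc k) t x)) (at t)"
proof -
  let ?a = "real k + 1 / 2"
  have d: "((\<lambda>t. gamma_const k t) has_real_derivative ?a / t * gamma_const k t) (at t)"
  proof -
    have "((\<lambda>t. t powr a / G) has_real_derivative a * t powr (a - 1) / G) (at t)" for a G
      using t by (intro DERIV_cdivide) (auto intro!: derivative_eq_intros)
    moreover have "a * t powr (a - 1) / G = a / t * (t powr a / G)" for a G
      using t by (simp add: powr_diff)
    ultimately show ?thesis unfolding gamma_const_def by metis
  qed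
  have "((\<lambda>t. kern k t x) has_real_derivative
      ?a / t * gamma_const k t * (x ^ (2 * k) * exp (- (t * x\<^sup>2)))
      + (x ^ (2 * k) * (exp (- (t * x\<^sup>2)) * - x\<^sup>2)) * gamma_const k t) (at t)"
    unfolding kern_def by (rule DERIV_mult[OF d]) (auto intro!: derivative_eq_intros)
  also have "?a / t * gamma_const k t * (x ^ (2 * k) * exp (- (t * x\<^sup>2)))
      + (x ^ (2 * k) * (exp (- (t * x\<^sup>2)) * - x\<^sup>2)) * gamma_const k t = ?a / t * kern k t x - x\<^sup>2 * kern k t x"
    by (simp add: kern_def)
  also have "\<dots> = ?a / t * (kern k t x - kern (Suc k) t x)"
  proof -
    have "?a / t * kern (Suc k) t x = x\<^sup>2 * kern k t x"
      using kern_Suc[OF t, of k x] t by (simp add: divide_simps mult_ac)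
    then show ?thesis by (simp only: right_diff_distrib)
  qed
  finally show ?thesis .
qed

lemma power_exp_deriv:
  "((\<lambda>x::real. x ^ n * exp (- (t * x\<^sup>2))) has_real_derivative
     real n * x ^ (n - 1) * exp (- (t * x\<^sup>2)) + (exp (- (t * x\<^sup>2)) * - (2 * t * x)) * x ^ n) (at x)"
  by (rule DERIV_mult) (auto intro!: derivative_eq_intros)

lemma kern_deriv: "(kern k t has_real_derivative kern1 k t x) (at x)"
proof -
  have "(kern k t has_real_derivative gamma_const k t * (real (2 * k) * x ^ (2 * k - 1) * exp (- (t * x\<^sup>2))
      + (exp (- (t * x\<^sup>2)) * - (2 * t * x)) * x ^ (2 * k))) (at x)"
    unfolding kern_def[abs_def] by (intro DERIV_cmult power_exp_deriv)
  then show ?thesis by (simp add: kern1_def algebra_simps)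
qed

text \<open>Differentiating twice produces the powers 2k - 2, 2k and 2k + 2 of x times the
  exponential, hence multiples of three neighbouring kernels.\<close>

lemma kern1_deriv:
  assumes t: "t > 0"
  shows "(kern1 k t has_real_derivative kern2 k t x) (at x)"
proof -
  let ?E = "exp (- (t * x\<^sup>2))" and ?c = "gamma_const k t"
  have D: "((\<lambda>x. ?c * (2 * k * (x ^ (2 * k - 1) * exp (- (t * x\<^sup>2))) - 2 * t * (x ^ (2 * k + 1) * exp (- (t * x\<^sup>2)))))
     has_real_derivative
      ?c * (2 * k * (real (2 * k - 1) * x ^ (2 * k - 1 - 1) * ?E + (?E * - (2 * t * x)) * x ^ (2 * k - 1))
        - 2 * t * (real (2 * k + 1) * x ^ (2 * k + 1 - 1) * ?E + (?E * - (2 * t * x)) * x ^ (2 * k + 1)))) (at x)"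
    by (intro DERIV_cmult DERIV_diff power_exp_deriv)
  have 1: "(kern1 k t has_real_derivative
      ?c * (2 * k * (real (2 * k - 1) * x ^ (2 * k - 1 - 1) * ?E + (?E * - (2 * t * x)) * x ^ (2 * k - 1))
        - 2 * t * (real (2 * k + 1) * x ^ (2 * k + 1 - 1) * ?E + (?E * - (2 * t * x)) * x ^ (2 * k + 1)))) (at x)"
  proof -
    have "kern1 k t = (\<lambda>x. ?c * (2 * k * (x ^ (2 * k - 1) * exp (- (t * x\<^sup>2))) - 2 * t * (x ^ (2 * k + 1) * exp (- (t * x\<^sup>2)))))"
      by (simp add: kern1_def fun_eq_iff left_diff_distrib mult.assoc)
    with D show ?thesis by simp
  qed
  have s: "(real k + 1 / 2) * kern (Suc k) t x = t * x\<^sup>2 * kern k t x" by (rule kern_Suc[OF t])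
  show ?thesis
  proof (cases k)
    \<comment> \<open>Here the terms with truncated exponents carry the factor k and drop
      out.\<close>
    case 0
    have "4 * t * ((real k + 1 / 2) * kern (Suc k) t x - (2 * k + 1 / 2) * kern k t x)
       = 4 * t * (t * x\<^sup>2 * kern k t x - (2 * k + 1 / 2) * kern k t x)" by (simp only: s)
    then have K: "kern2 k t x = 4 * t * (t * x\<^sup>2 * kern k t x - 1 / 2 * kern k t x)"
      using 0 by (simp add: kern2_def)
    have "?c * (2 * k * (real (2 * k - 1) * x ^ (2 * k - 1 - 1) * ?E + (?E * - (2 * t * x)) * x ^ (2 * k - 1))
        - 2 * t * (real (2 * k + 1) * x ^ (2 * k + 1 - 1) * ?E + (?E * - (2 * t * x)) * x ^ (2 * k + 1))) = kern2 k t x"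
      unfolding K using 0 by (simp add: kern_def algebra_simps power2_eq_square)
    with 1 show ?thesis by (simp only:)
  next
    case (Suc m)
    have s': "(real m + 1 / 2) * kern (Suc m) t x = t * x\<^sup>2 * kern m t x" by (rule kern_Suc[OF t])
    \<comment> \<open>The recursion for \<open>gamma_const\<close> turns the lowest power x^(2m)
      into the kernel of index m = k - 1.\<close>
    have e: "4 * t * ?c * x ^ (2 * m) * ?E * (real m + 1 / 2) = 4 * t * t * kern m t x" 
      using t unfolding Suc kern_def by (simp add: gamma_const_Suc field_simps)
    have "?c * (2 * k * (real (2 * k - 1) * x ^ (2 * k - 1 - 1) * ?E + (?E * - (2 * t * x)) * x ^ (2 * k - 1))
        - 2 * t * (real (2 * k + 1) * x ^ (2 * k + 1 - 1) * ?E + (?E * - (2 * t * x)) * x ^ (2 * k + 1)))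
      = real k * (4 * ?c * x ^ (2 * m) * ?E * (real m + 1 / 2)) - 4 * t * (2 * k + 1 / 2) * kern k t x + 4 * t * (t * x\<^sup>2 * kern k t x)"
      unfolding kern_def Suc by (simp add: algebra_simps power2_eq_square)
    also have "4 * ?c * x ^ (2 * m) * ?E * (real m + 1 / 2) = 4 * t * kern m t x"
      using e t by (simp add: mult_ac)
    also have "real k * (4 * t * kern m t x) - 4 * t * (2 * k + 1 / 2) * kern k t x + 4 * t * (t * x\<^sup>2 * kern k t x) = kern2 k t x"
      unfolding kern2_def s[symmetric] using Suc by (simp add: algebra_simps)
    finally show ?thesis using 1 by (simp only:)
  qed
qed

section \<open>Binomial averages of the kernels and the backward heat equation\<close>

lemma Bernstein_eq_0: "n < k \<Longrightarrow> Bernstein n k p = 0"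
  by (simp add: Bernstein_def)

lemma Bernstein_le_1: "0 \<le> p \<Longrightarrow> p \<le> 1 \<Longrightarrow> Bernstein n k p \<le> 1"
proof (cases "k \<le> n")
  case True
  assume p: "0 \<le> p" "p \<le> 1"
  then have "Bernstein n k p \<le> (\<Sum>k\<le>n. Bernstein n k p)"
    using True by (intro member_le_sum) (auto simp: Bernstein_nonneg)
  then show ?thesis by simp
qed (simp add: Bernstein_eq_0)

text \<open>By (k + 1) (n choose k + 1) = (n - k) (n choose k), the derivative is expressed in the
  same degree n, at the price of dividing by p. In this form the sum over k can be shifted in
  \<open>bkern_heat\<close>.\<close>

lemma Bernstein_deriv:
  assumes p: "p \<noteq> 0" and k: "k \<le> n"
  shows "(Bernstein n k has_real_derivative (k * Bernstein n k p - Suc k * Bernstein n (Suc k) p) / p) (at p)"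
proof -
  have c: "real (Suc k) * real (n choose Suc k) = real (n - k) * real (n choose k)"
    by (metis binomial_absorb_comp binomial_absorption mult.commute of_nat_mult Suc_times_binomial_add)
  have "(Bernstein n k has_real_derivative real (n choose k) *
      (real k * p ^ (k - 1) * (1 - p) ^ (n - k) - p ^ k * (real (n - k) * (1 - p) ^ (n - k - 1)))) (at p)"
    unfolding Bernstein_def[abs_def] by (auto intro!: derivative_eq_intros simp: algebra_simps)
  also have "real (n choose k) *
      (real k * p ^ (k - 1) * (1 - p) ^ (n - k) - p ^ k * (real (n - k) * (1 - p) ^ (n - k - 1)))
      = (k * Bernstein n k p - Suc k * Bernstein n (Suc k) p) / p"
  proof -
    have 1: "real k * p ^ (k - 1) * p = real k * p ^ k" by (cases k) auto
    have 2: "Suc k * Bernstein n (Suc k) p = real (n - k) * real (n choose k) * p ^ k * p * (1 - p) ^ (n - k - 1)"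
      unfolding Bernstein_def mult.assoc[symmetric] c by simp
    have "real (n choose k) *
      (real k * p ^ (k - 1) * (1 - p) ^ (n - k) - p ^ k * (real (n - k) * (1 - p) ^ (n - k - 1))) * p
      = real (n choose k) * (real k * p ^ (k - 1) * p) * (1 - p) ^ (n - k)
         - real (n - k) * real (n choose k) * p ^ k * p * (1 - p) ^ (n - k - 1)"
      by (simp add: algebra_simps)
    also have "\<dots> = k * Bernstein n k p - Suc k * Bernstein n (Suc k) p"
      unfolding 1 2 by (simp add: Bernstein_def)
    finally show ?thesis using p by (simp add: eq_divide_eq)
  qed
  finally show ?thesis .
qed

text \<open>Weights and kernels move together with t. For 0 < t \<le> T this is the heat flow of
  \<open>kern n T\<close> after time 1 / (4 t) - 1 / (4 T).\<close>

definition bkern :: "nat \<Rightarrow> real \<Rightarrow> real \<Rightarrow> real \<Rightarrow> real" where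
  "bkern n T t x = (\<Sum>k\<le>n. Bernstein n k (t / T) * kern k t x)"

definition bkern1 :: "nat \<Rightarrow> real \<Rightarrow> real \<Rightarrow> real \<Rightarrow> real" where
  "bkern1 n T t x = (\<Sum>k\<le>n. Bernstein n k (t / T) * kern1 k t x)"

definition bkern2 :: "nat \<Rightarrow> real \<Rightarrow> real \<Rightarrow> real \<Rightarrow> real" where
  "bkern2 n T t x = (\<Sum>k\<le>n. Bernstein n k (t / T) * kern2 k t x)"

lemma bkern_deriv: "(bkern n T t has_real_derivative bkern1 n T t x) (at x)"
  unfolding bkern_def[abs_def] bkern1_def by (intro DERIV_sum DERIV_cmult kern_deriv)

lemma bkern1_deriv: "t > 0 \<Longrightarrow> (bkern1 n T t has_real_derivative bkern2 n T t x) (at x)"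
  unfolding bkern1_def[abs_def] bkern2_def by (intro DERIV_sum DERIV_cmult kern1_deriv)

lemma bkern_nonneg: "0 < t \<Longrightarrow> t \<le> T \<Longrightarrow> 0 \<le> bkern n T t x"
  unfolding bkern_def by (intro sum_nonneg mult_nonneg_nonneg Bernstein_nonneg kern_nonneg) auto

lemma bkern_end: "T > 0 \<Longrightarrow> bkern n T T x = kern n T x"
  unfolding bkern_def
  by (subst sum.remove[of _ n]) (auto simp: Bernstein_def intro!: sum.neutral)

text \<open>Write b_k for the weights and K_k for the kernels. Differentiating the weights and
  shifting the index turns their contribution into k (K_k - K_(k-1)) b_k / t; the kernels contribute
  (k + 1/2) (K_k - K_(k+1)) b_k / t. The sum of the two is - b_k / (4 t^2) times
  \<open>kern2\<close>.\<close>

lemma bkern_heat: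
  assumes t: "0 < t" and T: "0 < T"
  shows "((\<lambda>t. bkern n T t x) has_real_derivative - (1 / (4 * t\<^sup>2)) * bkern2 n T t x) (at t)"
proof -
  let ?b = "\<lambda>k. Bernstein n k (t / T)" and ?k = "\<lambda>k. kern k t x"
  have B: "((\<lambda>t. Bernstein n k (t / T)) has_real_derivative (k * ?b k - Suc k * ?b (Suc k)) / t) (at t)"
    if "k \<le> n" for k
  proof -
    have "((\<lambda>t. Bernstein n k (t / T)) has_real_derivative (k * ?b k - Suc k * ?b (Suc k)) / (t / T) * (1 / T)) (at t)"
      by (rule DERIV_chain2[OF Bernstein_deriv]) (use t T that in \<open>auto intro!: derivative_eq_intros\<close>)
    then show ?thesis using t T by simp
  qed
  have "((\<lambda>t. bkern n T t x) has_real_derivative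
      (\<Sum>k\<le>n. (k * ?b k - Suc k * ?b (Suc k)) / t * ?k k + (real k + 1 / 2) / t * (?k k - ?k (Suc k)) * ?b k)) (at t)"
    unfolding bkern_def by (intro DERIV_sum DERIV_mult B kern_deriv_time t) auto
  also have "(\<Sum>k\<le>n. (k * ?b k - Suc k * ?b (Suc k)) / t * ?k k + (real k + 1 / 2) / t * (?k k - ?k (Suc k)) * ?b k)
      = 1 / t * ((\<Sum>k\<le>n. k * ?b k * ?k k) - (\<Sum>k\<le>n. Suc k * ?b (Suc k) * ?k k)
          + (\<Sum>k\<le>n. (real k + 1 / 2) * (?k k - ?k (Suc k)) * ?b k))"
  proof -
    have "(k * ?b k - Suc k * ?b (Suc k)) / t * ?k k + (real k + 1 / 2) / t * (?k k - ?k (Suc k)) * ?b k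
      = 1 / t * (k * ?b k * ?k k - Suc k * ?b (Suc k) * ?k k + (real k + 1 / 2) * (?k k - ?k (Suc k)) * ?b k)" for k
    proof -
      have "A / t * K + B / t * M * N = 1 / t * (A * K + B * M * N)" for A B K M N :: real
        by (simp add: add_divide_distrib)
      then show ?thesis by (simp only: left_diff_distrib)
    qed
    then show ?thesis
      by (simp only: sum_distrib_left[symmetric] sum.distrib sum_subtractf)
  qed
  \<comment> \<open>Shifting is free at both ends: the new term k = 0 has factor 0, and the weight
    of index n + 1 vanishes.\<close>
  also have "(\<Sum>k\<le>n. Suc k * ?b (Suc k) * ?k k) = (\<Sum>k\<le>n. k * ?b k * ?k (k - 1))"
  proof -
    have "(\<Sum>k\<le>Suc n. k * ?b k * ?k (k - 1)) = (\<Sum>k\<le>n. Suc k * ?b (Suc k) * ?k k)"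
      by (subst sum.atMost_Suc_shift) simp
    then show ?thesis by (simp add: Bernstein_eq_0)
  qed
  also have "1 / t * ((\<Sum>k\<le>n. k * ?b k * ?k k) - (\<Sum>k\<le>n. k * ?b k * ?k (k - 1))
          + (\<Sum>k\<le>n. (real k + 1 / 2) * (?k k - ?k (Suc k)) * ?b k))
       = 1 / t * (\<Sum>k\<le>n. - (?b k * (kern2 k t x / (4 * t))))"
  proof -
    have "kern2 k t x / (4 * t) = k * ?k (k - 1) - (2 * k + 1 / 2) * ?k k + (k + 1 / 2) * ?k (Suc k)" for k
      using t by (simp add: kern2_def)
    then have "- (?b k * (kern2 k t x / (4 * t))) = k * ?b k * ?k k - k * ?b k * ?k (k - 1) + (real k + 1 / 2) * (?k k - ?k (Suc k)) * ?b k" for k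
      by (simp only:) (simp add: algebra_simps)
    then show ?thesis by (simp add: sum.distrib sum_subtractf)
  qed
  also have "\<dots> = - (1 / (4 * t\<^sup>2)) * bkern2 n T t x"
    using t by (simp add: bkern2_def sum_distrib_left sum_negf power2_eq_square sum_divide_distrib[symmetric] field_simps)
  finally show ?thesis .
qed

section \<open>Bounds uniform in t between r and T\<close>

lemma abs_power_le: 
  fixes x :: real
  assumes "m \<le> 2 * N"
  shows "\<bar>x\<bar> ^ m \<le> (1 + x\<^sup>2) ^ N"
proof -
  have "\<bar>x\<bar> ^ m \<le> (max 1 \<bar>x\<bar>) ^ m" by (intro power_mono) auto
  also have "\<dots> \<le> (max 1 \<bar>x\<bar>) ^ (2 * N)" using assms by (intro power_increasing) auto
  also have "\<dots> = ((max 1 \<bar>x\<bar>)\<^sup>2) ^ N" by (rule power_mult)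
  also have "\<dots> \<le> (1 + x\<^sup>2) ^ N" by (intro power_mono) (auto simp: max_def)
  finally show ?thesis .
qed

lemma gamma_const_mono: "0 < t \<Longrightarrow> t \<le> T \<Longrightarrow> gamma_const k t \<le> gamma_const k T"
  unfolding gamma_const_def by (intro divide_right_mono powr_mono2) auto

text \<open>The normalising constant grows with t while the Gaussian shrinks, hence T in the
  constant and r in the exponent.\<close>

lemma kern_bound:
  assumes t: "0 < r" "r \<le> t" "t \<le> T" and k: "k \<le> N"
  shows "\<bar>kern k t x\<bar> \<le> gamma_const k T * ((1 + x\<^sup>2) ^ N * exp (- (r * x\<^sup>2)))"
proof -
  have T: "0 < T" using t by linarith
  have "\<bar>kern k t x\<bar> = gamma_const k t * (\<bar>x\<bar> ^ (2 * k) * exp (- (t * x\<^sup>2)))"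
    using t by (simp add: kern_def abs_mult power_abs gamma_const_pos less_imp_le)
  also have "\<dots> \<le> gamma_const k T * ((1 + x\<^sup>2) ^ N * exp (- (r * x\<^sup>2)))"
    using t k less_imp_le[OF gamma_const_pos[OF T]]
    by (intro mult_mono abs_power_le gamma_const_mono) (auto intro: mult_right_mono)
  finally show ?thesis .
qed

text \<open>The strict k < N makes room for the odd power 2k + 1; in \<open>kern2_bound\<close> it
  makes room for the kernel of index k + 1.\<close>

lemma kern1_bound:
  assumes t: "0 < r" "r \<le> t" "t \<le> T" and k: "k < N"
  shows "\<bar>kern1 k t x\<bar> \<le> gamma_const k T * (2 * k + 2 * T) * ((1 + x\<^sup>2) ^ N * exp (- (r * x\<^sup>2)))"
proof -
  have "\<bar>2 * k * x ^ (2 * k - 1) - 2 * t * x ^ (2 * k + 1)\<bar> \<le> 2 * k * \<bar>x\<bar> ^ (2 * k - 1) + 2 * t * \<bar>x\<bar> ^ (2 * k + 1)"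
    using t by (intro order_trans[OF abs_triangle_ineq4]) (simp add: abs_mult power_abs)
  also have "\<dots> \<le> 2 * k * (1 + x\<^sup>2) ^ N + 2 * T * (1 + x\<^sup>2) ^ N"
    using t k by (intro add_mono mult_mono abs_power_le) auto
  finally have 1: "\<bar>2 * k * x ^ (2 * k - 1) - 2 * t * x ^ (2 * k + 1)\<bar> \<le> (2 * k + 2 * T) * (1 + x\<^sup>2) ^ N"
    by (simp add: algebra_simps)
  have "\<bar>kern1 k t x\<bar> = gamma_const k t * (\<bar>2 * k * x ^ (2 * k - 1) - 2 * t * x ^ (2 * k + 1)\<bar> * exp (- (t * x\<^sup>2)))"
    using t by (simp add: kern1_def abs_mult gamma_const_pos less_imp_le)
  also have "\<dots> \<le> gamma_const k T * ((2 * k + 2 * T) * (1 + x\<^sup>2) ^ N * exp (- (r * x\<^sup>2)))"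
    using t k 1 less_imp_le[OF gamma_const_pos[of T]]
    by (intro mult_mono gamma_const_mono) (auto intro: mult_right_mono)
  finally show ?thesis by (simp add: mult_ac)
qed

lemma kern2_bound:
  assumes t: "0 < r" "r \<le> t" "t \<le> T" and k: "k < N"
  shows "\<bar>kern2 k t x\<bar> \<le> 4 * T * (k * gamma_const (k - 1) T + (2 * k + 1 / 2) * gamma_const k T
     + (k + 1 / 2) * gamma_const (Suc k) T) * ((1 + x\<^sup>2) ^ N * exp (- (r * x\<^sup>2)))"
proof -
  let ?Q = "(1 + x\<^sup>2) ^ N * exp (- (r * x\<^sup>2))"
  have "\<bar>kern2 k t x\<bar> = 4 * t * \<bar>k * kern (k - 1) t x - (2 * k + 1 / 2) * kern k t x + (k + 1 / 2) * kern (Suc k) t x\<bar>"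
    using t by (simp add: kern2_def abs_mult)
  also have "\<dots> \<le> 4 * T * (k * \<bar>kern (k - 1) t x\<bar> + (2 * k + 1 / 2) * \<bar>kern k t x\<bar> + (k + 1 / 2) * \<bar>kern (Suc k) t x\<bar>)"
  proof (intro mult_mono)
    have "\<bar>k * a - (2 * k + 1 / 2) * b + (k + 1 / 2) * c\<bar> \<le> k * \<bar>a\<bar> + (2 * k + 1 / 2) * \<bar>b\<bar> + (k + 1 / 2) * \<bar>c\<bar>" for a b c :: real
    proof -
      have "\<bar>k * a\<bar> = k * \<bar>a\<bar>" "\<bar>(2 * k + 1 / 2) * b\<bar> = (2 * k + 1 / 2) * \<bar>b\<bar>" "\<bar>(k + 1 / 2) * c\<bar> = (k + 1 / 2) * \<bar>c\<bar>"
        by (simp_all add: abs_mult)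
      then show ?thesis by linarith
    qed
    then show "\<bar>k * kern (k - 1) t x - (2 * k + 1 / 2) * kern k t x + (k + 1 / 2) * kern (Suc k) t x\<bar>
      \<le> k * \<bar>kern (k - 1) t x\<bar> + (2 * k + 1 / 2) * \<bar>kern k t x\<bar> + (k + 1 / 2) * \<bar>kern (Suc k) t x\<bar>" .
  qed (use t in auto)
  also have "\<dots> \<le> 4 * T * (k * (gamma_const (k - 1) T * ?Q) + (2 * k + 1 / 2) * (gamma_const k T * ?Q) + (k + 1 / 2) * (gamma_const (Suc k) T * ?Q))"
    using t k by (intro mult_left_mono add_mono kern_bound) auto
  finally show ?thesis by (simp add: algebra_simps)
qed

lemma bkern_bounds:
  assumes r: "0 < r" and N: "n < N"
  obtains C where "\<And>t x. r \<le> t \<Longrightarrow> t \<le> T \<Longrightarrow> \<bar>bkern n T t x\<bar> \<le> C * ((1 + x\<^sup>2) ^ N * exp (- (r * x\<^sup>2)))"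
    "\<And>t x. r \<le> t \<Longrightarrow> t \<le> T \<Longrightarrow> \<bar>bkern1 n T t x\<bar> \<le> C * ((1 + x\<^sup>2) ^ N * exp (- (r * x\<^sup>2)))"
    "\<And>t x. r \<le> t \<Longrightarrow> t \<le> T \<Longrightarrow> \<bar>bkern2 n T t x\<bar> \<le> C * ((1 + x\<^sup>2) ^ N * exp (- (r * x\<^sup>2)))"
proof -
  let ?Q = "\<lambda>x. (1 + x\<^sup>2) ^ N * exp (- (r * x\<^sup>2))"
  have S: "\<bar>\<Sum>k\<le>n. Bernstein n k (t / T) * \<psi> k\<bar> \<le> \<bar>\<Sum>k\<le>n. c k\<bar> * ?Q x"
    if "r \<le> t" "t \<le> T" "\<And>k. k < N \<Longrightarrow> \<bar>\<psi> k\<bar> \<le> c k * ?Q x" for \<psi> c t x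
  proof -
    have "\<bar>\<Sum>k\<le>n. Bernstein n k (t / T) * \<psi> k\<bar> \<le> (\<Sum>k\<le>n. \<bar>Bernstein n k (t / T) * \<psi> k\<bar>)" by (rule sum_abs)
    also have "\<dots> \<le> (\<Sum>k\<le>n. 1 * (c k * ?Q x))"
    proof (rule sum_mono)
      fix k assume "k \<in> {..n}"
      then show "\<bar>Bernstein n k (t / T) * \<psi> k\<bar> \<le> 1 * (c k * ?Q x)"
        unfolding abs_mult using that r N
        by (intro mult_mono that(3)) (auto simp: Bernstein_nonneg intro!: Bernstein_le_1)
    qed
    also have "\<dots> = (\<Sum>k\<le>n. c k) * ?Q x" by (simp add: sum_distrib_right)
    also have "\<dots> \<le> \<bar>\<Sum>k\<le>n. c k\<bar> * ?Q x" by (intro mult_right_mono) auto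
    finally show ?thesis .
  qed
  \<comment> \<open>Absolute values keep the three constants nonnegative, so that their sum
    dominates each of them.\<close>
  define C0 where "C0 = \<bar>\<Sum>k\<le>n. gamma_const k T\<bar>"
  define C1 where "C1 = \<bar>\<Sum>k\<le>n. gamma_const k T * (2 * k + 2 * T)\<bar>"
  define C2 where "C2 = \<bar>\<Sum>k\<le>n. 4 * T * (k * gamma_const (k - 1) T + (2 * k + 1 / 2) * gamma_const k T
     + (k + 1 / 2) * gamma_const (Suc k) T)\<bar>"
  have le: "C0 * ?Q x \<le> (C0 + C1 + C2) * ?Q x" "C1 * ?Q x \<le> (C0 + C1 + C2) * ?Q x" "C2 * ?Q x \<le> (C0 + C1 + C2) * ?Q x" for x
    by (intro mult_right_mono; simp add: C0_def C1_def C2_def)+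
  show ?thesis
  proof (rule that[of "C0 + C1 + C2"])
    fix t x assume t: "r \<le> t" "t \<le> T"
    show "\<bar>bkern n T t x\<bar> \<le> (C0 + C1 + C2) * ?Q x"
      by (rule order_trans[OF _ le(1)], unfold bkern_def C0_def, rule S) (use t r in \<open>auto intro!: kern_bound\<close>)
    show "\<bar>bkern1 n T t x\<bar> \<le> (C0 + C1 + C2) * ?Q x"
      by (rule order_trans[OF _ le(2)], unfold bkern1_def C1_def, rule S) (use t r in \<open>auto intro!: kern1_bound\<close>)
    have "\<bar>bkern2 n T t x\<bar> \<le> C2 * ?Q x"
      unfolding bkern2_def C2_def of_nat_mult of_nat_numeral
      by (rule S[OF t]) (rule kern2_bound[OF r t, unfolded of_nat_mult of_nat_numeral])
    then show "\<bar>bkern2 n T t x\<bar> \<le> (C0 + C1 + C2) * ?Q x"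
      using le(3)[of x] by linarith
  qed
qed

subsection \<open>The Bernstein average of a superharmonic weight\<close>

lemma prod_kern_eq: "(\<Prod>i\<in>UNIV. kern (z i) t (\<theta> $ i)) = (\<Prod>i\<in>UNIV. gamma_const (z i) t) * gauss_moment z t \<theta>"
  by (simp add: kern_def prod.distrib gauss_moment_def)

text \<open>A product of one-dimensional heat solutions, one per coordinate, solves the equation in
  d dimensions. At t = r the product of sums expands into the mixture on the left; at t = T only the
  index n survives.\<close>

lemma bernstein_average_le:
  fixes f :: "real^'n \<Rightarrow> real"
  assumes C2: "C2 f" and lap: "\<And>\<theta>. (\<Sum>i\<in>UNIV. partial i (partial i f) \<theta>) \<le> 0"
    and r: "0 < r" "r \<le> T"
    and i0: "\<And>z. integrable lborel (\<lambda>\<theta>. f \<theta> * gauss_moment z r \<theta>)"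
    and i1: "\<And>z i. integrable lborel (\<lambda>\<theta>. partial i f \<theta> * gauss_moment z r \<theta>)"
    and i2: "\<And>z i. integrable lborel (\<lambda>\<theta>. partial i (partial i f) \<theta> * gauss_moment z r \<theta>)"
  shows "(\<Sum>x\<in>PiE UNIV (\<lambda>i. {..n i}). (\<Prod>i\<in>UNIV. Bernstein (n i) (x i) (r / T))
        * ((\<Prod>i\<in>UNIV. gamma_const (x i) r) * moment f x r))
    \<le> (\<Prod>i\<in>UNIV. gamma_const (n i) T) * moment f n T"
proof -
  have T: "0 < T" using r by linarith
  \<comment> \<open>Large enough that every n i is strictly below N, as the bounds on the
    derivatives require.\<close>
  define N where "N = Suc (\<Sum>i\<in>UNIV. n i)"
  have N: "n i < N" for i
    unfolding N_def using member_le_sum[of i UNIV n] by simp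
  let ?Q = "\<lambda>x. (1 + x\<^sup>2) ^ N * exp (- (r * x\<^sup>2))"
  have "\<forall>i. \<exists>C. \<forall>t x. r \<le> t \<longrightarrow> t \<le> T \<longrightarrow> \<bar>bkern (n i) T t x\<bar> \<le> C * ?Q x
      \<and> \<bar>bkern1 (n i) T t x\<bar> \<le> C * ?Q x \<and> \<bar>bkern2 (n i) T t x\<bar> \<le> C * ?Q x"
  proof
    fix i
    show "\<exists>C. \<forall>t x. r \<le> t \<longrightarrow> t \<le> T \<longrightarrow> \<bar>bkern (n i) T t x\<bar> \<le> C * ?Q x
      \<and> \<bar>bkern1 (n i) T t x\<bar> \<le> C * ?Q x \<and> \<bar>bkern2 (n i) T t x\<bar> \<le> C * ?Q x"
      using bkern_bounds[OF r(1) N[of i], of T] by metis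
  qed
  from choice[OF this] obtain c where "\<forall>i t x. r \<le> t \<longrightarrow> t \<le> T \<longrightarrow> \<bar>bkern (n i) T t x\<bar> \<le> c i * ?Q x
      \<and> \<bar>bkern1 (n i) T t x\<bar> \<le> c i * ?Q x \<and> \<bar>bkern2 (n i) T t x\<bar> \<le> c i * ?Q x" ..
  then have c: "\<bar>bkern (n i) T t x\<bar> \<le> c i * ?Q x" "\<bar>bkern1 (n i) T t x\<bar> \<le> c i * ?Q x"
    "\<bar>bkern2 (n i) T t x\<bar> \<le> c i * ?Q x" if "r \<le> t" "t \<le> T" for i t x
    using that by blast+
  have cf: "continuous_on UNIV f" and cp: "continuous_on UNIV (partial i f)" "continuous_on UNIV (partial i (partial i f))" for i
    using C2 by (auto simp: C2_def)
  have [measurable]: "f \<in> borel_measurable borel" "partial i f \<in> borel_measurable borel"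
    "partial i (partial i f) \<in> borel_measurable borel" for i
    using cf cp by (auto intro: borel_measurable_continuous_onI)
  define P where "P t \<theta> = (\<Prod>i\<in>UNIV. bkern (n i) T t (\<theta> $ i))" for t and \<theta> :: "real^'n"
  \<comment> \<open>The second partial derivative of \<open>P t\<close> in direction i.\<close>
  define R where "R i t \<theta> = bkern2 (n i) T t (\<theta> $ i) * (\<Prod>j\<in>UNIV - {i}. bkern (n j) T t (\<theta> $ j))" for i t and \<theta> :: "real^'n"
  have m_bkern[measurable]: "(\<lambda>p. bkern k T (a p) (b p)) \<in> borel_measurable M" "(\<lambda>p. bkern2 k T (a p) (b p)) \<in> borel_measurable M"
    if [measurable]: "a \<in> borel_measurable M" "b \<in> borel_measurable M" for k a b and M :: "'b measure"
    unfolding bkern_def bkern2_def kern2_def kern_def gamma_const_def Bernstein_def by measurable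
  have R_bound: "\<bar>R i t \<theta>\<bar> \<le> (\<Prod>j\<in>UNIV. c j) * gauss_bound N r \<theta>" if "r \<le> t" "t \<le> T" for i t \<theta>
  proof -
    have "R i t \<theta> = (\<Prod>j\<in>UNIV. (if j = i then bkern2 (n j) T t else bkern (n j) T t) (\<theta> $ j))"
      unfolding R_def by (subst prod.remove[of UNIV i]) auto
    also have "\<bar>\<dots>\<bar> \<le> (\<Prod>j\<in>UNIV. c j) * gauss_bound N r \<theta>"
      by (rule abs_prod_gauss_bound) (use c[OF that] in auto)
    finally show ?thesis .
  qed
  have P_bound: "\<bar>P t \<theta>\<bar> \<le> (\<Prod>j\<in>UNIV. c j) * gauss_bound N r \<theta>" if "r \<le> t" "t \<le> T" for t \<theta>
    unfolding P_def by (rule abs_prod_gauss_bound) (use c[OF that] in auto)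
  have gb: "integrable lborel (\<lambda>\<theta>. f \<theta> * gauss_bound N r \<theta>)"
    by (rule integrable_gauss_boundI[OF i0])
  have fP: "integrable lborel (\<lambda>\<theta>. f \<theta> * P t \<theta>)" if "r \<le> t" "t \<le> T" for t
    by (rule integrable_mult_gauss_dominated[OF gb _ _ P_bound[OF that]]) (unfold P_def, measurable)
  have parts: "integrable lborel (\<lambda>\<theta>. f \<theta> * R i t \<theta>)"
      "integrable lborel (\<lambda>\<theta>. partial i (partial i f) \<theta> * P t \<theta>)"
      "(LINT \<theta>|lborel. f \<theta> * R i t \<theta>) = (LINT \<theta>|lborel. partial i (partial i f) \<theta> * P t \<theta>)"
    if t: "r \<le> t" "t \<le> T" for i t
  proof -
    have t0: "t > 0" using r t by linarith
    have c2: "continuous_on UNIV (bkern2 (n j) T t)" for j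
      unfolding bkern2_def[abs_def] kern2_def kern_def by (intro continuous_intros)
    show "integrable lborel (\<lambda>\<theta>. f \<theta> * R i t \<theta>)"
      "integrable lborel (\<lambda>\<theta>. partial i (partial i f) \<theta> * P t \<theta>)"
      "(LINT \<theta>|lborel. f \<theta> * R i t \<theta>) = (LINT \<theta>|lborel. partial i (partial i f) \<theta> * P t \<theta>)"
      unfolding R_def P_def
      by (rule integral_second_partial_parts[OF C2 bkern_deriv bkern1_deriv[OF t0] c2
            c(1)[OF t] c(2)[OF t] c(3)[OF t]
            gb integrable_gauss_boundI[OF i1] integrable_gauss_boundI[OF i2]])+
  qed
  have le: "(LINT \<theta>|lborel. f \<theta> * P r \<theta>) \<le> (LINT \<theta>|lborel. f \<theta> * P T \<theta>)"
  \<comment> \<open>In \<open>B\<close>, each of the \<open>CARD('n)\<close> terms of the sum is at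
    most the product of the c j times the envelope, and 1 / (4 t^2) is largest at t = r.\<close>
  proof (rule integral_mono_of_derivative_nonneg[where B="\<lambda>\<theta>. (CARD('n) * (\<Prod>j\<in>UNIV. c j)) / (4 * r\<^sup>2) * \<bar>f \<theta> * gauss_bound N r \<theta>\<bar>"
        and g'="\<lambda>t \<theta>. f \<theta> * (- (1 / (4 * t\<^sup>2)) * (\<Sum>i\<in>UNIV. R i t \<theta>))"])
    show "r \<le> T" by fact
    show "integrable lborel (\<lambda>\<theta>. (CARD('n) * (\<Prod>j\<in>UNIV. c j)) / (4 * r\<^sup>2) * \<bar>f \<theta> * gauss_bound N r \<theta>\<bar>)"
      using gb by (intro integrable_mult_right integrable_abs)
    show "integrable lborel (\<lambda>\<theta>. f \<theta> * P r \<theta>)" "integrable lborel (\<lambda>\<theta>. f \<theta> * P T \<theta>)"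
      using fP r by auto
    show "(\<lambda>(t, \<theta>). indicator {r..T} t * (f \<theta> * (- (1 / (4 * t\<^sup>2)) * (\<Sum>i\<in>UNIV. R i t \<theta>)))) \<in> borel_measurable (borel \<Otimes>\<^sub>M borel)"
      unfolding R_def by measurable
    fix \<theta> :: "real^'n"
    have cb: "continuous_on {r..T} (\<lambda>t. bkern k T t x)" "continuous_on {r..T} (\<lambda>t. bkern2 k T t x)" for k x
    proof -
      have ck: "continuous_on {r..T} (\<lambda>t. kern k t x)" for k
        by (rule DERIV_continuous_on, rule has_field_derivative_at_within, rule kern_deriv_time) (use r in auto)
      show "continuous_on {r..T} (\<lambda>t. bkern k T t x)" "continuous_on {r..T} (\<lambda>t. bkern2 k T t x)"
        unfolding bkern_def bkern2_def kern2_def Bernstein_def using T by (intro continuous_intros ck; simp)+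
    qed
    show "continuous_on {r..T} (\<lambda>t. f \<theta> * (- (1 / (4 * t\<^sup>2)) * (\<Sum>i\<in>UNIV. R i t \<theta>)))"
      unfolding R_def using r by (intro continuous_intros cb) auto
  next
    fix t \<theta> assume t: "t \<in> {r..T}"
    then have t0: "t > 0" using r by auto
    have "((\<lambda>t. P t \<theta>) has_real_derivative
        (\<Sum>i\<in>UNIV. - (1 / (4 * t\<^sup>2)) * bkern2 (n i) T t (\<theta> $ i) * (\<Prod>j\<in>UNIV - {i}. bkern (n j) T t (\<theta> $ j)))) (at t)"
      unfolding P_def by (intro has_field_derivative_prod bkern_heat t0 T)
    then have "((\<lambda>t. P t \<theta>) has_real_derivative (- (1 / (4 * t\<^sup>2)) * (\<Sum>i\<in>UNIV. R i t \<theta>))) (at t)"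
      by (simp only: R_def sum_distrib_left mult.assoc)
    then show "((\<lambda>t. f \<theta> * P t \<theta>) has_real_derivative f \<theta> * (- (1 / (4 * t\<^sup>2)) * (\<Sum>i\<in>UNIV. R i t \<theta>))) (at t)"
      by (rule DERIV_cmult)
    have "\<bar>\<Sum>i\<in>UNIV. R i t \<theta>\<bar> \<le> (\<Sum>i\<in>(UNIV::'n set). (\<Prod>j\<in>UNIV. c j) * gauss_bound N r \<theta>)"
      by (rule order_trans[OF sum_abs sum_mono]) (use R_bound t in auto)
    then have 1: "\<bar>\<Sum>i\<in>UNIV. R i t \<theta>\<bar> \<le> CARD('n) * (\<Prod>j\<in>UNIV. c j) * gauss_bound N r \<theta>"
      by simp
    have "\<bar>- (1 / (4 * t\<^sup>2)) * (\<Sum>i\<in>UNIV. R i t \<theta>)\<bar> = 1 / (4 * t\<^sup>2) * \<bar>\<Sum>i\<in>UNIV. R i t \<theta>\<bar>"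
      by (simp add: abs_mult)
    also have "\<dots> \<le> 1 / (4 * r\<^sup>2) * (CARD('n) * (\<Prod>j\<in>UNIV. c j) * gauss_bound N r \<theta>)"
      using t r 1 by (intro mult_mono) (auto intro!: divide_left_mono power_mono mult_pos_pos)
    finally have 2: "\<bar>- (1 / (4 * t\<^sup>2)) * (\<Sum>i\<in>UNIV. R i t \<theta>)\<bar> \<le> 1 / (4 * r\<^sup>2) * (CARD('n) * (\<Prod>j\<in>UNIV. c j) * gauss_bound N r \<theta>)" .
    show "\<bar>f \<theta> * (- (1 / (4 * t\<^sup>2)) * (\<Sum>i\<in>UNIV. R i t \<theta>))\<bar>
        \<le> (CARD('n) * (\<Prod>j\<in>UNIV. c j)) / (4 * r\<^sup>2) * \<bar>f \<theta> * gauss_bound N r \<theta>\<bar>"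
      using mult_left_mono[OF 2 abs_ge_zero[of "f \<theta>"]] gauss_bound_nonneg[of N r \<theta>]
      by (simp add: abs_mult mult_ac)
  next
    fix t assume "t \<in> {r..T}"
    then have t: "r \<le> t" "t \<le> T" "t > 0" using r by auto
    \<comment> \<open>The minus sign of the backward equation meets the nonpositive Laplacian of f,
      onto which the derivatives of \<open>P t\<close> have been moved.\<close>
    have "(LINT \<theta>|lborel. f \<theta> * (- (1 / (4 * t\<^sup>2)) * (\<Sum>i\<in>UNIV. R i t \<theta>)))
       = (LINT \<theta>|lborel. - (1 / (4 * t\<^sup>2)) * (\<Sum>i\<in>UNIV. f \<theta> * R i t \<theta>))"
      by (simp add: sum_distrib_left mult_ac)
    also have "\<dots> = - (1 / (4 * t\<^sup>2)) * (\<Sum>i\<in>UNIV. LINT \<theta>|lborel. f \<theta> * R i t \<theta>)"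
      using parts(1)[OF t(1,2)] by (subst integral_mult_right_zero) (simp add: Bochner_Integration.integral_sum)
    also have "\<dots> = - (1 / (4 * t\<^sup>2)) * (LINT \<theta>|lborel. (\<Sum>i\<in>UNIV. partial i (partial i f) \<theta>) * P t \<theta>)"
      using parts(2)[OF t(1,2)] by (simp add: parts(3)[OF t(1,2)] sum_distrib_right Bochner_Integration.integral_sum)
    finally have eq: "(LINT \<theta>|lborel. f \<theta> * (- (1 / (4 * t\<^sup>2)) * (\<Sum>i\<in>UNIV. R i t \<theta>)))
       = (1 / (4 * t\<^sup>2)) * (LINT \<theta>|lborel. - (\<Sum>i\<in>UNIV. partial i (partial i f) \<theta>) * P t \<theta>)"
      by simp
    have "P t \<theta> \<ge> 0" for \<theta>
      unfolding P_def using t by (intro prod_nonneg_UNIV bkern_nonneg)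
    then show "0 \<le> (LINT \<theta>|lborel. f \<theta> * (- (1 / (4 * t\<^sup>2)) * (\<Sum>i\<in>UNIV. R i t \<theta>)))"
      unfolding eq using t lap
      by (intro mult_nonneg_nonneg Bochner_Integration.integral_nonneg) auto
  qed
  have atT: "(LINT \<theta>|lborel. f \<theta> * P T \<theta>) = (\<Prod>i\<in>UNIV. gamma_const (n i) T) * moment f n T"
  proof -
    have "(\<lambda>\<theta>. f \<theta> * P T \<theta>) = (\<lambda>\<theta>. (\<Prod>i\<in>UNIV. gamma_const (n i) T) * (f \<theta> * gauss_moment n T \<theta>))"
      by (simp add: P_def bkern_end[OF T] prod_kern_eq mult_ac)
    then show ?thesis by (simp add: moment_def)
  qed
  have atr: "(LINT \<theta>|lborel. f \<theta> * P r \<theta>) = (\<Sum>x\<in>PiE UNIV (\<lambda>i. {..n i}). (\<Prod>i\<in>UNIV. Bernstein (n i) (x i) (r / T))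
        * ((\<Prod>i\<in>UNIV. gamma_const (x i) r) * moment f x r))"
  proof -
    have "P r \<theta> = (\<Sum>x\<in>PiE UNIV (\<lambda>i. {..n i}). (\<Prod>i\<in>UNIV. Bernstein (n i) (x i) (r / T))
        * ((\<Prod>i\<in>UNIV. gamma_const (x i) r) * gauss_moment x r \<theta>))" for \<theta>
      unfolding P_def bkern_def
      by (subst prod_sum_PiE) (simp_all add: prod.distrib prod_kern_eq)
    then have "(\<lambda>\<theta>. f \<theta> * P r \<theta>) = (\<lambda>\<theta>. \<Sum>x\<in>PiE UNIV (\<lambda>i. {..n i}). (\<Prod>i\<in>UNIV. Bernstein (n i) (x i) (r / T))
        * ((\<Prod>i\<in>UNIV. gamma_const (x i) r) * (f \<theta> * gauss_moment x r \<theta>)))"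
      by (simp add: sum_distrib_left mult_ac)
    then show ?thesis
      using i0 by (simp add: Bochner_Integration.integral_sum moment_def)
  qed
  show ?thesis using le unfolding atT atr .
qed

subsection \<open>Sign changes\<close>

definition sign_vectors :: "('n \<Rightarrow> real) set" where
  "sign_vectors = PiE UNIV (\<lambda>_. {1, -1})"

definition flip :: "('n \<Rightarrow> real) \<Rightarrow> real^'n \<Rightarrow> real^'n" where
  "flip a \<theta> = (\<chi> i. a i * \<theta> $ i)"

lemma sign_vectors_iff: "a \<in> sign_vectors \<longleftrightarrow> (\<forall>i. a i = 1 \<or> a i = -1)"
  by (auto simp: sign_vectors_def PiE_iff)

lemma sign_vector_square: "a \<in> sign_vectors \<Longrightarrow> a i * a i = 1"
  by (auto simp: sign_vectors_iff) (metis minus_mult_minus mult_1)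

lemma finite_sign_vectors: "finite (sign_vectors :: ('n::finite \<Rightarrow> real) set)"
  unfolding sign_vectors_def by (intro finite_PiE) auto

lemma sign_symmetrize_eq: "sign_symmetrize h \<theta> = (\<Sum>a\<in>sign_vectors. h (flip a \<theta>))"
  by (simp add: sign_symmetrize_def sign_vectors_def flip_def)

lemma flip_flip: "flip a (flip b \<theta>) = flip (\<lambda>i. a i * b i) \<theta>"
  by (simp add: flip_def vec_eq_iff)

lemma flip_shift: "flip a (\<theta> + t *\<^sub>R axis i 1) = flip a \<theta> + (a i * t) *\<^sub>R axis i 1"
  by (auto simp: flip_def vec_eq_iff axis_def algebra_simps)

lemma continuous_flip: "continuous_on UNIV (flip a)"
  unfolding flip_def[abs_def] by (intro continuous_on_vec_lambda continuous_intros)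

text \<open>Multiplication by b is an involution of the sign vectors, so it only permutes the
  summands.\<close>

lemma sign_symmetrize_flip:
  fixes h :: "real^'n \<Rightarrow> real"
  assumes b: "b \<in> sign_vectors"
  shows "sign_symmetrize h (flip b \<theta>) = sign_symmetrize h \<theta>"
proof -
  have bij: "bij_betw (\<lambda>a i. a i * b i) sign_vectors (sign_vectors :: ('n \<Rightarrow> real) set)"
  proof (rule bij_betw_byWitness[where f'="\<lambda>a i. a i * b i"])
    show "\<forall>a\<in>sign_vectors. (\<lambda>i. (a i * b i) * b i) = a" "\<forall>a\<in>sign_vectors. (\<lambda>i. (a i * b i) * b i) = a"
      using sign_vector_square[OF b] by (auto simp: mult.assoc)
    show "(\<lambda>a i. a i * b i) ` sign_vectors \<subseteq> (sign_vectors :: ('n \<Rightarrow> real) set)"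
      "(\<lambda>a i. a i * b i) ` sign_vectors \<subseteq> (sign_vectors :: ('n \<Rightarrow> real) set)"
      using b by (auto simp: sign_vectors_iff) (metis minus_mult_minus mult_1 mult_minus1_right)+
  qed
  show ?thesis
    unfolding sign_symmetrize_eq flip_flip
    by (rule sum.reindex_bij_betw[OF bij, of "\<lambda>a. h (flip a \<theta>)"])
qed

lemma partialI:
  assumes "((\<lambda>t. g (\<theta> + t *\<^sub>R axis i 1)) has_real_derivative D) (at 0)"
  shows "partial i g \<theta> = D"
  using assms unfolding partial_def by (rule DERIV_imp_deriv)

text \<open>The factor \<sigma> allows iteration: starting from \<sigma> = 1, the first partial has
  factor b i, and applying the lemma to it gives b i * b i = 1 for the second.\<close>

lemma partial_flip:
  assumes g: "has_partials g" and b: "b \<in> sign_vectors"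
    and even: "\<And>\<theta>. g (flip b \<theta>) = \<sigma> * g \<theta>"
  shows "partial i g (flip b \<theta>) = \<sigma> * b i * partial i g \<theta>"
proof (rule partialI)
  have "flip b \<theta> + t *\<^sub>R axis i 1 = flip b (\<theta> + (b i * t) *\<^sub>R axis i 1)" for t
    using sign_vector_square[OF b, of i] by (simp add: flip_shift mult.assoc[symmetric])
  then have eq: "(\<lambda>t. g (flip b \<theta> + t *\<^sub>R axis i 1)) = (\<lambda>t. \<sigma> * g (\<theta> + (b i * t) *\<^sub>R axis i 1))"
    by (simp add: even)
  have "((\<lambda>t. g (\<theta> + t *\<^sub>R axis i 1)) has_real_derivative partial i g \<theta>) (at (b i * 0))"
    using partial_has_derivative[OF g] by simp
  then have "((\<lambda>t. g (\<theta> + (b i * t) *\<^sub>R axis i 1)) has_real_derivative partial i g \<theta> * b i) (at 0)"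
    by (rule DERIV_chain2) (auto intro!: derivative_eq_intros)
  then show "((\<lambda>t. g (flip b \<theta> + t *\<^sub>R axis i 1)) has_real_derivative \<sigma> * b i * partial i g \<theta>) (at 0)"
    unfolding eq by (auto intro!: derivative_eq_intros)
qed

text \<open>Arbitrary coefficients c make the class of weighted sign sums closed under partial
  derivatives: the chain rule only multiplies c a by a i.\<close>

lemma sign_sum_derivative:
  fixes h :: "real^'n \<Rightarrow> real"
  assumes h: "has_partials h"
  shows "((\<lambda>t. \<Sum>a\<in>sign_vectors. c a * h (flip a (\<theta> + t *\<^sub>R axis i 1)))
      has_real_derivative (\<Sum>a\<in>sign_vectors. (c a * a i) * partial i h (flip a \<theta>))) (at 0)"
proof (intro DERIV_sum)
  fix a :: "'n \<Rightarrow> real"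
  have "((\<lambda>t. h (flip a \<theta> + t *\<^sub>R axis i 1)) has_real_derivative partial i h (flip a \<theta>)) (at (a i * 0))"
    using partial_has_derivative[OF h] by simp
  then have "((\<lambda>t. h (flip a \<theta> + (a i * t) *\<^sub>R axis i 1)) has_real_derivative partial i h (flip a \<theta>) * a i) (at 0)"
    by (rule DERIV_chain2) (auto intro!: derivative_eq_intros)
  then show "((\<lambda>t. c a * h (flip a (\<theta> + t *\<^sub>R axis i 1))) has_real_derivative (c a * a i) * partial i h (flip a \<theta>)) (at 0)"
    unfolding flip_shift by (auto intro!: derivative_eq_intros)
qed

lemma
  fixes h :: "real^'n \<Rightarrow> real"
  assumes h: "has_partials h"
  shows has_partials_sign_sum: "has_partials (\<lambda>\<theta>. \<Sum>a\<in>sign_vectors. c a * h (flip a \<theta>))"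
    and partial_sign_sum: "partial i (\<lambda>\<theta>. \<Sum>a\<in>sign_vectors. c a * h (flip a \<theta>))
       = (\<lambda>\<theta>. \<Sum>a\<in>sign_vectors. (c a * a i) * partial i h (flip a \<theta>))"
  using sign_sum_derivative[OF h, of c] unfolding has_partials_def
  by (auto simp: real_differentiable_def intro!: ext partialI)

lemma continuous_sign_sum:
  fixes h :: "real^'n \<Rightarrow> real"
  assumes "continuous_on UNIV h"
  shows "continuous_on UNIV (\<lambda>\<theta>. \<Sum>a\<in>sign_vectors. c a * h (flip a \<theta>))"
  by (intro continuous_intros continuous_on_compose2[OF assms continuous_flip]) auto

text \<open>In a pure second partial the coefficient is a i * a i = 1, so the Laplacian of the
  symmetrisation at \<theta> is the sum of the Laplacians of h at the flipped points.\<close>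

lemma
  fixes h :: "real^'n \<Rightarrow> real"
  assumes h: "C2 h"
  shows C2_sign_symmetrize: "C2 (sign_symmetrize h)"
    and superharmonic_sign_symmetrize: "superharmonic h \<Longrightarrow> superharmonic (sign_symmetrize h)"
proof -
  have f: "sign_symmetrize h = (\<lambda>\<theta>. \<Sum>a\<in>sign_vectors. 1 * h (flip a \<theta>))"
    by (simp add: sign_symmetrize_eq fun_eq_iff)
  have p1: "partial i (sign_symmetrize h) = (\<lambda>\<theta>. \<Sum>a\<in>sign_vectors. (1 * a i) * partial i h (flip a \<theta>))" for i
    unfolding f using h by (intro partial_sign_sum) (auto simp: C2_def)
  have p2: "partial j (partial i (sign_symmetrize h))
      = (\<lambda>\<theta>. \<Sum>a\<in>sign_vectors. ((1 * a i) * a j) * partial j (partial i h) (flip a \<theta>))" for i j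
    unfolding p1 using h by (intro partial_sign_sum) (auto simp: C2_def)
  show "C2 (sign_symmetrize h)"
    unfolding C2_def p2 unfolding p1 unfolding f using h
    by (intro conjI allI continuous_sign_sum has_partials_sign_sum) (auto simp: C2_def)
  show "superharmonic (sign_symmetrize h)" if "superharmonic h"
    unfolding superharmonic_def
  proof
    fix \<theta> :: "real^'n"
    have "(\<Sum>i\<in>UNIV. partial i (partial i (sign_symmetrize h)) \<theta>)
        = (\<Sum>i\<in>UNIV. \<Sum>a\<in>sign_vectors. partial i (partial i h) (flip a \<theta>))"
      unfolding p2 by (intro sum.cong refl) (simp add: sign_vector_square)
    also have "\<dots> = (\<Sum>a\<in>sign_vectors. \<Sum>i\<in>UNIV. partial i (partial i h) (flip a \<theta>))"
      by (rule sum.swap)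
    also have "\<dots> \<le> 0"
      by (rule sum_nonpos) (use that in \<open>simp add: superharmonic_def\<close>)
    finally show "(\<Sum>i\<in>UNIV. partial i (partial i (sign_symmetrize h)) \<theta>) \<le> 0" .
  qed
qed

section \<open>From integrability on the orthant to integrability on the whole space\<close>

lemma lborel_distr_flip:
  assumes a: "a \<in> sign_vectors"
  shows "distr lborel borel (flip a) = (lborel :: (real^'n) measure)"
proof -
  let ?c = "\<lambda>j::real^'n. a (axis_index j)"
  have inj: "inj (\<lambda>i::'n. axis i (1::real))"
    by (auto simp: inj_def axis_eq_axis)
  have abs: "\<bar>a i\<bar> = 1" for i using a by (auto simp: sign_vectors_iff) (metis abs_minus_cancel abs_one)
  have T: "0 + (\<Sum>j\<in>Basis. (?c j * (x \<bullet> j)) *\<^sub>R j) = flip a x" for x :: "real^'n"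
  proof -
    have "(\<Sum>j\<in>Basis. (?c j * (x \<bullet> j)) *\<^sub>R j) = (\<Sum>i\<in>UNIV. (a i * x $ i) *\<^sub>R axis i 1)"
      by (simp add: Basis_vec_eq sum.reindex[OF inj] o_def inner_axis)
    also have "\<dots> = flip a x"
      by (simp add: flip_def vec_eq_iff axis_def if_distrib[where f="\<lambda>z. _ * z"] cong: if_cong)
    finally show ?thesis by simp
  qed
  have c0: "?c j \<noteq> 0" if "j \<in> Basis" for j using abs[of "axis_index j"] by auto
  have "lborel = density (distr lborel borel (\<lambda>x. 0 + (\<Sum>j\<in>Basis. (?c j * (x \<bullet> j)) *\<^sub>R j))) (\<lambda>_. (\<Prod>j\<in>Basis. \<bar>?c j\<bar>))"
    by (rule lborel_affine_euclidean[OF c0])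
  then show ?thesis unfolding T by (simp add: abs density_1)
qed

text \<open>Some sign vector moves \<theta> into the nonnegative orthant, so |g \<theta>| is one
  summand of the sum over all flips of the restricted |g|. Domination by this sum makes the overlap
  of the orthants on the coordinate hyperplanes harmless.\<close>

lemma integrable_of_orthant:
  fixes g :: "real^'n \<Rightarrow> real"
  assumes [measurable]: "g \<in> borel_measurable borel"
    and even: "\<And>a \<theta>. a \<in> sign_vectors \<Longrightarrow> \<bar>g (flip a \<theta>)\<bar> = \<bar>g \<theta>\<bar>"
    and int: "set_integrable lborel nonneg_orthant (\<lambda>\<theta>. \<bar>g \<theta>\<bar>)"
  shows "integrable lborel g"
proof (rule Bochner_Integration.integrable_bound)
  let ?k = "\<lambda>\<theta>::real^'n. indicator nonneg_orthant \<theta> *\<^sub>R \<bar>g \<theta>\<bar>"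
  have k: "integrable lborel (\<lambda>\<theta>. ?k (flip a \<theta>))" if a: "a \<in> sign_vectors" for a
  proof -
    have "integrable (distr lborel borel (flip a)) ?k"
      using int by (simp add: lborel_distr_flip[OF a] set_integrable_def)
    then show ?thesis
      by (subst (asm) integrable_distr_eq) (auto intro: borel_measurable_continuous_onI[OF continuous_flip])
  qed
  then show "integrable lborel (\<lambda>\<theta>. \<Sum>a\<in>sign_vectors. ?k (flip a \<theta>))"
    by (intro Bochner_Integration.integrable_sum)
  show "AE \<theta> in lborel. norm (g \<theta>) \<le> norm (\<Sum>a\<in>sign_vectors. ?k (flip a \<theta>))"
  proof (rule AE_I2)
    fix \<theta> :: "real^'n"
    define a where "a i = (if 0 \<le> \<theta> $ i then 1 else -1 :: real)" for i
    have a: "a \<in> sign_vectors" by (auto simp: a_def sign_vectors_iff)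
    have "flip a \<theta> \<in> nonneg_orthant" by (auto simp: a_def flip_def nonneg_orthant_def)
    then have "norm (g \<theta>) = ?k (flip a \<theta>)" using even[OF a] by simp
    also have "\<dots> \<le> (\<Sum>a\<in>sign_vectors. ?k (flip a \<theta>))"
      by (rule member_le_sum[OF a]) (auto simp: finite_sign_vectors)
    finally show "norm (g \<theta>) \<le> norm (\<Sum>a\<in>sign_vectors. ?k (flip a \<theta>))" by simp
  qed
qed measurable

lemma gauss_moment_flip: "a \<in> sign_vectors \<Longrightarrow> gauss_moment z t (flip a \<theta>) = gauss_moment z t \<theta>"
proof -
  assume a: "a \<in> sign_vectors"
  have "(a i * x)\<^sup>2 = x\<^sup>2" for i x
    using sign_vector_square[OF a, of i] by (simp add: power2_eq_square mult_ac)
  then show ?thesis by (simp add: gauss_moment_def flip_def power_mult)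
qed

text \<open>Symmetry is asked of the absolute value of g so as to include the first partials of f,
  which are odd in one coordinate.\<close>

lemma integrable_gauss_moment_of_orthant:
  fixes g :: "real^'n \<Rightarrow> real"
  assumes [measurable]: "g \<in> borel_measurable borel"
    and even: "\<And>a \<theta>. a \<in> sign_vectors \<Longrightarrow> \<bar>g (flip a \<theta>)\<bar> = \<bar>g \<theta>\<bar>"
    and int: "set_integrable lborel nonneg_orthant (\<lambda>\<theta>. \<bar>g \<theta>\<bar> * gauss_moment z t \<theta>)"
  shows "integrable lborel (\<lambda>\<theta>. g \<theta> * gauss_moment z t \<theta>)"
  by (rule integrable_of_orthant)
     (use even int gauss_moment_nonneg[of z t] in \<open>auto simp: abs_mult gauss_moment_flip\<close>)

subsection \<open>Growth of the logarithm of the moments\<close>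

text \<open>The k-th power of u / k \<le> exp (u / k).\<close>

lemma power_le_power_exp:
  fixes u :: real
  assumes u: "0 \<le> u"
  shows "u ^ k \<le> real k ^ k * exp u"
proof (cases "k = 0")
  case False
  have "u / k \<le> exp (u / k)" using exp_ge_add_one_self[of "u / k"] by linarith
  then have "u \<le> k * exp (u / k)" using False by (simp add: field_simps)
  then have "u ^ k \<le> (k * exp (u / k)) ^ k" using u by (intro power_mono)
  also have "\<dots> = real k ^ k * exp u"
    using False by (simp add: power_mult_distrib exp_of_nat_mult[symmetric])
  finally show ?thesis .
qed (use u in simp)

text \<open>Source of the base 4: logarithms of moments grow like k ln k \<le> k^2, and squaring k
  \<le> 2^k gives 4^k. Unlike k^2, the bound 4^k is multiplicative over coordinates and over x and
  y.\<close>

lemma square_le_4_power: "real k * real k \<le> 4 ^ k"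
proof -
  have "real k \<le> 2 ^ k" using of_nat_less_two_power[of k, where 'a=real] by linarith
  then have "real k * real k \<le> 2 ^ k * 2 ^ k" by (intro mult_mono) auto
  also have "\<dots> = 4 ^ k" by (simp add: power_mult_distrib[symmetric])
  finally show ?thesis .
qed

lemma le_4_power: "real k \<le> 4 ^ k"
proof -
  have "real k \<le> real k * real k" by (cases k) auto
  also note square_le_4_power
  finally show ?thesis .
qed

text \<open>Half of the Gaussian decay pays for the power: \<open>power_le_power_exp\<close> is used
  with u = t x^2 / 2.\<close>

lemma gauss_moment_upper:
  assumes t: "t > 0"
  shows "gauss_moment z t \<theta> \<le> (\<Prod>i\<in>UNIV. (real (z i) * (2 / t)) ^ z i) * gauss_moment (\<lambda>_. 0) (t / 2) \<theta>"
proof -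
  have "gauss_moment z t \<theta> \<le> (\<Prod>i\<in>UNIV. (real (z i) * (2 / t)) ^ z i * exp (- (t / 2 * (\<theta> $ i)\<^sup>2)))"
    unfolding gauss_moment_def
  proof (intro prod_mono conjI)
    fix i
    let ?x = "\<theta> $ i"
    have "?x ^ (2 * z i) = (2 / t) ^ z i * (t / 2 * ?x\<^sup>2) ^ z i"
      using t by (simp add: power_mult power_mult_distrib[symmetric])
    also have "\<dots> \<le> (2 / t) ^ z i * (real (z i) ^ z i * exp (t / 2 * ?x\<^sup>2))"
      using t by (intro mult_left_mono power_le_power_exp) auto
    finally have "?x ^ (2 * z i) * exp (- (t * ?x\<^sup>2))
        \<le> (2 / t) ^ z i * (real (z i) ^ z i * exp (t / 2 * ?x\<^sup>2)) * exp (- (t * ?x\<^sup>2))"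
      by (intro mult_right_mono) auto
    also have "\<dots> = (real (z i) * (2 / t)) ^ z i * (exp (t / 2 * ?x\<^sup>2) * exp (- (t * ?x\<^sup>2)))"
      by (simp only: power_mult_distrib mult_ac)
    also have "exp (t / 2 * ?x\<^sup>2) * exp (- (t * ?x\<^sup>2)) = exp (- (t / 2 * ?x\<^sup>2))"
      by (simp add: exp_add[symmetric] field_simps)
    finally show "?x ^ (2 * z i) * exp (- (t * ?x\<^sup>2)) \<le> (real (z i) * (2 / t)) ^ z i * exp (- (t / 2 * ?x\<^sup>2))" .
    show "0 \<le> ?x ^ (2 * z i) * exp (- (t * ?x\<^sup>2))" by simp
  qed
  then show ?thesis by (simp add: prod.distrib gauss_moment_def)
qed

lemma gauss_moment_lower:
  assumes \<delta>: "0 \<le> \<delta>" and \<theta>: "\<And>i. \<delta> \<le> \<bar>\<theta> $ i\<bar>"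
  shows "\<delta> ^ (2 * (\<Sum>i\<in>UNIV. z i)) * gauss_moment (\<lambda>_. 0) t \<theta> \<le> gauss_moment z t \<theta>"
proof -
  have "\<delta> ^ (2 * (\<Sum>i\<in>UNIV. z i)) * gauss_moment (\<lambda>_. 0) t \<theta>
      = (\<Prod>i\<in>UNIV. \<delta> ^ (2 * z i) * exp (- (t * (\<theta> $ i)\<^sup>2)))"
    by (simp add: gauss_moment_def prod.distrib sum_distrib_left power_sum)
  also have "\<dots> \<le> gauss_moment z t \<theta>"
    unfolding gauss_moment_def
  proof (intro prod_mono conjI mult_right_mono)
    fix i
    have "\<delta> ^ (2 * z i) \<le> \<bar>\<theta> $ i\<bar> ^ (2 * z i)" by (intro power_mono \<theta> \<delta>)
    then show "\<delta> ^ (2 * z i) \<le> (\<theta> $ i) ^ (2 * z i)" by (simp add: power_even_abs)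
  qed (use \<delta> in auto)
  finally show ?thesis .
qed

text \<open>The given point may lie on a coordinate hyperplane, where Gaussian moments have zeros. A
  small move away from all hyperplanes keeps g positive by continuity.\<close>

lemma positive_off_hyperplanes:
  fixes g :: "real^'n \<Rightarrow> real"
  assumes g: "continuous_on UNIV g" and pos: "0 < g \<theta>0"
  obtains \<delta> where "0 < \<delta>" "open {\<theta>. 0 < g \<theta> \<and> (\<forall>i. \<delta> < \<bar>\<theta> $ i\<bar>)}" "{\<theta>. 0 < g \<theta> \<and> (\<forall>i. \<delta> < \<bar>\<theta> $ i\<bar>)} \<noteq> {}"
proof -
  \<comment> \<open>Each coordinate moves away from 0, so for \<delta> > 0 its absolute value grows
    by exactly \<delta>.\<close>
  define p where "p \<delta> = \<theta>0 + \<delta> *\<^sub>R (\<chi> i. if 0 \<le> \<theta>0 $ i then 1 else - 1)" for \<delta>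
  have pc: "continuous_on UNIV p" unfolding p_def by (intro continuous_intros)
  have "isCont (\<lambda>\<delta>. g (p \<delta>)) 0"
    using continuous_on_compose2[OF g pc] by (simp add: continuous_on_eq_continuous_at)
  moreover have "p 0 = \<theta>0" by (simp add: p_def vec_eq_iff)
  ultimately have "((\<lambda>\<delta>. g (p \<delta>)) \<longlongrightarrow> g \<theta>0) (at 0)" by (simp add: isCont_def)
  then have "eventually (\<lambda>\<delta>. 0 < g (p \<delta>)) (at 0)"
    using pos by (rule order_tendstoD)
  then obtain e where e: "e > 0" "\<And>\<delta>. \<delta> \<noteq> 0 \<Longrightarrow> \<bar>\<delta>\<bar> < e \<Longrightarrow> 0 < g (p \<delta>)"
    by (auto simp: eventually_at dist_real_def)
  \<comment> \<open>At e / 2 the value of g is still positive; the threshold e / 4 leaves the strict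
    inequality that makes the set open.\<close>
  let ?\<delta> = "e / 2"
  have "0 < g (p ?\<delta>)" using e by (intro e(2)) auto
  moreover have "e / 4 < \<bar>p ?\<delta> $ i\<bar>" for i using e(1) by (auto simp: p_def)
  ultimately have ne: "p ?\<delta> \<in> {\<theta>. 0 < g \<theta> \<and> (\<forall>i. e / 4 < \<bar>\<theta> $ i\<bar>)}" by simp
  have "{\<theta>. 0 < g \<theta> \<and> (\<forall>i. e / 4 < \<bar>\<theta> $ i\<bar>)} = {\<theta>. 0 < g \<theta>} \<inter> (\<Inter>i. {\<theta>. e / 4 < \<bar>\<theta> $ i\<bar>})" by auto
  also have "open \<dots>"
    by (intro open_Int open_INT finite_UNIV ballI open_Collect_less g) (auto intro!: continuous_intros)
  finally show ?thesis using ne e(1) by (intro that[of "e / 4"]) auto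
qed

lemma integral_open_pos:
  fixes g :: "'a::euclidean_space \<Rightarrow> real"
  assumes U: "open U" "U \<noteq> {}" and int: "integrable lborel g"
    and pos: "\<And>\<theta>. \<theta> \<in> U \<Longrightarrow> 0 < g \<theta>" and nonneg: "\<And>\<theta>. 0 \<le> g \<theta>"
  shows "0 < (LINT \<theta>|lborel. g \<theta>)"
proof -
  have "(LINT \<theta>|lborel. g \<theta>) \<noteq> 0"
  proof
    assume "(LINT \<theta>|lborel. g \<theta>) = 0"
    then have "AE \<theta> in lborel. g \<theta> = 0"
      using integral_nonneg_eq_0_iff_AE[OF int] nonneg by auto
    then have "AE \<theta> in lborel. \<theta> \<notin> U" by eventually_elim (use pos in force)
    moreover have "U \<in> sets lborel" using U by simp
    ultimately have "U \<in> null_sets lborel"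
      by (subst (asm) AE_iff_null_sets[symmetric]) auto
    then have "negligible U"
      by (simp add: negligible_iff_null_sets null_sets_completionI)
    then show False using U open_not_negligible by blast
  qed
  moreover have "0 \<le> (LINT \<theta>|lborel. g \<theta>)" by (intro Bochner_Integration.integral_nonneg nonneg)
  ultimately show ?thesis by linarith
qed

text \<open>Away from the hyperplanes the moment is at least geometric in the total index, so its
  logarithm falls at most linearly; the upper bound by k^k lets it rise at most like k ln k.\<close>

lemma moment_pos_log_bound:
  fixes g :: "real^'n \<Rightarrow> real"
  assumes cont: "continuous_on UNIV g" and nonneg: "\<And>\<theta>. 0 \<le> g \<theta>" and pos: "0 < g \<theta>0"
    and int: "\<And>z t. t > 0 \<Longrightarrow> integrable lborel (\<lambda>\<theta>. g \<theta> * gauss_moment z t \<theta>)"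
    and t: "0 < t"
  shows "\<And>z. 0 < moment g z t" and "\<exists>C. \<forall>z. \<bar>ln (moment g z t)\<bar> \<le> C * 4 ^ (\<Sum>i\<in>UNIV. z i)"
proof -
  obtain \<delta> where \<delta>: "0 < \<delta>" "open {\<theta>. 0 < g \<theta> \<and> (\<forall>i. \<delta> < \<bar>\<theta> $ i\<bar>)}" "{\<theta>. 0 < g \<theta> \<and> (\<forall>i. \<delta> < \<bar>\<theta> $ i\<bar>)} \<noteq> {}"
    using positive_off_hyperplanes[OF cont pos] .
  define U where "U = {\<theta>. 0 < g \<theta> \<and> (\<forall>i. \<delta> < \<bar>\<theta> $ i\<bar>)}"
  note U = \<delta>(2,3)[folded U_def]
  \<comment> \<open>Restricted to \<open>U\<close>, where every coordinate exceeds \<delta> in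
    absolute value and \<open>gauss_moment_lower\<close> applies.\<close>
  define c0 where "c0 = (LINT \<theta>|lborel. indicator U \<theta> *\<^sub>R (g \<theta> * gauss_moment (\<lambda>_. 0) t \<theta>))"
  have Ui: "integrable lborel (\<lambda>\<theta>. indicator U \<theta> *\<^sub>R (g \<theta> * gauss_moment (\<lambda>_. 0) t \<theta>))"
    using U by (intro integrable_mult_indicator int t) auto
  have c0: "0 < c0"
    unfolding c0_def
    by (rule integral_open_pos[OF U Ui])
       (auto simp: U_def gauss_moment_def nonneg intro!: mult_nonneg_nonneg mult_pos_pos prod_pos prod_nonneg)
  have low: "\<delta> ^ (2 * (\<Sum>i\<in>UNIV. z i)) * c0 \<le> moment g z t" for z
  proof -
    have "\<delta> ^ (2 * (\<Sum>i\<in>UNIV. z i)) * c0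
       = (LINT \<theta>|lborel. \<delta> ^ (2 * (\<Sum>i\<in>UNIV. z i)) * (indicator U \<theta> *\<^sub>R (g \<theta> * gauss_moment (\<lambda>_. 0) t \<theta>)))"
      unfolding c0_def by simp
    also have "\<dots> \<le> moment g z t"
      unfolding moment_def
    proof (intro integral_mono integrable_mult_right Ui int t)
      fix \<theta>
      show "\<delta> ^ (2 * (\<Sum>i\<in>UNIV. z i)) * (indicator U \<theta> *\<^sub>R (g \<theta> * gauss_moment (\<lambda>_. 0) t \<theta>)) \<le> g \<theta> * gauss_moment z t \<theta>"
      proof (cases "\<theta> \<in> U")
        case True
        have "\<delta> ^ (2 * (\<Sum>i\<in>UNIV. z i)) * gauss_moment (\<lambda>_. 0) t \<theta> \<le> gauss_moment z t \<theta>"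
          using True \<delta>(1) by (intro gauss_moment_lower) (auto simp: U_def less_imp_le)
        then have "g \<theta> * (\<delta> ^ (2 * (\<Sum>i\<in>UNIV. z i)) * gauss_moment (\<lambda>_. 0) t \<theta>) \<le> g \<theta> * gauss_moment z t \<theta>"
          by (intro mult_left_mono nonneg)
        then show ?thesis using True by (simp add: mult_ac)
      qed (simp add: nonneg gauss_moment_nonneg)
    qed
    finally show ?thesis .
  qed
  have pos': "0 < moment g z t" for z
    using low[of z] c0 \<delta>(1) by (smt (verit) mult_pos_pos zero_less_power)
  show "0 < moment g z t" for z by (rule pos')
  define M0 where "M0 = moment g (\<lambda>_. 0) (t / 2)"
  have up: "moment g z t \<le> (\<Prod>i\<in>UNIV. (real (z i) * (2 / t)) ^ z i) * M0" for z
  proof -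
    have "moment g z t \<le> (LINT \<theta>|lborel. (\<Prod>i\<in>UNIV. (real (z i) * (2 / t)) ^ z i) * (g \<theta> * gauss_moment (\<lambda>_. 0) (t / 2) \<theta>))"
      unfolding moment_def
    proof (intro integral_mono integrable_mult_right int)
      fix \<theta>
      show "g \<theta> * gauss_moment z t \<theta> \<le> (\<Prod>i\<in>UNIV. (real (z i) * (2 / t)) ^ z i) * (g \<theta> * gauss_moment (\<lambda>_. 0) (t / 2) \<theta>)"
        using mult_left_mono[OF gauss_moment_upper[OF t, of z \<theta>] nonneg[of \<theta>]] by (simp add: mult_ac)
    qed (use t in auto)
    then show ?thesis by (simp add: M0_def moment_def)
  qed
  \<comment> \<open>At z = 0 the product in \<open>up\<close> is 1, as 0 ^ 0 = 1, so
    \<open>M0\<close> is at least a positive moment.\<close>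
  have M0: "0 < M0"
  proof -
    have "0 < (\<Prod>i\<in>(UNIV::'n set). (real 0 * (2 / t)) ^ 0) * M0"
      using pos'[of "\<lambda>_. 0"] up[of "\<lambda>_. 0"] by linarith
    then show ?thesis by simp
  qed
  let ?S = "\<lambda>z::'n \<Rightarrow> nat. \<Sum>i\<in>UNIV. z i"
  have S1: "1 \<le> (4::real) ^ ?S z" for z by simp
  have Si: "(4::real) ^ z i \<le> 4 ^ ?S z" for z i
    by (intro power_increasing member_le_sum) auto
  define C where "C = real CARD('n) * (1 + \<bar>ln (2 / t)\<bar>) + \<bar>ln M0\<bar> + 2 * \<bar>ln \<delta>\<bar> + \<bar>ln c0\<bar>"
  have "\<bar>ln (moment g z t)\<bar> \<le> C * 4 ^ ?S z" for z
  proof -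
    \<comment> \<open>Also when z i = 0, again by 0 ^ 0 = 1; hence the logarithm of the product
      splits.\<close>
    have ppos: "0 < (real (z i) * (2 / t)) ^ z i" for i
      using t by (cases "z i = 0") auto
    have "ln (moment g z t) \<le> ln ((\<Prod>i\<in>UNIV. (real (z i) * (2 / t)) ^ z i) * M0)"
      using up[of z] pos'[of z] by (subst ln_le_cancel_iff) auto
    also have "\<dots> = (\<Sum>i\<in>UNIV. ln ((real (z i) * (2 / t)) ^ z i)) + ln M0"
    proof -
      have "0 < (\<Prod>i\<in>UNIV. (real (z i) * (2 / t)) ^ z i)" using ppos by (intro prod_pos) blast
      from this M0 have "ln ((\<Prod>i\<in>UNIV. (real (z i) * (2 / t)) ^ z i) * M0)
          = ln (\<Prod>i\<in>UNIV. (real (z i) * (2 / t)) ^ z i) + ln M0"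
        by (rule ln_mult_pos)
      moreover have "(real (z i) * (2 / t)) ^ z i \<noteq> 0" for i using ppos[of i] by linarith
      then have "ln (\<Prod>i\<in>UNIV. (real (z i) * (2 / t)) ^ z i) = (\<Sum>i\<in>UNIV. ln ((real (z i) * (2 / t)) ^ z i))"
        by (intro ln_prod finite)
      ultimately show ?thesis by (simp only:)
    qed
    also have "(\<Sum>i\<in>UNIV. ln ((real (z i) * (2 / t)) ^ z i)) \<le> (\<Sum>i\<in>(UNIV::'n set). (1 + \<bar>ln (2 / t)\<bar>) * 4 ^ ?S z)"
    proof (rule sum_mono)
      fix i
      have "ln ((real (z i) * (2 / t)) ^ z i) \<le> (1 + \<bar>ln (2 / t)\<bar>) * 4 ^ z i"
      proof (cases "z i = 0")
        case False
        have "ln ((real (z i) * (2 / t)) ^ z i) = z i * (ln (real (z i)) + ln (2 / t))"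
        proof -
          have "ln (real (z i) * (2 / t)) = ln (real (z i)) + ln (2 / t)"
            using False t by (intro ln_mult_pos) auto
          moreover have "ln ((real (z i) * (2 / t)) ^ z i) = z i * ln (real (z i) * (2 / t))"
            by (rule ln_realpow)
          ultimately show ?thesis by (simp only:)
        qed
        also have "\<dots> \<le> z i * (real (z i) + \<bar>ln (2 / t)\<bar>)"
          using False ln_le_minus_one[of "real (z i)"] by (intro mult_left_mono add_mono) auto
        also have "\<dots> \<le> 4 ^ z i + 4 ^ z i * \<bar>ln (2 / t)\<bar>"
          unfolding distrib_left by (intro add_mono mult_right_mono square_le_4_power le_4_power) auto
        finally show ?thesis by (simp add: algebra_simps)
      qed simp
      also have "\<dots> \<le> (1 + \<bar>ln (2 / t)\<bar>) * 4 ^ ?S z"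
        by (intro mult_left_mono Si) auto
      finally show "ln ((real (z i) * (2 / t)) ^ z i) \<le> (1 + \<bar>ln (2 / t)\<bar>) * 4 ^ ?S z" .
    qed
    finally have u: "ln (moment g z t) \<le> real CARD('n) * (1 + \<bar>ln (2 / t)\<bar>) * 4 ^ ?S z + ln M0" by simp
    have "ln (\<delta> ^ (2 * ?S z) * c0) \<le> ln (moment g z t)"
      using low[of z] pos'[of z] c0 \<delta>(1) by (subst ln_le_cancel_iff) auto
    moreover have "ln (\<delta> ^ (2 * ?S z) * c0) = 2 * real (?S z) * ln \<delta> + ln c0"
      using c0 \<delta>(1) by (subst ln_mult) (auto simp: ln_realpow)
    moreover have "\<bar>real (?S z) * ln \<delta>\<bar> \<le> 4 ^ ?S z * \<bar>ln \<delta>\<bar>"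
      unfolding abs_mult abs_of_nat by (rule mult_right_mono[OF le_4_power]) simp
    moreover have "\<bar>ln c0\<bar> \<le> \<bar>ln c0\<bar> * 4 ^ ?S z" "\<bar>ln M0\<bar> \<le> \<bar>ln M0\<bar> * 4 ^ ?S z"
      using mult_left_mono[OF S1 abs_ge_zero] by simp_all
    moreover have "0 \<le> real CARD('n) * (1 + \<bar>ln (2 / t)\<bar>) * 4 ^ ?S z" "0 \<le> 4 ^ ?S z * \<bar>ln \<delta>\<bar>" by simp_all
    moreover have "C * 4 ^ ?S z = real CARD('n) * (1 + \<bar>ln (2 / t)\<bar>) * 4 ^ ?S z + \<bar>ln M0\<bar> * 4 ^ ?S z
        + 2 * (4 ^ ?S z * \<bar>ln \<delta>\<bar>) + \<bar>ln c0\<bar> * 4 ^ ?S z"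
      unfolding C_def by (simp only: distrib_right) (simp only: mult_ac)
    ultimately show ?thesis using u by linarith
  qed
  then show "\<exists>C. \<forall>z. \<bar>ln (moment g z t)\<bar> \<le> C * 4 ^ ?S z" by blast
qed

subsection \<open>Kullback--Leibler risk\<close>

no_notation Infinite_Sum.abs_summable_on (infixr "abs'_summable'_on" 46)

text \<open>Absolute summability makes the positive and the negative part finite, so the difference
  of extended reals is an ordinary one.\<close>

lemma ext_sum_eq_infsetsum:
  assumes "k abs_summable_on UNIV"
  shows "ext_sum (\<lambda>x. ereal (k x)) = ereal (infsetsum k UNIV)"
proof -
  have int: "integrable (count_space UNIV) k" using assms by (simp add: abs_summable_on_def)
  let ?P = "\<integral>\<^sup>+ x. ennreal (k x) \<partial>count_space UNIV" and ?N = "\<integral>\<^sup>+ x. ennreal (- k x) \<partial>count_space UNIV"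
  have fin: "?P \<noteq> \<infinity>" "?N \<noteq> \<infinity>"
    using int by (auto simp: real_integrable_def)
  have e: "enn2ereal X = ereal (enn2real X)" if "X \<noteq> \<infinity>" for X
    using that by (cases X) auto
  have "ext_sum (\<lambda>x. ereal (k x)) = enn2ereal ?P - enn2ereal ?N"
    by (simp add: ext_sum_def)
  also have "\<dots> = ereal (enn2real ?P - enn2real ?N)"
    using fin by (simp add: e)
  also have "enn2real ?P - enn2real ?N = infsetsum k UNIV"
    unfolding infsetsum_def using real_lebesgue_integral_def[OF int] by simp
  finally show ?thesis .
qed

text \<open>Jensen by the tangent of ln at the mean b: ln a \<le> ln b + (a / b - 1), with equality
  only at a = b. The weighted tangent values sum to ln b, so weak and strict form come from the same
  pointwise inequality.\<close>

lemma
  fixes w a :: "'a \<Rightarrow> real"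
  assumes A: "finite A" and w: "\<And>x. x \<in> A \<Longrightarrow> 0 \<le> w x" "sum w A = 1" and a: "\<And>x. x \<in> A \<Longrightarrow> 0 < a x"
    and B: "(\<Sum>x\<in>A. w x * a x) \<le> B"
  shows log_sum_le: "(\<Sum>x\<in>A. w x * ln (a x)) \<le> ln B"
    and log_sum_less: "u \<in> A \<Longrightarrow> v \<in> A \<Longrightarrow> 0 < w u \<Longrightarrow> 0 < w v \<Longrightarrow> a u \<noteq> a v \<Longrightarrow> (\<Sum>x\<in>A. w x * ln (a x)) < ln B"
proof -
  let ?b = "\<Sum>x\<in>A. w x * a x"
  have "\<exists>x\<in>A. w x \<noteq> 0"
  proof (rule ccontr)
    assume "\<not> ?thesis"
    then have "sum w A = 0" by (intro sum.neutral) auto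
    with w(2) show False by simp
  qed
  then obtain x0 where x0: "x0 \<in> A" "w x0 > 0" using w(1) by force
  have "0 < w x0 * a x0" using x0 a by simp
  also have "\<dots> \<le> ?b" using A w a by (intro member_le_sum) (auto simp: less_imp_le x0)
  finally have b: "0 < ?b" .
  have lnB: "ln ?b \<le> ln B" using b B by (subst ln_le_cancel_iff) auto
  have tot: "(\<Sum>x\<in>A. w x * (ln ?b + (a x / ?b - 1))) = ln ?b"
  proof -
    have "(\<Sum>x\<in>A. w x * (ln ?b + (a x / ?b - 1))) = (\<Sum>x\<in>A. ln ?b * w x + (w x * a x) / ?b - w x)"
      by (intro sum.cong refl) (simp add: algebra_simps)
    also have "\<dots> = ln ?b * sum w A + ?b / ?b - sum w A"
      by (simp only: sum.distrib sum_subtractf sum_distrib_left sum_divide_distrib)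
    finally show ?thesis using b w(2) by simp
  qed
  have pt: "ln (a x) \<le> ln ?b + (a x / ?b - 1)" if "x \<in> A" for x
    using ln_le_minus_one[of "a x / ?b"] a[OF that] b by (simp add: ln_div)
  have le: "w x * ln (a x) \<le> w x * (ln ?b + (a x / ?b - 1))" if "x \<in> A" for x
    by (rule mult_left_mono[OF pt[OF that] w(1)[OF that]])
  then have "(\<Sum>x\<in>A. w x * ln (a x)) \<le> (\<Sum>x\<in>A. w x * (ln ?b + (a x / ?b - 1)))" by (rule sum_mono)
  then show "(\<Sum>x\<in>A. w x * ln (a x)) \<le> ln B" using tot lnB by linarith
  assume uv: "u \<in> A" "v \<in> A" "0 < w u" "0 < w v" "a u \<noteq> a v"
  \<comment> \<open>Two different values cannot both equal the mean.\<close>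
  then obtain y where y: "y \<in> A" "0 < w y" "a y \<noteq> ?b" by metis
  have "ln (a y / ?b) \<noteq> a y / ?b - 1"
    using ln_eq_minus_one[of "a y / ?b"] a[OF y(1)] b y(3) by auto
  then have "ln (a y) < ln ?b + (a y / ?b - 1)"
    using pt[OF y(1)] a[OF y(1)] b by (simp add: ln_div)
  then have "w y * ln (a y) < w y * (ln ?b + (a y / ?b - 1))" using y(2) by simp
  then have "(\<Sum>x\<in>A. w x * ln (a x)) < (\<Sum>x\<in>A. w x * (ln ?b + (a x / ?b - 1)))"
    using le y(1) by (intro sum_strict_mono_ex1[OF A]) auto
  then show "(\<Sum>x\<in>A. w x * ln (a x)) < ln B" using tot lnB by linarith
qed

section \<open>Poisson sums and the risk as an absolutely convergent double sum\<close>

lemma poisson_lik_pos: "0 < c \<Longrightarrow> l \<in> pos_orthant \<Longrightarrow> 0 < poisson_lik c x l"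
  by (auto simp: poisson_lik_def pos_orthant_def intro!: prod_pos mult_pos_pos divide_pos_pos)

text \<open>The sum factors over the coordinates into exponential series at 4 c l_i.\<close>

lemma poisson_exp_moment_summable:
  fixes l :: "real^'n"
  shows "(\<lambda>x. poisson_lik c x l * 4 ^ (\<Sum>i\<in>UNIV. x i)) abs_summable_on UNIV"
proof -
  have "(\<lambda>x. \<Prod>i\<in>UNIV. (4 * (c * l $ i)) ^ x i / fact (x i) * exp (- (c * l $ i))) abs_summable_on PiE UNIV (\<lambda>_. UNIV)"
  proof (rule abs_summable_on_prod_PiE)
    fix i :: 'n
    have "summable (\<lambda>k. norm ((4 * (c * l $ i)) ^ k / fact k) * norm (exp (- (c * l $ i))))"
      using summable_norm_exp[of "4 * (c * l $ i)"] by (intro summable_mult2) (simp add: divide_inverse mult_ac)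
    then show "(\<lambda>k. (4 * (c * l $ i)) ^ k / fact k * exp (- (c * l $ i))) abs_summable_on UNIV"
      by (simp only: abs_summable_on_nat_iff' norm_mult)
  qed auto
  moreover have "(\<Prod>i\<in>UNIV. (4 * (c * l $ i)) ^ x i / fact (x i) * exp (- (c * l $ i)))
      = poisson_lik c x l * 4 ^ (\<Sum>i\<in>UNIV. x i)" for x
    unfolding poisson_lik_def power_sum prod.distrib[symmetric]
    by (intro prod.cong refl) (simp add: power_mult_distrib mult_ac)
  ultimately show ?thesis by (simp add: PiE_UNIV_domain)
qed

lemma poisson_pair_summable:
  fixes l :: "real^'n"
  assumes r: "0 < r" and s: "0 < s" and l: "l \<in> pos_orthant"
    and L: "\<And>x y. \<bar>L x y\<bar> \<le> C * (4 ^ (\<Sum>i\<in>UNIV. x i) * 4 ^ (\<Sum>i\<in>UNIV. y i))"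
  shows "(\<lambda>(x, y). poisson_lik r x l * (poisson_lik s y l * L x y)) abs_summable_on (UNIV \<times> UNIV)"
proof (rule abs_summable_on_comparison_test')
  show "(\<lambda>p. C * (case p of (x, y) \<Rightarrow> (poisson_lik r x l * 4 ^ (\<Sum>i\<in>UNIV. x i)) * (poisson_lik s y l * 4 ^ (\<Sum>i\<in>UNIV. y i))))
      abs_summable_on (UNIV \<times> UNIV)"
    by (intro abs_summable_on_cmult_right abs_summable_on_product poisson_exp_moment_summable countableI_type)
  fix p :: "('n \<Rightarrow> nat) \<times> ('n \<Rightarrow> nat)"
  obtain x y where p: "p = (x, y)" by (cases p)
  have pp: "0 < poisson_lik r x l * poisson_lik s y l" using r s l by (simp add: poisson_lik_pos)
  have "norm (poisson_lik r x l * (poisson_lik s y l * L x y)) = (poisson_lik r x l * poisson_lik s y l) * \<bar>L x y\<bar>"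
    using pp r s l by (simp add: abs_mult poisson_lik_pos less_imp_le)
  also have "\<dots> \<le> (poisson_lik r x l * poisson_lik s y l) * (C * (4 ^ (\<Sum>i\<in>UNIV. x i) * 4 ^ (\<Sum>i\<in>UNIV. y i)))"
    using pp L by (intro mult_left_mono) auto
  finally show "norm (case p of (x, y) \<Rightarrow> poisson_lik r x l * (poisson_lik s y l * L x y))
     \<le> C * (case p of (x, y) \<Rightarrow> (poisson_lik r x l * 4 ^ (\<Sum>i\<in>UNIV. x i)) * (poisson_lik s y l * 4 ^ (\<Sum>i\<in>UNIV. y i)))"
    by (simp add: p mult_ac)
qed

text \<open>Turns the nested extended sums into one absolutely convergent sum over pairs, which can
  be subtracted termwise and reindexed.\<close>

lemma KL_risk_eq_infsetsum:
  fixes l :: "real^'n"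
  assumes summable: "(\<lambda>(x, y). poisson_lik r x l * (poisson_lik s y l * L x y)) abs_summable_on (UNIV \<times> UNIV)"
    and pos: "\<And>x. 0 < poisson_lik r x l"
    and L: "\<And>x y. log_ratio (poisson_lik s y l) (q x y) = ereal (L x y)"
  shows "KL_risk r s q l = ereal (infsetsum (\<lambda>(x, y). poisson_lik r x l * (poisson_lik s y l * L x y)) (UNIV \<times> UNIV))"
proof -
  let ?h = "\<lambda>x y. poisson_lik s y l * L x y"
  have sx: "(\<lambda>y. poisson_lik r x l * ?h x y) abs_summable_on UNIV" for x
    using abs_summable_on_Sigma_project2[OF summable, of x] by simp
  have sh: "?h x abs_summable_on UNIV" for x
  proof -
    \<comment> \<open>Summability over pairs controls the inner sum only with the likelihood of x in
      front; that factor is positive and is divided out.\<close>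
    have "(\<lambda>y. inverse (poisson_lik r x l) * (poisson_lik r x l * ?h x y)) abs_summable_on UNIV"
      by (rule abs_summable_on_cmult_right[OF sx])
    then show ?thesis using pos[of x] by (simp add: mult.assoc[symmetric])
  qed
  have inner: "ext_sum (\<lambda>y. ereal (poisson_lik s y l) * log_ratio (poisson_lik s y l) (q x y)) = ereal (infsetsum (?h x) UNIV)" for x
    unfolding L using ext_sum_eq_infsetsum[OF sh[of x]] by simp
  have eq: "poisson_lik r x l * infsetsum (?h x) UNIV = infsetsum (\<lambda>y. poisson_lik r x l * ?h x y) UNIV" for x
    by (rule infsetsum_cmult_right[symmetric]) (use sh in auto)
  have s1: "(\<lambda>x. infsetsum (\<lambda>y. poisson_lik r x l * ?h x y) UNIV) abs_summable_on UNIV"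
    using abs_summable_on_Sigma_project1'[OF summable] by simp
  have "KL_risk r s q l = ext_sum (\<lambda>x. ereal (infsetsum (\<lambda>y. poisson_lik r x l * ?h x y) UNIV))"
    unfolding KL_risk_def inner using eq by simp
  also have "\<dots> = ereal (infsetsum (\<lambda>x. infsetsum (\<lambda>y. poisson_lik r x l * ?h x y) UNIV) UNIV)"
    by (rule ext_sum_eq_infsetsum[OF s1])
  also have "infsetsum (\<lambda>x. infsetsum (\<lambda>y. poisson_lik r x l * ?h x y) UNIV) UNIV
     = infsetsum (\<lambda>(x, y). poisson_lik r x l * ?h x y) (UNIV \<times> UNIV)"
    by (rule infsetsum_Times'[OF _ _ summable]) auto
  finally show ?thesis .
qed

text \<open>The Bernstein polynomial is the binomial mass of x given the total n; all dependence on
  l stays in the Poisson mass of n.\<close>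

lemma poisson_lik_split:
  fixes l :: "real^'n"
  assumes rs: "0 < r" "0 < s" and xn: "\<And>i. x i \<le> n i"
  shows "poisson_lik r x l * poisson_lik s (\<lambda>i. n i - x i) l
     = poisson_lik (r + s) n l * (\<Prod>i\<in>UNIV. Bernstein (n i) (x i) (r / (r + s)))"
  unfolding poisson_lik_def prod.distrib[symmetric]
proof (intro prod.cong refl)
  fix i :: 'n
  let ?k = "x i" and ?m = "n i" and ?l = "l $ i"
  \<comment> \<open>Replaces the truncated difference, which is exact because x i \<le> n i.\<close>
  define j where "j = ?m - ?k"
  have m: "?m = ?k + j" using xn[of i] by (simp add: j_def)
  have T: "r + s \<noteq> 0" using rs by simp
  have q: "1 - r / (r + s) = s / (r + s)" using T by (simp add: field_simps)
  have bin: "real (?m choose ?k) = fact ?m / (fact ?k * fact j)"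
    using binomial_fact[OF xn[of i], where 'a=real] by (simp add: j_def)
  have "((r + s) * ?l) ^ ?m * exp (- ((r + s) * ?l)) / fact ?m * Bernstein ?m ?k (r / (r + s))
      = ((r + s) * ?l) ^ (?k + j) * exp (- ((r + s) * ?l)) / fact ?m * (fact ?m / (fact ?k * fact j) * (r / (r + s)) ^ ?k * (s / (r + s)) ^ j)"
    unfolding Bernstein_def q bin j_def[symmetric] by (simp only: m[symmetric])
  also have "\<dots> = ((r + s) * ?l) ^ (?k + j) * (r / (r + s)) ^ ?k * (s / (r + s)) ^ j * exp (- ((r + s) * ?l)) / (fact ?k * fact j)"
    by simp
  also have "((r + s) * ?l) ^ (?k + j) * (r / (r + s)) ^ ?k * (s / (r + s)) ^ j = (r * ?l) ^ ?k * (s * ?l) ^ j"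
  proof -
    have "(u * p) ^ ?k * (u * q) ^ j = u ^ (?k + j) * p ^ ?k * q ^ j" for u p q :: real
      by (simp add: power_add power_mult_distrib)
    from this[of "(r + s) * ?l" "r / (r + s)" "s / (r + s)"] show ?thesis
      using T by (simp add: mult.commute)
  qed
  finally have T_eq: "((r + s) * ?l) ^ ?m * exp (- ((r + s) * ?l)) / fact ?m * Bernstein ?m ?k (r / (r + s))
      = (r * ?l) ^ ?k * (s * ?l) ^ j * exp (- ((r + s) * ?l)) / (fact ?k * fact j)" .
  have "exp (- ((r + s) * ?l)) = exp (- (r * ?l)) * exp (- (s * ?l))"
    by (simp add: exp_add[symmetric] algebra_simps)
  then show "(r * ?l) ^ ?k * exp (- (r * ?l)) / fact ?k * ((s * ?l) ^ (?m - ?k) * exp (- (s * ?l)) / fact (?m - ?k))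
    = ((r + s) * ?l) ^ ?m * exp (- ((r + s) * ?l)) / fact ?m * Bernstein ?m ?k (r / (r + s))"
    unfolding T_eq j_def[symmetric] by (simp add: mult_ac)
qed

text \<open>Pairs (x, y) are reindexed by (x + y, x). For a fixed total n the possible x fill the
  finite box below n, so the inner sum becomes an ordinary binomial average.\<close>

lemma infsetsum_poisson_pairs:
  fixes l :: "real^'n" and H :: "('n \<Rightarrow> nat) \<Rightarrow> ('n \<Rightarrow> nat) \<Rightarrow> real"
  assumes rs: "0 < r" "0 < s"
    and summable: "(\<lambda>(x, y). poisson_lik r x l * (poisson_lik s y l * H x (\<lambda>i. x i + y i))) abs_summable_on (UNIV \<times> UNIV)"
  defines "W \<equiv> \<lambda>n. poisson_lik (r + s) n l *
      (\<Sum>x\<in>PiE UNIV (\<lambda>i. {..n i}). (\<Prod>i\<in>UNIV. Bernstein (n i) (x i) (r / (r + s))) * H x n)"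
  shows "infsetsum (\<lambda>(x, y). poisson_lik r x l * (poisson_lik s y l * H x (\<lambda>i. x i + y i))) (UNIV \<times> UNIV)
      = infsetsum W UNIV" and "W abs_summable_on UNIV"
proof -
  let ?B = "\<lambda>n::'n \<Rightarrow> nat. PiE UNIV (\<lambda>i. {..n i})"
  let ?f = "\<lambda>(x, y). poisson_lik r x l * (poisson_lik s y l * H x (\<lambda>i. x i + y i))"
  let ?g = "\<lambda>(n::'n \<Rightarrow> nat, x::'n \<Rightarrow> nat). (x, \<lambda>i. n i - x i)"
  have bij: "bij_betw ?g (Sigma UNIV ?B) (UNIV \<times> UNIV)"
    by (rule bij_betw_byWitness[where f'="\<lambda>(x, y). (\<lambda>i. x i + y i, x)"]) (auto simp: PiE_iff)
  have fg: "?f (?g (n, x)) = poisson_lik (r + s) n l * ((\<Prod>i\<in>UNIV. Bernstein (n i) (x i) (r / (r + s))) * H x n)"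
    if "x \<in> ?B n" for n x
  proof -
    have le: "x i \<le> n i" for i using that by (auto simp: PiE_iff)
    then have "(\<lambda>i. x i + (n i - x i)) = n" by simp
    then have "?f (?g (n, x)) = (poisson_lik r x l * poisson_lik s (\<lambda>i. n i - x i) l) * H x n"
      by simp
    then show ?thesis unfolding poisson_lik_split[OF rs le] by (simp add: mult_ac)
  qed
  have fin: "finite (?B n)" for n by (intro finite_PiE) auto
  have s: "(\<lambda>p. ?f (?g p)) abs_summable_on (Sigma UNIV ?B)"
    using summable by (subst abs_summable_on_reindex_bij_betw[OF bij])
  have W: "infsetsum (\<lambda>x. ?f (?g (n, x))) (?B n) = W n" for n
  proof -
    have "infsetsum (\<lambda>x. ?f (?g (n, x))) (?B n) = (\<Sum>x\<in>?B n. ?f (?g (n, x)))"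
      by (rule infsetsum_finite[OF fin])
    also have "\<dots> = (\<Sum>x\<in>?B n. poisson_lik (r + s) n l * ((\<Prod>i\<in>UNIV. Bernstein (n i) (x i) (r / (r + s))) * H x n))"
      by (intro sum.cong refl fg)
    finally show ?thesis by (simp only: W_def sum_distrib_left)
  qed
  have "infsetsum ?f (UNIV \<times> UNIV) = infsetsum (\<lambda>p. ?f (?g p)) (Sigma UNIV ?B)"
    by (rule infsetsum_reindex_bij_betw[OF bij, symmetric])
  also have "\<dots> = infsetsum (\<lambda>n. infsetsum (\<lambda>x. ?f (?g (n, x))) (?B n)) UNIV"
    by (rule infsetsum_Sigma[OF _ _ s]) (auto intro: countable_finite fin)
  finally show "infsetsum ?f (UNIV \<times> UNIV) = infsetsum W UNIV" by (simp only: W)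
  have "(\<lambda>n. infsetsum (\<lambda>x. ?f (?g (n, x))) (?B n)) abs_summable_on UNIV"
    by (rule abs_summable_on_Sigma_project1'[where f="\<lambda>n x. ?f (?g (n, x))"]) (use s fin in \<open>auto intro: countable_finite simp: case_prod_unfold\<close>)
  then show "W abs_summable_on UNIV" by (simp only: W)
qed

lemma infsetsum_pos:
  fixes W :: "'a \<Rightarrow> real"
  assumes "W abs_summable_on UNIV" "\<And>n. 0 \<le> W n" "0 < W n"
  shows "0 < infsetsum W UNIV"
proof -
  have "infsetsum W {n} \<le> infsetsum W UNIV"
    using assms by (intro infsetsum_mono_neutral_left) auto
  then show ?thesis using assms(3) by simp
qed

text \<open>The logarithm in the risk written with moments. The factor s^y / y! is absent because
  likelihood and predictive distribution share it; the first sum does not involve \<open>g\<close>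
  and cancels between two priors.\<close>

definition log_likelihood_ratio :: "real \<Rightarrow> real \<Rightarrow> real^'n \<Rightarrow> (real^'n \<Rightarrow> real) \<Rightarrow> ('n \<Rightarrow> nat) \<Rightarrow> ('n \<Rightarrow> nat) \<Rightarrow> real" where
  "log_likelihood_ratio r s l g x y = (\<Sum>i\<in>UNIV. real (y i) * ln (l $ i) - s * l $ i)
      - ln (moment g (\<lambda>i. x i + y i) (r + s)) + ln (moment g x r)"

text \<open>The bound 4^(x + y) on the logarithm of a moment splits into a factor in x and one in y,
  so the Poisson exponential moments give summability over pairs.\<close>

lemma
  fixes g :: "real^'n \<Rightarrow> real"
  assumes cont: "continuous_on UNIV g" and nonneg: "\<And>\<theta>. 0 \<le> g \<theta>" and pos: "0 < g \<theta>0"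
    and int: "\<And>z t. t > 0 \<Longrightarrow> integrable lborel (\<lambda>\<theta>. g \<theta> * gauss_moment z t \<theta>)"
    and even: "\<And>\<theta>. g (\<chi> i. \<bar>\<theta> $ i\<bar>) = g \<theta>"
    and r: "0 < r" and s: "0 < s" and l: "l \<in> pos_orthant"
  shows log_likelihood_ratio_summable: "(\<lambda>(x, y). poisson_lik r x l * (poisson_lik s y l * log_likelihood_ratio r s l g x y)) abs_summable_on (UNIV \<times> UNIV)" (is ?S)
    and KL_risk_weighted_jeffreys: "KL_risk r s (predictive r s (weighted_jeffreys_prior g)) l
      = ereal (infsetsum (\<lambda>(x, y). poisson_lik r x l * (poisson_lik s y l * log_likelihood_ratio r s l g x y)) (UNIV \<times> UNIV))"
proof -
  have T: "0 < r + s" using r s by simp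
  note M = moment_pos_log_bound[OF cont nonneg pos int]
  obtain C1 where C1: "\<And>z. \<bar>ln (moment g z (r + s))\<bar> \<le> C1 * 4 ^ (\<Sum>i\<in>UNIV. z i)"
    using M(2)[OF _ T] by blast
  obtain C2 where C2: "\<And>z. \<bar>ln (moment g z r)\<bar> \<le> C2 * 4 ^ (\<Sum>i\<in>UNIV. z i)"
    using M(2)[OF _ r] by blast
  define C0 where "C0 = (\<Sum>i\<in>UNIV. \<bar>ln (l $ i)\<bar> + s * l $ i)"
  have lp: "0 < l $ i" for i using l by (auto simp: pos_orthant_def)
  have "\<bar>log_likelihood_ratio r s l g x y\<bar> \<le> (C0 + C1 + C2) * (4 ^ (\<Sum>i\<in>UNIV. x i) * 4 ^ (\<Sum>i\<in>UNIV. y i))" for x y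
  proof -
    let ?X = "4 ^ (\<Sum>i\<in>UNIV. x i) :: real" and ?Y = "4 ^ (\<Sum>i\<in>UNIV. y i) :: real"
    have XY: "1 \<le> ?X" "1 \<le> ?Y" by simp_all
    have "\<bar>\<Sum>i\<in>UNIV. real (y i) * ln (l $ i) - s * l $ i\<bar> \<le> (\<Sum>i\<in>UNIV. (\<bar>ln (l $ i)\<bar> + s * l $ i) * ?Y)"
    proof (rule order_trans[OF sum_abs sum_mono])
      fix i
      have "real (y i) \<le> 4 ^ y i" by (rule le_4_power)
      also have "\<dots> \<le> ?Y" by (intro power_increasing member_le_sum) auto
      finally have "real (y i) * \<bar>ln (l $ i)\<bar> \<le> ?Y * \<bar>ln (l $ i)\<bar>" by (intro mult_right_mono) auto
      moreover have "s * l $ i \<le> s * l $ i * ?Y"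
        using XY s lp[of i] mult_left_mono[of 1 ?Y "s * l $ i"] by simp
      moreover have "\<bar>real (y i) * ln (l $ i) - s * l $ i\<bar> \<le> real (y i) * \<bar>ln (l $ i)\<bar> + s * l $ i"
        using s lp[of i] by (intro order_trans[OF abs_triangle_ineq4]) (simp add: abs_mult)
      ultimately show "\<bar>real (y i) * ln (l $ i) - s * l $ i\<bar> \<le> (\<bar>ln (l $ i)\<bar> + s * l $ i) * ?Y"
        by (simp add: algebra_simps)
    qed
    also have "\<dots> = C0 * ?Y" by (simp add: C0_def sum_distrib_right)
    also have "\<dots> \<le> C0 * (?X * ?Y)"
    proof -
      have "0 \<le> C0" unfolding C0_def using s lp by (intro sum_nonneg) (simp add: less_imp_le)
      then show ?thesis using XY mult_right_mono[of 1 ?X ?Y] by (intro mult_left_mono) auto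
    qed
    finally have a: "\<bar>\<Sum>i\<in>UNIV. real (y i) * ln (l $ i) - s * l $ i\<bar> \<le> C0 * (?X * ?Y)" .
    have b: "\<bar>ln (moment g (\<lambda>i. x i + y i) (r + s))\<bar> \<le> C1 * (?X * ?Y)"
      using C1[of "\<lambda>i. x i + y i"] by (simp add: sum.distrib power_add)
    have "0 \<le> C2" using C2[of "\<lambda>_. 0"] by simp
    then have "C2 * ?X \<le> C2 * (?X * ?Y)" using XY mult_left_mono[of 1 ?Y ?X] by (intro mult_left_mono) auto
    then have c: "\<bar>ln (moment g x r)\<bar> \<le> C2 * (?X * ?Y)" using C2[of x] by linarith
    show ?thesis
      unfolding log_likelihood_ratio_def distrib_right using a b c by linarith
  qed
  then show ?S by (rule poisson_pair_summable[OF r s l])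
  moreover have "log_ratio (poisson_lik s y l) (predictive r s (weighted_jeffreys_prior g) x y)
      = ereal (log_likelihood_ratio r s l g x y)" for x y
  proof -
    let ?c = "\<Prod>i\<in>UNIV. s ^ y i / fact (y i)" and ?e = "\<Prod>i\<in>UNIV. (l $ i) ^ y i * exp (- (s * l $ i))"
    let ?Mxy = "moment g (\<lambda>i. x i + y i) (r + s)" and ?Mx = "moment g x r"
    have gm: "g \<in> borel_measurable borel" using cont by (rule borel_measurable_continuous_onI)
    have p: "predictive r s (weighted_jeffreys_prior g) x y = ?c * ?Mxy / ?Mx"
      by (rule predictive_eq_moment[OF gm even r])
    have Mp: "0 < ?Mxy" "0 < ?Mx" using M(1)[OF _ T] M(1)[OF _ r] by blast+
    have c: "0 < ?c" using s by (intro prod_pos) auto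
    have e: "0 < ?e" using lp by (intro prod_pos) (auto intro!: mult_pos_pos)
    have lik: "poisson_lik s y l = ?c * ?e"
      unfolding poisson_lik_def prod.distrib[symmetric]
      by (intro prod.cong refl) (simp add: power_mult_distrib)
    have ratio: "poisson_lik s y l / predictive r s (weighted_jeffreys_prior g) x y = ?e * ?Mx / ?Mxy"
    proof -
      have "c * e / (c * A / B) = e * B / A" if "0 < c" "0 < A" "0 < B" for c e A B :: real
        using that by (simp add: field_simps)
      from this[OF c Mp] show ?thesis unfolding p lik .
    qed
    have "ln (poisson_lik s y l / predictive r s (weighted_jeffreys_prior g) x y) = ln ?e + ln ?Mx - ln ?Mxy"
    proof -
      have "ln (a * b / c) = ln a + ln b - ln c" if "0 < a" "0 < b" "0 < c" for a b c :: real
        using that by (simp add: ln_mult ln_div)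
      from this[OF e Mp(2,1)] show ?thesis
        by (simp only: ratio)
    qed
    also have "ln ?e = (\<Sum>i\<in>UNIV. ln ((l $ i) ^ y i * exp (- (s * l $ i))))"
      using lp by (intro ln_prod) (auto simp: less_imp_neq[OF lp, symmetric])
    also have "\<dots> = (\<Sum>i\<in>UNIV. real (y i) * ln (l $ i) - s * l $ i)"
    proof (intro sum.cong refl)
      fix i
      show "ln ((l $ i) ^ y i * exp (- (s * l $ i))) = real (y i) * ln (l $ i) - s * l $ i"
        using lp[of i] by (subst ln_mult_pos) (auto simp: ln_realpow)
    qed
    finally have "ln (poisson_lik s y l / predictive r s (weighted_jeffreys_prior g) x y) = log_likelihood_ratio r s l g x y"
      by (simp add: log_likelihood_ratio_def)
    \<comment> \<open>Excludes the infinite branch of \<open>log_ratio\<close>.\<close>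
    moreover have "predictive r s (weighted_jeffreys_prior g) x y \<noteq> 0" unfolding p using c Mp s by simp
    ultimately show ?thesis by (simp add: log_ratio_def)
  qed
  ultimately show "KL_risk r s (predictive r s (weighted_jeffreys_prior g)) l
      = ereal (infsetsum (\<lambda>(x, y). poisson_lik r x l * (poisson_lik s y l * log_likelihood_ratio r s l g x y)) (UNIV \<times> UNIV))"
    by (intro KL_risk_eq_infsetsum poisson_lik_pos r l)
qed

theorem corollary1:
  fixes h f :: "real^'n \<Rightarrow> real" and r s :: real
  assumes "r > 0" and "s > 0"
    and "C2 h" and "superharmonic h"
    and "f = sign_symmetrize h"
    and "\<forall>\<theta>\<in>nonneg_orthant. 0 \<le> f \<theta>"
    and "\<exists>\<theta>\<in>nonneg_orthant. f \<theta> \<noteq> 0"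
    and "\<And>z t. t > 0 \<Longrightarrow>
      set_integrable lborel nonneg_orthant (\<lambda>\<theta>. f \<theta> * gauss_moment z t \<theta>)"
    and "\<And>z t i. t > 0 \<Longrightarrow>
      set_integrable lborel nonneg_orthant (\<lambda>\<theta>. \<bar>partial i f \<theta>\<bar> * gauss_moment z t \<theta>)"
    and "\<And>z t i. t > 0 \<Longrightarrow>
      set_integrable lborel nonneg_orthant (\<lambda>\<theta>. \<bar>partial i (partial i f) \<theta>\<bar> * gauss_moment z t \<theta>)"
  shows "weakly_dominates r s (predictive r s (weighted_jeffreys_prior f)) (predictive r s jeffreys_prior)
    \<and> (\<not> (\<lambda>z. gamma_average f z r) constant_on UNIV \<longrightarrow>
      dominates r s (predictive r s (weighted_jeffreys_prior f)) (predictive r s jeffreys_prior))"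
proof -
  note r = assms(1) and s = assms(2)
  have T: "0 < r + s" and rT: "r \<le> r + s" using r s by auto
  have C2f: "C2 f" unfolding assms(5) by (rule C2_sign_symmetrize[OF assms(3)])
  have lap: "(\<Sum>i\<in>UNIV. partial i (partial i f) \<theta>) \<le> 0" for \<theta>
    using superharmonic_sign_symmetrize[OF assms(3,4)] by (simp add: superharmonic_def assms(5))
  have hp: "has_partials f" "has_partials (partial i f)" and cf: "continuous_on UNIV f"
    and cp: "continuous_on UNIV (partial i f)" "continuous_on UNIV (partial i (partial i f))" for i
    using C2f by (auto simp: C2_def)
  have flip0: "f (flip a \<theta>) = 1 * f \<theta>" if "a \<in> sign_vectors" for a \<theta>
    unfolding assms(5) using sign_symmetrize_flip[OF that] by simp
  have flip1: "partial i f (flip a \<theta>) = a i * partial i f \<theta>" if "a \<in> sign_vectors" for a \<theta> i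
    using partial_flip[OF hp(1) that flip0[OF that]] by simp
  have flip2: "partial i (partial i f) (flip a \<theta>) = partial i (partial i f) \<theta>" if "a \<in> sign_vectors" for a \<theta> i
    using partial_flip[OF hp(2) that flip1[OF that]] sign_vector_square[OF that] by simp
  have abs1: "\<bar>a i\<bar> = (1::real)" if "a \<in> sign_vectors" for a and i :: 'n
    using sign_vector_square[OF that, of i] by (metis abs_mult_self_eq abs_square_eq_1 power2_eq_square)
  have even: "f (\<chi> i. \<bar>\<theta> $ i\<bar>) = f \<theta>" for \<theta>
  proof -
    have "(\<chi> i. \<bar>\<theta> $ i\<bar>) = flip (\<lambda>i. if 0 \<le> \<theta> $ i then 1 else - 1) \<theta>"
      by (auto simp: flip_def vec_eq_iff)
    moreover have "(\<lambda>i. if 0 \<le> \<theta> $ i then 1 else - 1) \<in> sign_vectors" by (auto simp: sign_vectors_iff)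
    ultimately show ?thesis using flip0 by simp
  qed
  have nonneg: "0 \<le> f \<theta>" for \<theta>
  proof -
    have "(\<chi> i. \<bar>\<theta> $ i\<bar>) \<in> nonneg_orthant" by (simp add: nonneg_orthant_def)
    then have "0 \<le> f (\<chi> i. \<bar>\<theta> $ i\<bar>)" using assms(6) by blast
    then show ?thesis by (simp only: even)
  qed
  obtain \<theta>0 where pos: "0 < f \<theta>0" using assms(7) nonneg by (metis less_le)
  note mc = borel_measurable_continuous_onI
  have i0: "integrable lborel (\<lambda>\<theta>. f \<theta> * gauss_moment z t \<theta>)" if "t > 0" for z t
    by (rule integrable_gauss_moment_of_orthant[OF mc[OF cf]])
      (use assms(8)[OF that] nonneg flip0 in auto)
  have i1: "integrable lborel (\<lambda>\<theta>. partial i f \<theta> * gauss_moment z t \<theta>)" if "t > 0" for z t i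
    by (rule integrable_gauss_moment_of_orthant[OF mc[OF cp(1)]])
      (use assms(9)[OF that] flip1 abs1 in \<open>auto simp: abs_mult\<close>)
  have i2: "integrable lborel (\<lambda>\<theta>. partial i (partial i f) \<theta> * gauss_moment z t \<theta>)" if "t > 0" for z t i
    by (rule integrable_gauss_moment_of_orthant[OF mc[OF cp(2)]])
      (use assms(10)[OF that] flip2 in auto)
  define F where "F z t = (\<Prod>i\<in>UNIV. gamma_const (z i) t) * moment f z t" for z t
  have c: "0 < (\<Prod>i\<in>UNIV. gamma_const (z i) t)" if "0 < t" for z :: "'n \<Rightarrow> nat" and t
    using gamma_const_pos[OF that] by (intro prod_pos) auto
  have M: "0 < moment f z t" if "0 < t" for z t
    by (rule moment_pos_log_bound(1)[OF cf nonneg pos i0 that])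
  have Fpos: "0 < F z t" if "0 < t" for z t
    unfolding F_def using c[OF that] M[OF that] by simp
  \<comment> \<open>The normalising constants are the reciprocals of the moments of the weight 1, so
    ln F compares f with the Jeffreys case.\<close>
  have lnF: "ln (F z t) = ln (moment f z t) - ln (moment (\<lambda>_. 1) z t)" if "0 < t" for z t
  proof -
    have "moment (\<lambda>_. 1) z t = 1 / (\<Prod>i\<in>UNIV. gamma_const (z i) t)"
      by (simp add: moment_one[OF that] prod_dividef)
    moreover have "ln (a * b) = ln b - ln (1 / a)" if "0 < a" "0 < b" for a b :: real
      using that by (simp add: ln_mult ln_div)
    ultimately show ?thesis
      unfolding F_def using c[OF that, of z] M[OF that, of z] by (simp only:)
  qed
  have gF: "gamma_average f z r = F z r" for z
    unfolding F_def by (rule gamma_average_eq_moment[OF mc[OF cf] even])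
  let ?w = "\<lambda>n x. \<Prod>i\<in>(UNIV::'n set). Bernstein (n i) (x i) (r / (r + s))"
  let ?B = "\<lambda>n::'n \<Rightarrow> nat. PiE UNIV (\<lambda>i. {..n i})"
  \<comment> \<open>Strictly between 0 and 1, so every index in the box has positive weight; the
    strict form of Jensen's inequality relies on this.\<close>
  have p: "0 < r / (r + s)" "r / (r + s) < 1" using r s by auto
  have finB: "finite (?B n)" for n by (intro finite_PiE) auto
  have w0: "0 \<le> ?w n x" for n x
    using p by (intro prod_nonneg_UNIV Bernstein_nonneg) auto
  have wpos: "0 < ?w n x" if "x \<in> ?B n" for n x
    using p that by (intro prod_pos) (auto intro!: Bernstein_pos simp: PiE_iff)
  have w1: "sum (?w n) (?B n) = 1" for n
  proof -
    have "(\<Prod>i\<in>(UNIV::'n set). \<Sum>k\<in>{..n i}. Bernstein (n i) k (r / (r + s))) = sum (?w n) (?B n)"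
      by (rule prod_sum_PiE) auto
    then show ?thesis by simp
  qed
  have key: "(\<Sum>x\<in>?B n. ?w n x * F x r) \<le> F n (r + s)" for n
    unfolding F_def by (rule bernstein_average_le[OF C2f lap r rT i0[OF r] i1[OF r] i2[OF r]])
  \<comment> \<open>The share of the risk difference that comes from pairs with x + y = n.\<close>
  define gain where "gain l n = poisson_lik (r + s) n l * (\<Sum>x\<in>?B n. ?w n x * (ln (F n (r + s)) - ln (F x r)))" for l n
  have sum_eq: "(\<Sum>x\<in>?B n. ?w n x * (ln (F n (r + s)) - ln (F x r))) = ln (F n (r + s)) - (\<Sum>x\<in>?B n. ?w n x * ln (F x r))" for n
    using w1[of n] by (simp add: right_diff_distrib sum_subtractf sum_distrib_right[symmetric])
  have gain_nonneg: "0 \<le> gain l n" if "l \<in> pos_orthant" for l n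
    unfolding gain_def sum_eq
    using log_sum_le[OF finB w0 w1 Fpos[OF r] key] poisson_lik_pos[OF T that, of n]
    by (intro mult_nonneg_nonneg) auto
  have risk: "\<exists>a b. KL_risk r s (predictive r s (weighted_jeffreys_prior f)) l = ereal a
     \<and> KL_risk r s (predictive r s jeffreys_prior) l = ereal b
     \<and> b - a = infsetsum (gain l) UNIV \<and> gain l abs_summable_on UNIV" if l: "l \<in> pos_orthant" for l
  proof -
    let ?pp = "\<lambda>L (x, y). poisson_lik r x l * (poisson_lik s y l * L x y)"
    let ?L = "log_likelihood_ratio r s l"
    \<comment> \<open>The hypotheses of the risk formula for the constant weight 1; the last item is
      its evenness.\<close>
    have one: "continuous_on UNIV (\<lambda>_::real^'n. 1::real)" "\<And>\<theta>::real^'n. 0 \<le> (1::real)" "0 < (1::real)"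
      "\<And>z t. t > 0 \<Longrightarrow> integrable lborel (\<lambda>\<theta>::real^'n. 1 * gauss_moment z t \<theta>)"
      "\<And>\<theta>::real^'n. (1::real) = 1"
      using integrable_gauss_moment by auto
    note S1 = log_likelihood_ratio_summable[where g="\<lambda>_. 1", OF one r s l]
    note K1 = KL_risk_weighted_jeffreys[where g="\<lambda>_. 1", OF one r s l, folded jeffreys_prior_eq_weighted]
    note Sf = log_likelihood_ratio_summable[OF cf nonneg pos i0 even r s l]
    note Kf = KL_risk_weighted_jeffreys[OF cf nonneg pos i0 even r s l]
    let ?H = "\<lambda>x n. ln (F n (r + s)) - ln (F x r)"
    have "?L (\<lambda>_. 1) x y - ?L f x y = ?H x (\<lambda>i. x i + y i)" for x y
      by (simp add: log_likelihood_ratio_def lnF[OF T] lnF[OF r])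
    then have diff: "?pp (?L (\<lambda>_. 1)) p - ?pp (?L f) p = ?pp (\<lambda>x y. ?H x (\<lambda>i. x i + y i)) p" for p
      by (cases p) (simp add: right_diff_distrib[symmetric])
    have SH: "?pp (\<lambda>x y. ?H x (\<lambda>i. x i + y i)) abs_summable_on (UNIV \<times> UNIV)"
      using abs_summable_on_diff[OF S1 Sf] unfolding diff .
    have "infsetsum (?pp (?L (\<lambda>_. 1))) (UNIV \<times> UNIV) - infsetsum (?pp (?L f)) (UNIV \<times> UNIV)
        = infsetsum (?pp (\<lambda>x y. ?H x (\<lambda>i. x i + y i))) (UNIV \<times> UNIV)"
      using infsetsum_diff[OF S1 Sf] unfolding diff by simp
    also have "\<dots> = infsetsum (gain l) UNIV"
      unfolding gain_def[abs_def] by (rule infsetsum_poisson_pairs(1)[OF r s SH])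
    finally show ?thesis
      using K1 Kf infsetsum_poisson_pairs(2)[OF r s SH] unfolding gain_def[abs_def] by blast
  qed
  have weak: "weakly_dominates r s (predictive r s (weighted_jeffreys_prior f)) (predictive r s jeffreys_prior)"
    unfolding weakly_dominates_def
  proof
    fix l :: "real^'n" assume l: "l \<in> pos_orthant"
    obtain a b where ab: "KL_risk r s (predictive r s (weighted_jeffreys_prior f)) l = ereal a"
      "KL_risk r s (predictive r s jeffreys_prior) l = ereal b" "b - a = infsetsum (gain l) UNIV"
      using risk[OF l] by blast
    have "0 \<le> infsetsum (gain l) UNIV" by (intro infsetsum_nonneg gain_nonneg l)
    then show "KL_risk r s (predictive r s (weighted_jeffreys_prior f)) l \<le> KL_risk r s (predictive r s jeffreys_prior) l"
      using ab by simp
  qed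
  moreover have "dominates r s (predictive r s (weighted_jeffreys_prior f)) (predictive r s jeffreys_prior)"
    if "\<not> (\<lambda>z. gamma_average f z r) constant_on UNIV"
  proof -
    have "\<exists>u v. F u r \<noteq> F v r"
    proof (rule ccontr)
      assume "\<not> ?thesis"
      then have "F z r = F (\<lambda>_. 0) r" for z by blast
      then have "(\<lambda>z. gamma_average f z r) constant_on UNIV" unfolding constant_on_def gF by blast
      with that show False by blast
    qed
    then obtain u v where uv: "F u r \<noteq> F v r" by blast
    \<comment> \<open>The smallest total whose box contains both u and v.\<close>
    define n where "n i = max (u i) (v i)" for i
    have B: "u \<in> ?B n" "v \<in> ?B n" by (auto simp: n_def PiE_iff)
    \<comment> \<open>One intensity suffices for strictness; at every l in the positive orthant the
      total n has positive probability.\<close>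
    define l :: "real^'n" where "l = (\<chi> i. 1)"
    have l: "l \<in> pos_orthant" by (simp add: l_def pos_orthant_def)
    have "(\<Sum>x\<in>?B n. ?w n x * ln (F x r)) < ln (F n (r + s))"
      by (rule log_sum_less[where A="?B n" and w="?w n" and a="\<lambda>x. F x r" and u=u and v=v,
            OF finB w0 w1 Fpos[OF r] key B wpos[OF B(1)] wpos[OF B(2)] uv])
    then have "0 < gain l n"
      unfolding gain_def sum_eq using poisson_lik_pos[OF T l, of n] by simp
    obtain a b where ab: "KL_risk r s (predictive r s (weighted_jeffreys_prior f)) l = ereal a"
      "KL_risk r s (predictive r s jeffreys_prior) l = ereal b" "b - a = infsetsum (gain l) UNIV"
      and S: "gain l abs_summable_on UNIV"
      using risk[OF l] by blast
    have "0 < infsetsum (gain l) UNIV"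
      by (rule infsetsum_pos[where n=n]) (use S gain_nonneg[OF l] \<open>0 < gain l n\<close> in auto)
    then have "KL_risk r s (predictive r s (weighted_jeffreys_prior f)) l < KL_risk r s (predictive r s jeffreys_prior) l"
      using ab by simp
    with weak l show ?thesis unfolding dominates_def by blast
  qed
  ultimately show ?thesis by blast
qed

end
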